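(* Let $X$ be a compact complex manifold and let $\omega$ be a Levi-Civita Ricci-flat Hermitian metric on $X$, i.e. $\mathfrak{Ric}(\omega)=0$. If $X$ satisfies the $\partial\bar\partial$-lemma, then $(X,\omega)$ is conformally balanced and the canonical bundle $K_X$ is unitary flat.
   Context: Let $n=\dim_{\mathbb C}X$. $X$ satisfies (supports) the $\partial\bar\partial$-lemma if every form $\eta$ which is $d$-exact, $\partial$-closed and $\bar\partial$-closed is $\partial\bar\partial$-exact; in particular, on such $X$, every pure-type form $\varphi\in\Omega^{p,q}(X)$ that is $\bar\partial$-closed and $\partial$-exact is $\partial\bar\partial$-exact. A Hermitian metric is balanced if its fundamental form satisfies $d\omega^{n-1}=0$; $(X,\omega)$ is conformally balanced if $e^f\omega$ is balanced for some $f\in C^\infty(X,\mathbb R)$. $K_X$ is unitary flat if it carries a smooth Hermitian metric with vanishing (Chern) curvature; equivalently, $X$ has a Hermitian metric $\omega'$ with $\mathrm{Ric}(\omega')=-\sqrt{-1}\,\partial\bar\partial\log\det(\omega')=0$. Levi-Civita Ricci curvature: let $(X,\omega)$ be a Hermitian manifold with $\omega=\sqrt{-1}\,h_{i\bar j}\,dz^i\wedge d\bar z^j$ in local holomorphic coordinates, and extend the Levi-Civita connection of the background Riemannian metric $\mathbb{C}$-linearly to $T_{\mathbb C}X=T^{1,0}X\oplus T^{0,1}X$. Composing it with the projection to $T^{1,0}X$ gives the Levi-Civita connection $\nabla^{\mathrm{LC}}$ on $T^{1,0}X$, with coefficients $\nabla^{\mathrm{LC}}_{\partial/\partial z^i}\frac{\partial}{\partial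 z^k}=\Gamma_{ik}^p\frac{\partial}{\partial z^p}$ and $\nabla^{\mathrm{LC}}_{\partial/\partial\bar z^j}\frac{\partial}{\partial z^k}=\Gamma_{\bar jk}^p\frac{\partial}{\partial z^p}$, where $$\Gamma_{ij}^k=\tfrac12 h^{k\bar\ell}\Big(\frac{\partial h_{j\bar\ell}}{\partial z^i}+\frac{\partial h_{i\bar\ell}}{\partial z^j}\Big),\qquad \Gamma_{\bar ij}^k=\tfrac12 h^{k\bar\ell}\Big(\frac{\partial h_{j\bar\ell}}{\partial\bar z^i}-\frac{\partial h_{j\bar i}}{\partial\bar z^\ell}\Big).$$ The $(1,1)$ components of its curvature are $$\mathfrak R_{i\bar jk}^{\ell}=-\Big(\frac{\partial\Gamma_{ik}^\ell}{\partial\bar z^j}-\frac{\partial\Gamma_{\bar jk}^\ell}{\partial z^i}+\Gamma_{ik}^s\Gamma_{\bar js}^\ell-\Gamma_{\bar jk}^s\Gamma_{si}^\ell\Big).$$ The (first) Levi-Civita Ricci curvature is $\mathfrak{Ric}(\omega)=\sqrt{-1}\,\mathfrak R_{i\bar jk}^{k}\,dz^i\wedge d\bar z^j$ (sum over $k$). The metric $\omega$ is Levi-Civita Ricci-flat if $\mathfrak{Ric}(\omega)=0$. *)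

theory Defs
  imports "HOL-Analysis.Analysis"
begin

section \<open>Smooth and holomorphic maps\<close>

text \<open>Real differentiability classes, to be used on open sets \<open>S\<close> only.\<close>

primrec Ck_on :: "nat \<Rightarrow> ('a::real_normed_vector \<Rightarrow> 'b::real_normed_vector) \<Rightarrow> 'a set \<Rightarrow> bool" where
  "Ck_on 0 f S \<longleftrightarrow> continuous_on S f"
| "Ck_on (Suc k) f S \<longleftrightarrow> (\<forall>x\<in>S. f differentiable (at x)) \<and>
     (\<forall>v. Ck_on k (\<lambda>x. frechet_derivative f (at x) v) S)"

definition smooth_map_on :: "('a::real_normed_vector \<Rightarrow> 'b::real_normed_vector) \<Rightarrow> 'a set \<Rightarrow> bool" where
  "smooth_map_on f S \<longleftrightarrow> (\<forall>k. Ck_on k f S)"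

text \<open>A map between open subsets of \<open>\<complex>\<^sup>n\<close> is holomorphic if it is smooth and satisfies the
  Cauchy--Riemann equations, i.e. its real differential is complex linear.\<close>

definition holomorphic_map_on :: "(complex^'n \<Rightarrow> complex^'m) \<Rightarrow> (complex^'n) set \<Rightarrow> bool" where
  "holomorphic_map_on f S \<longleftrightarrow> smooth_map_on f S \<and>
     (\<forall>x\<in>S. \<forall>c v. frechet_derivative f (at x) (c *s v) = c *s frechet_derivative f (at x) v)"

section \<open>Complex manifolds\<close>

text \<open>A chart is a pair of its domain and its coordinate map; the coordinate map is
  irrelevant outside the domain.\<close>

type_synonym ('p, 'n) chart = "'p set \<times> ('p \<Rightarrow> complex^'n)"

definition cimage :: "('p, 'n::finite) chart \<Rightarrow> (complex^'n) set" where
  "cimage c = snd c ` fst c"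

definition cinv :: "('p, 'n::finite) chart \<Rightarrow> complex^'n \<Rightarrow> 'p" where
  "cinv c = inv_into (fst c) (snd c)"

definition overlap :: "('p, 'n::finite) chart \<Rightarrow> ('p, 'n) chart \<Rightarrow> (complex^'n) set" where
  "overlap c c' = snd c ` (fst c \<inter> fst c')"

text \<open>Change of coordinates from \<open>c\<close> to \<open>c'\<close>, defined on \<open>overlap c c'\<close>.\<close>

definition transition :: "('p, 'n::finite) chart \<Rightarrow> ('p, 'n) chart \<Rightarrow> complex^'n \<Rightarrow> complex^'n" where
  "transition c c' = snd c' \<circ> cinv c"

definition chart_on :: "'p topology \<Rightarrow> ('p, 'n::finite) chart \<Rightarrow> bool" where
  "chart_on X c \<longleftrightarrow> openin X (fst c) \<and> open (cimage c) \<and>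
     homeomorphic_map (subtopology X (fst c)) (top_of_set (cimage c)) (snd c)"

text \<open>\<open>A\<close> is a holomorphic atlas of the Hausdorff space \<open>X\<close>, of complex dimension \<open>CARD('n)\<close>.
  Second countability is not listed: it is automatic on the compact spaces considered here.\<close>

definition complex_manifold :: "'p topology \<Rightarrow> ('p, 'n::finite) chart set \<Rightarrow> bool" where
  "complex_manifold X A \<longleftrightarrow> Hausdorff_space X \<and> (\<forall>c\<in>A. chart_on X c) \<and> (\<Union>c\<in>A. fst c) = topspace X \<and>
     (\<forall>c\<in>A. \<forall>c'\<in>A. holomorphic_map_on (transition c c') (overlap c c'))"

section \<open>Complex differential forms in coordinates\<close>

text \<open>A complex-valued form of possibly mixed degree on (an open subset of) \<open>\<complex>\<^sup>n\<close> is evaluated on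
  finite lists of tangent vectors: its component of degree \<open>k\<close> at \<open>x\<close> is the restriction of
  \<open>\<eta> x\<close> to lists of length \<open>k\<close>. Tangent vectors are real tangent vectors, identified with
  elements of \<open>\<complex>\<^sup>n\<close>, so that \<open>dz\<^sup>i(v) = v $ i\<close> and \<open>d(cnj z)\<^sup>i(v) = cnj (v $ i)\<close>.\<close>

type_synonym 'n dform = "complex^'n \<Rightarrow> (complex^'n) list \<Rightarrow> complex"

definition alternating_multilinear :: "('v::real_vector list \<Rightarrow> complex) \<Rightarrow> bool" where
  "alternating_multilinear a \<longleftrightarrow> (\<forall>us ws. linear (\<lambda>v. a (us @ v # ws))) \<and>
     (\<forall>vs. \<not> distinct vs \<longrightarrow> a vs = 0)"

definition form_on :: "(complex^'n::finite) set \<Rightarrow> 'n dform \<Rightarrow> bool" where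
  "form_on S \<eta> \<longleftrightarrow> (\<forall>x\<in>S. alternating_multilinear (\<eta> x)) \<and> (\<forall>vs. smooth_map_on (\<lambda>x. \<eta> x vs) S)"

definition zero_form :: "(complex^'n::finite \<Rightarrow> complex) \<Rightarrow> 'n dform" where
  "zero_form f x vs = (if vs = [] then f x else 0)"

text \<open>The differential \<open>df(v)\<close> of a function and its complex linear and antilinear parts,
  \<open>\<Sum>\<^sub>i (\<partial>f/\<partial>z\<^sup>i) dz\<^sup>i(v)\<close> and \<open>\<Sum>\<^sub>i (\<partial>f/\<partial>(cnj z)\<^sup>i) d(cnj z)\<^sup>i(v)\<close>.\<close>

definition fun_d :: "(complex^'n::finite \<Rightarrow> complex) \<Rightarrow> complex^'n \<Rightarrow> complex^'n \<Rightarrow> complex" where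
  "fun_d f x v = frechet_derivative f (at x) v"

definition fun_del :: "(complex^'n::finite \<Rightarrow> complex) \<Rightarrow> complex^'n \<Rightarrow> complex^'n \<Rightarrow> complex" where
  "fun_del f x v = (fun_d f x v - \<i> * fun_d f x (\<i> *s v)) / 2"

definition fun_delbar :: "(complex^'n::finite \<Rightarrow> complex) \<Rightarrow> complex^'n \<Rightarrow> complex^'n \<Rightarrow> complex" where
  "fun_delbar f x v = (fun_d f x v + \<i> * fun_d f x (\<i> *s v)) / 2"

text \<open>Exterior derivative built from a differential \<open>D\<close> of functions,
  \<open>(v\<^sub>0, \<dots>, v\<^sub>k) \<mapsto> \<Sum>\<^sub>i (-1)\<^sup>i D(\<eta>(v\<^sub>0, \<dots>, omit v\<^sub>i, \<dots>, v\<^sub>k))(v\<^sub>i)\<close>. For \<open>D = fun_del\<close> this is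
  \<open>\<Sum>\<^sub>i dz\<^sup>i \<and> (\<partial>\<eta>/\<partial>z\<^sup>i)\<close>, the derivative being taken of the coefficients of \<open>\<eta>\<close>; similarly for
  \<open>fun_d\<close> and \<open>fun_delbar\<close>.\<close>

definition ext_deriv ::
  "((complex^'n::finite \<Rightarrow> complex) \<Rightarrow> complex^'n \<Rightarrow> complex^'n \<Rightarrow> complex) \<Rightarrow> 'n dform \<Rightarrow> 'n dform" where
  "ext_deriv D \<eta> x vs =
     (\<Sum>i<length vs. (-1)^i * D (\<lambda>y. \<eta> y (take i vs @ drop (Suc i) vs)) x (vs ! i))"

abbreviation form_d :: "'n::finite dform \<Rightarrow> 'n dform" where "form_d \<equiv> ext_deriv fun_d"
abbreviation form_del :: "'n::finite dform \<Rightarrow> 'n dform" where "form_del \<equiv> ext_deriv fun_del"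
abbreviation form_delbar :: "'n::finite dform \<Rightarrow> 'n dform" where "form_delbar \<equiv> ext_deriv fun_delbar"

text \<open>Wedge product as a sum over shuffles: \<open>I\<close> is the set of positions of the arguments passed to
  the first factor, and the sign is that of the permutation listing \<open>I\<close> before its complement.
  In particular \<open>(\<alpha> \<and> \<beta>)(v, w) = \<alpha>(v) \<beta>(w) - \<alpha>(w) \<beta>(v)\<close> for 1-forms.\<close>

definition wedge :: "'n::finite dform \<Rightarrow> 'n dform \<Rightarrow> 'n dform" where
  "wedge \<alpha> \<beta> x vs = (\<Sum>I\<in>Pow {..<length vs}.
     (-1) ^ card {(i, j). i < j \<and> i \<in> {..<length vs} - I \<and> j \<in> I} *
     \<alpha> x (nths vs I) * \<beta> x (nths vs (- I)))"

primrec wedge_power :: "'n::finite dform \<Rightarrow> nat \<Rightarrow> 'n dform" where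
  "wedge_power \<alpha> 0 = zero_form (\<lambda>_. 1)"
| "wedge_power \<alpha> (Suc m) = wedge \<alpha> (wedge_power \<alpha> m)"

section \<open>Global forms and the \<open>\<partial>\<partial>\<close>-bar lemma\<close>

text \<open>A global form is a family of forms on the coordinate domains related by pullback along
  the changes of coordinates.\<close>

definition global_form :: "('p, 'n::finite) chart set \<Rightarrow> (('p, 'n) chart \<Rightarrow> 'n dform) \<Rightarrow> bool" where
  "global_form A \<eta> \<longleftrightarrow> (\<forall>c\<in>A. form_on (cimage c) (\<eta> c)) \<and>
     (\<forall>c\<in>A. \<forall>c'\<in>A. \<forall>x\<in>overlap c c'. \<forall>vs.
        \<eta> c x vs = \<eta> c' (transition c c' x) (map (frechet_derivative (transition c c') (at x)) vs))"

definition forms_eq ::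
  "('p, 'n::finite) chart set \<Rightarrow> (('p, 'n) chart \<Rightarrow> 'n dform) \<Rightarrow> (('p, 'n) chart \<Rightarrow> 'n dform) \<Rightarrow> bool" where
  "forms_eq A \<alpha> \<beta> \<longleftrightarrow> (\<forall>c\<in>A. \<forall>x\<in>cimage c. \<alpha> c x = \<beta> c x)"

abbreviation zero_forms :: "('p, 'n::finite) chart \<Rightarrow> 'n dform" where
  "zero_forms \<equiv> (\<lambda>c x vs. 0)"

text \<open>Forms are of arbitrary, possibly mixed, degree. As \<open>d\<close> raises the degree by one, an exact form
  has no component of degree 0, and a \<open>\<partial>\<partial>\<close>-bar-exact form none of degree 0 or 1.\<close>

definition ddbar_lemma :: "('p, 'n::finite) chart set \<Rightarrow> bool" where
  "ddbar_lemma A \<longleftrightarrow> (\<forall>\<eta>. global_form A \<eta> \<and>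
       (\<exists>\<beta>. global_form A \<beta> \<and> forms_eq A \<eta> (\<lambda>c. form_d (\<beta> c))) \<and>
       forms_eq A (\<lambda>c. form_del (\<eta> c)) zero_forms \<and>
       forms_eq A (\<lambda>c. form_delbar (\<eta> c)) zero_forms \<longrightarrow>
     (\<exists>\<gamma>. global_form A \<gamma> \<and> forms_eq A \<eta> (\<lambda>c. form_del (form_delbar (\<gamma> c)))))"

section \<open>Hermitian metrics\<close>

text \<open>The sesquilinear form \<open>h\<^sub>i\<^sub>j v\<^sup>i cnj(w\<^sup>j)\<close>; rows of \<open>M\<close> correspond to the unbarred index.\<close>

definition sesq :: "complex^'n^'n \<Rightarrow> complex^'n \<Rightarrow> complex^'n \<Rightarrow> complex" where
  "sesq M v w = (\<Sum>i\<in>UNIV. \<Sum>j\<in>UNIV. M $ i $ j * v $ i * cnj (w $ j))"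

definition hermitian_posdef :: "complex^'n^'n \<Rightarrow> bool" where
  "hermitian_posdef M \<longleftrightarrow> (\<forall>i j. M $ j $ i = cnj (M $ i $ j)) \<and> (\<forall>v. v \<noteq> 0 \<longrightarrow> Re (sesq M v v) > 0)"

definition hermitian_metric ::
  "('p, 'n::finite) chart set \<Rightarrow> (('p, 'n) chart \<Rightarrow> complex^'n \<Rightarrow> complex^'n^'n) \<Rightarrow> bool" where
  "hermitian_metric A h \<longleftrightarrow>
     (\<forall>c\<in>A. smooth_map_on (h c) (cimage c) \<and> (\<forall>x\<in>cimage c. hermitian_posdef (h c x))) \<and>
     (\<forall>c\<in>A. \<forall>c'\<in>A. \<forall>x\<in>overlap c c'. \<forall>v w.
        sesq (h c x) v w = sesq (h c' (transition c c' x))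
          (frechet_derivative (transition c c') (at x) v) (frechet_derivative (transition c c') (at x) w))"

text \<open>The (1,1)-form \<open>\<i> M\<^sub>i\<^sub>j dz\<^sup>i \<and> d(cnj z)\<^sup>j\<close>.\<close>

definition form11 :: "(complex^'n::finite \<Rightarrow> complex^'n^'n) \<Rightarrow> 'n dform" where
  "form11 M x vs = (case vs of [v, w] \<Rightarrow> \<i> * (sesq (M x) v w - sesq (M x) w v) | _ \<Rightarrow> 0)"

definition balanced ::
  "('p, 'n::finite) chart set \<Rightarrow> (('p, 'n) chart \<Rightarrow> complex^'n \<Rightarrow> complex^'n^'n) \<Rightarrow> bool" where
  "balanced A h \<longleftrightarrow>
     forms_eq A (\<lambda>c. form_d (wedge_power (form11 (h c)) (CARD('n) - 1))) zero_forms"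

definition smooth_real_function :: "('p, 'n::finite) chart set \<Rightarrow> ('p \<Rightarrow> real) \<Rightarrow> bool" where
  "smooth_real_function A f \<longleftrightarrow> (\<forall>c\<in>A. smooth_map_on (f \<circ> cinv c) (cimage c))"

definition conformally_balanced ::
  "('p, 'n::finite) chart set \<Rightarrow> (('p, 'n) chart \<Rightarrow> complex^'n \<Rightarrow> complex^'n^'n) \<Rightarrow> bool" where
  "conformally_balanced A h \<longleftrightarrow>
     (\<exists>f. smooth_real_function A f \<and> balanced A (\<lambda>c x. exp (f (cinv c x)) *\<^sub>R h c x))"

section \<open>Levi-Civita Ricci curvature\<close>

definition dz :: "'n::finite \<Rightarrow> (complex^'n \<Rightarrow> complex) \<Rightarrow> complex^'n \<Rightarrow> complex" where
  "dz i f x = fun_del f x (axis i 1)"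

definition dzbar :: "'n::finite \<Rightarrow> (complex^'n \<Rightarrow> complex) \<Rightarrow> complex^'n \<Rightarrow> complex" where
  "dzbar i f x = fun_delbar f x (axis i 1)"

text \<open>\<open>h\<^sup>k\<^sup>l\<close>, where \<open>k\<close> is unbarred and \<open>l\<close> barred, is determined by \<open>\<Sum>\<^sub>l h\<^sup>k\<^sup>l h\<^sub>j\<^sub>l = \<delta>\<^sub>j\<^sub>k\<close>; hence
  the transposition.\<close>

definition hup :: "complex^'n^'n \<Rightarrow> 'n::finite \<Rightarrow> 'n \<Rightarrow> complex" where
  "hup M k l = matrix_inv M $ l $ k"

text \<open>\<open>lc_gamma H i j k = \<Gamma>\<^sub>i\<^sub>j\<^sup>k\<close> and \<open>lc_gamma_bar H i j k = \<Gamma>\<^sub>i\<^sub>j\<^sup>k\<close> with \<open>i\<close> barred.\<close>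

definition lc_gamma :: "(complex^'n::finite \<Rightarrow> complex^'n^'n) \<Rightarrow> 'n \<Rightarrow> 'n \<Rightarrow> 'n \<Rightarrow> complex^'n \<Rightarrow> complex" where
  "lc_gamma H i j k x = 1/2 * (\<Sum>l\<in>UNIV. hup (H x) k l *
     (dz i (\<lambda>y. H y $ j $ l) x + dz j (\<lambda>y. H y $ i $ l) x))"

definition lc_gamma_bar :: "(complex^'n::finite \<Rightarrow> complex^'n^'n) \<Rightarrow> 'n \<Rightarrow> 'n \<Rightarrow> 'n \<Rightarrow> complex^'n \<Rightarrow> complex" where
  "lc_gamma_bar H i j k x = 1/2 * (\<Sum>l\<in>UNIV. hup (H x) k l *
     (dzbar i (\<lambda>y. H y $ j $ l) x - dzbar l (\<lambda>y. H y $ j $ i) x))"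

text \<open>\<open>lc_curv H i j k l\<close> is \<open>\<RR>\<^sub>i\<^sub>j\<^sub>k\<^sup>l\<close> with \<open>j\<close> barred.\<close>

definition lc_curv :: "(complex^'n::finite \<Rightarrow> complex^'n^'n) \<Rightarrow> 'n \<Rightarrow> 'n \<Rightarrow> 'n \<Rightarrow> 'n \<Rightarrow> complex^'n \<Rightarrow> complex" where
  "lc_curv H i j k l x = - (dzbar j (lc_gamma H i k l) x - dz i (lc_gamma_bar H j k l) x +
     (\<Sum>s\<in>UNIV. lc_gamma H i k s x * lc_gamma_bar H j s l x - lc_gamma_bar H j k s x * lc_gamma H s i l x))"

definition lc_ricci :: "(complex^'n::finite \<Rightarrow> complex^'n^'n) \<Rightarrow> 'n dform" where
  "lc_ricci H = form11 (\<lambda>x. \<chi> i j. \<Sum>k\<in>UNIV. lc_curv H i j k k x)"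

definition levi_civita_ricci_flat ::
  "('p, 'n::finite) chart set \<Rightarrow> (('p, 'n) chart \<Rightarrow> complex^'n \<Rightarrow> complex^'n^'n) \<Rightarrow> bool" where
  "levi_civita_ricci_flat A h \<longleftrightarrow> forms_eq A (\<lambda>c. lc_ricci (h c)) zero_forms"

section \<open>Flat metrics on the canonical bundle\<close>

text \<open>A holomorphic line bundle trivialised over the charts by holomorphic frames \<open>e\<^sub>c\<close> is given by
  the functions \<open>\<tau> c c'\<close> with \<open>e\<^sub>c\<^sub>' = \<tau> c c' e\<^sub>c\<close>, written in the coordinates of \<open>c\<close>. A smooth
  Hermitian metric on it is given by the functions \<open>g c = |e\<^sub>c|\<^sup>2\<close>.\<close>

definition line_bundle_metric ::
  "('p, 'n::finite) chart set \<Rightarrow> (('p, 'n) chart \<Rightarrow> ('p, 'n) chart \<Rightarrow> complex^'n \<Rightarrow> complex) \<Rightarrow>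
     (('p, 'n) chart \<Rightarrow> complex^'n \<Rightarrow> real) \<Rightarrow> bool" where
  "line_bundle_metric A \<tau> g \<longleftrightarrow>
     (\<forall>c\<in>A. smooth_map_on (g c) (cimage c) \<and> (\<forall>x\<in>cimage c. g c x > 0)) \<and>
     (\<forall>c\<in>A. \<forall>c'\<in>A. \<forall>x\<in>overlap c c'. g c' (transition c c' x) = (cmod (\<tau> c c' x))\<^sup>2 * g c x)"

text \<open>Curvature of the Chern connection, whose connection form in the frame \<open>e\<^sub>c\<close> is \<open>\<partial> log |e\<^sub>c|\<^sup>2\<close>.\<close>

definition chern_curvature :: "(('p, 'n::finite) chart \<Rightarrow> complex^'n \<Rightarrow> real) \<Rightarrow> ('p, 'n) chart \<Rightarrow> 'n dform" where
  "chern_curvature g c = form_delbar (form_del (zero_form (\<lambda>x. complex_of_real (ln (g c x)))))"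

definition unitary_flat ::
  "('p, 'n::finite) chart set \<Rightarrow> (('p, 'n) chart \<Rightarrow> ('p, 'n) chart \<Rightarrow> complex^'n \<Rightarrow> complex) \<Rightarrow> bool" where
  "unitary_flat A \<tau> \<longleftrightarrow> (\<exists>g. line_bundle_metric A \<tau> g \<and> forms_eq A (chern_curvature g) zero_forms)"

text \<open>The canonical bundle, with frames \<open>e\<^sub>c = dz\<^sup>1 \<and> \<dots> \<and> dz\<^sup>n\<close> in the coordinates of \<open>c\<close>.\<close>

definition canonical_bundle :: "('p, 'n::finite) chart \<Rightarrow> ('p, 'n) chart \<Rightarrow> complex^'n \<Rightarrow> complex" where
  "canonical_bundle c c' x = det (matrix (frechet_derivative (transition c c') (at x)))"

end

theory Submission
  imports Defs
begin

text \<open>Let \<open>n\<close> be the dimension and \<open>\<theta>\<close> the trace of the torsion of the Chern connection of \<open>\<omega>\<close>, the global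
  (1,0)-form \<open>\<theta>\<^sub>i = h\<^sup>k\<^sup>l (\<partial>\<^sub>i h\<^sub>k\<^sub>l - \<partial>\<^sub>k h\<^sub>i\<^sub>l)\<close>, where \<open>l\<close> is barred. Taking the trace of the Levi-Civita curvature,
  the products of Christoffel symbols cancel, and the traces of the two families of Christoffel symbols are
  \<open>\<partial> log det h - \<theta>/2\<close> and \<open>cnj \<theta>/2\<close>. So the coefficients of the Ricci form are minus the complex Hessian of
  \<open>log det h\<close> plus the Hermitian part of the matrix of \<open>\<partial>\<close>-bar \<open>\<theta>\<close> (\<open>lc_curv_trace\<close>), and the metric is Ricci-flat
  if these two matrices agree (\<open>ricci_flat_equation\<close>).

  Differentiating this equation shows that \<open>\<partial>\<partial>\<close>-bar \<open>\<theta>\<close> vanishes, so that the form \<open>d\<theta>\<close>, which is \<open>d\<close>-exact, is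
  closed under \<open>\<partial>\<close> and \<open>\<partial>\<close>-bar (\<open>d_theta_closed\<close>). By the \<open>\<partial>\<partial>\<close>-bar lemma there is a function \<open>u\<close> with
  \<open>\<partial>\<close>-bar \<open>\<theta> = \<partial>\<partial>\<close>-bar \<open>u\<close> (\<open>ddbar_potential\<close>). Both assertions follow from the existence of \<open>u\<close>.

  The Hermitian part of the matrix of \<open>\<partial>\<close>-bar \<open>\<theta>\<close> is minus the complex Hessian of \<open>Re u\<close>. So
  \<open>log det h + Re u\<close> is pluriharmonic (\<open>pluriharmonic_potential\<close>), which says that the metric
  \<open>exp (- Re u) / det h\<close> on the canonical bundle is flat (\<open>unitary_flat_of_potential\<close>).

  The metric \<open>exp (Re u / (n-1)) h\<close> has the torsion form \<open>\<theta>' = \<theta> + \<partial> Re u\<close> (\<open>theta_conformal\<close>), and the trace of the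
  matrix of \<open>\<partial>\<close>-bar \<open>\<theta>'\<close> is imaginary, since only the Hessian of \<open>\<i> Im u\<close> contributes
  (\<open>conformal_trace_imaginary\<close>). On the other hand, the divergence of the vector field dual to \<open>\<theta>'\<close> is this trace
  plus \<open>|\<theta>'|\<^sup>2\<close> (\<open>divergence_flux\<close>). Its real part integrates to zero over \<open>X\<close>, hence \<open>\<theta>' = 0\<close>
  (\<open>theta_eq_0_of_imaginary_trace\<close>). Contracting \<open>d\<omega>'\<close> with the bivector dual to \<open>\<omega>'\<close> gives the real part of
  \<open>\<theta>'\<close> up to a factor, so \<open>d\<omega>'\<close> is primitive. As \<open>\<omega>\<^sup>n\<^sup>-\<^sup>2 \<and> b = 0\<close> for a primitive 3-form \<open>b\<close>
  (\<open>primitive_three_form\<close>), it follows that \<open>d(\<omega>'\<^sup>n\<^sup>-\<^sup>1) = (n-1) \<omega>'\<^sup>n\<^sup>-\<^sup>2 \<and> d\<omega>' = 0\<close>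
  (\<open>theta_zero_imp_balanced\<close>), so the conformally changed metric is balanced.
  The factor \<open>1 / (n-1)\<close> excludes \<open>n = 1\<close>, where every metric is balanced.

  Instead of a measure on \<open>X\<close>, the integration uses a partition of unity and integrals in coordinate domains
  (\<open>nonneg_divergence_eq_0\<close>).\<close>

section \<open>Calculus of smooth functions\<close>

lemma frechet_derivative_cong_open:
  assumes "open S" "x \<in> S" "\<And>y. y \<in> S \<Longrightarrow> f y = g y"
  shows "frechet_derivative f (at x) = frechet_derivative g (at x)"
    and "f differentiable (at x) \<longleftrightarrow> g differentiable (at x)"
proof -
  have "(f has_derivative D) (at x) \<longleftrightarrow> (g has_derivative D) (at x)" for D
    using assms has_derivative_transform_within_open by metis
  then show "frechet_derivative f (at x) = frechet_derivative g (at x)"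
    and "f differentiable (at x) \<longleftrightarrow> g differentiable (at x)"
    unfolding frechet_derivative_def differentiable_def by auto
qed

lemma Ck_on_cong:
  assumes "open S" "\<And>y. y \<in> S \<Longrightarrow> f y = g y"
  shows "Ck_on k f S \<longleftrightarrow> Ck_on k g S"
  using assms(2)
proof (induction k arbitrary: f g)
  case 0
  then show ?case by (simp cong: continuous_on_cong)
next
  case (Suc k)
  have "f differentiable (at x) \<longleftrightarrow> g differentiable (at x)" if "x \<in> S" for x
    by (rule frechet_derivative_cong_open(2)[OF assms(1) that Suc.prems])
  moreover have "Ck_on k (\<lambda>x. frechet_derivative f (at x) v) S \<longleftrightarrow> Ck_on k (\<lambda>x. frechet_derivative g (at x) v) S" for v
    by (rule Suc.IH) (simp add: frechet_derivative_cong_open(1)[OF assms(1) _ Suc.prems])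
  ultimately show ?case by simp
qed

lemma Ck_on_imp_continuous_on: "Ck_on k f S \<Longrightarrow> continuous_on S f"
proof (cases k)
  case (Suc n)
  assume "Ck_on k f S"
  then have "isCont f x" if "x \<in> S" for x
    using Suc that differentiable_imp_continuous_within[of f x UNIV] by simp
  then show ?thesis by (simp add: continuous_at_imp_continuous_on)
qed simp

lemma Ck_on_Suc_imp: "Ck_on (Suc k) f S \<Longrightarrow> Ck_on k f S"
proof (induction k arbitrary: f)
  case 0
  then show ?case using Ck_on_imp_continuous_on[of "Suc 0"] by simp
next
  case (Suc k)
  then show ?case by simp
qed

lemma Ck_on_subset: "Ck_on k f S \<Longrightarrow> T \<subseteq> S \<Longrightarrow> Ck_on k f T"
proof (induction k arbitrary: f)
  case 0
  then show ?case using continuous_on_subset by auto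
qed auto

lemma Ck_on_open_Union:
  assumes "\<And>S. S \<in> \<S> \<Longrightarrow> open S" "\<And>S. S \<in> \<S> \<Longrightarrow> Ck_on k f S"
  shows "Ck_on k f (\<Union>\<S>)"
  using assms(2)
proof (induction k arbitrary: f)
  case 0
  then show ?case using continuous_on_open_Union[of \<S> f] assms(1) by simp
qed auto

lemma Ck_on_const: "Ck_on k (\<lambda>x. c) S"
proof (induction k arbitrary: c)
  case (Suc k)
  have "frechet_derivative (\<lambda>x. c) (at x) v = 0" for x v
    using frechet_derivative_at[OF has_derivative_const[of c "at x"]] by metis
  then show ?case using Suc by simp
qed simp

lemma Ck_on_add:
  assumes "open S" "Ck_on k f S" "Ck_on k g S"
  shows "Ck_on k (\<lambda>x. f x + g x) S"
  using assms(2-)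
proof (induction k arbitrary: f g)
  case (Suc k)
  have "Ck_on k (\<lambda>x. frechet_derivative (\<lambda>x. f x + g x) (at x) v) S" for v
  proof (subst Ck_on_cong[OF assms(1)])
    show "frechet_derivative (\<lambda>x. f x + g x) (at y) v
       = frechet_derivative f (at y) v + frechet_derivative g (at y) v" if "y \<in> S" for y
    proof -
      have "f differentiable at y" "g differentiable at y" using Suc.prems that by auto
      from has_derivative_add[OF this[THEN frechet_derivative_works[THEN iffD1]]]
      show ?thesis using frechet_derivative_at by metis
    qed
  qed (use Suc in auto)
  then show ?case using Suc.prems by (simp add: differentiable_add)
qed (auto intro: continuous_intros)

lemma Ck_on_linear:
  assumes "bounded_linear L" "open S" "Ck_on k f S"
  shows "Ck_on k (\<lambda>x. L (f x)) S"
  using assms(3)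
proof (induction k arbitrary: f)
  case 0
  then show ?case using bounded_linear.continuous_on[OF assms(1)] by simp
next
  case (Suc k)
  have *: "((\<lambda>x. L (f x)) has_derivative (\<lambda>v. L (frechet_derivative f (at y) v))) (at y)" if "y \<in> S" for y
    by (rule bounded_linear.has_derivative[OF assms(1)])
       (use Suc.prems that frechet_derivative_works in auto)
  have "Ck_on k (\<lambda>x. frechet_derivative (\<lambda>x. L (f x)) (at x) v) S" for v
  proof (subst Ck_on_cong[OF assms(2)])
    show "frechet_derivative (\<lambda>x. L (f x)) (at y) v = L (frechet_derivative f (at y) v)" if "y \<in> S" for y
      using frechet_derivative_at[OF *[OF that]] by metis
  qed (use Suc in auto)
  then show ?case using * by (auto simp: differentiable_def)
qed

lemma Ck_on_bilinear:
  assumes "bounded_bilinear pr" "open S" "Ck_on k f S" "Ck_on k g S"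
  shows "Ck_on k (\<lambda>x. pr (f x) (g x)) S"
  using assms(3-)
proof (induction k arbitrary: f g)
  case 0
  then show ?case using bounded_bilinear.continuous_on[OF assms(1)] by simp
next
  case (Suc k)
  have *: "((\<lambda>x. pr (f x) (g x)) has_derivative (\<lambda>v. pr (f y) (frechet_derivative g (at y) v) +
     pr (frechet_derivative f (at y) v) (g y))) (at y)" if "y \<in> S" for y
    by (rule bounded_bilinear.FDERIV[OF assms(1)])
       (use Suc.prems that in \<open>auto intro: frechet_derivative_works[THEN iffD1]\<close>)
  have "Ck_on k (\<lambda>x. frechet_derivative (\<lambda>x. pr (f x) (g x)) (at x) v) S" for v
  proof (subst Ck_on_cong[OF assms(2)])
    show "frechet_derivative (\<lambda>x. pr (f x) (g x)) (at y) v = pr (f y) (frechet_derivative g (at y) v) +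
     pr (frechet_derivative f (at y) v) (g y)" if "y \<in> S" for y
      using frechet_derivative_at[OF *[OF that]] by metis
    show "Ck_on k (\<lambda>y. pr (f y) (frechet_derivative g (at y) v) + pr (frechet_derivative f (at y) v) (g y)) S"
      by (intro Ck_on_add assms(2) Suc.IH Ck_on_Suc_imp[OF Suc.prems(1)] Ck_on_Suc_imp[OF Suc.prems(2)])
         (use Suc.prems in auto)
  qed
  then show ?case using * by (auto simp: differentiable_def)
qed

lemma Ck_on_sum:
  assumes "open S" "\<And>i. i \<in> I \<Longrightarrow> Ck_on k (f i) S"
  shows "Ck_on k (\<lambda>x. \<Sum>i\<in>I. f i x) S"
  using assms(2)
proof (induction I rule: infinite_finite_induct)
  case (insert i I)
  then show ?case using Ck_on_add[OF assms(1), of k "f i" "\<lambda>x. \<Sum>i\<in>I. f i x"] by simp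
qed (simp_all add: Ck_on_const)

text \<open>The chain rule, expanded in a basis of the intermediate space, writes the derivative of the composition as
  a sum of products of functions that are one degree less differentiable.\<close>

lemma Ck_on_compose:
  fixes f :: "'a::real_normed_vector \<Rightarrow> 'b::euclidean_space"
  assumes "open S" "open T" "f ` S \<subseteq> T" "Ck_on k f S" "Ck_on k g T"
  shows "Ck_on k (\<lambda>x. g (f x)) S"
  using assms(4-)
proof (induction k arbitrary: g)
  case 0
  then show ?case using continuous_on_compose2[of T g S f] assms(3) by auto
next
  case (Suc k)
  have *: "((\<lambda>x. g (f x)) has_derivative (\<lambda>v. frechet_derivative g (at (f y)) (frechet_derivative f (at y) v))) (at y)"
     and **: "frechet_derivative g (at (f y)) (frechet_derivative f (at y) v) =
          (\<Sum>b\<in>Basis. (frechet_derivative f (at y) v \<bullet> b) *\<^sub>R frechet_derivative g (at (f y)) b)" if "y \<in> S" for y v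
  proof -
    have 1: "(f has_derivative frechet_derivative f (at y)) (at y)"
      and 2: "(g has_derivative frechet_derivative g (at (f y))) (at (f y))"
      using Suc.prems that assms(3) by (auto intro!: frechet_derivative_works[THEN iffD1])
    show "((\<lambda>x. g (f x)) has_derivative (\<lambda>v. frechet_derivative g (at (f y)) (frechet_derivative f (at y) v))) (at y)"
      using has_derivative_compose[OF 1 2] .
    have "linear (frechet_derivative g (at (f y)))"
      using 2 has_derivative_linear by blast
    then show "frechet_derivative g (at (f y)) (frechet_derivative f (at y) v) =
          (\<Sum>b\<in>Basis. (frechet_derivative f (at y) v \<bullet> b) *\<^sub>R frechet_derivative g (at (f y)) b)"
      by (subst euclidean_representation[symmetric, of "frechet_derivative f (at y) v"])
         (simp only: linear_sum linear_cmul)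
  qed
  have "Ck_on k (\<lambda>x. frechet_derivative (\<lambda>x. g (f x)) (at x) v) S" for v
  proof (subst Ck_on_cong[OF assms(1)])
    show "frechet_derivative (\<lambda>x. g (f x)) (at y) v =
       (\<Sum>b\<in>Basis. (frechet_derivative f (at y) v \<bullet> b) *\<^sub>R frechet_derivative g (at (f y)) b)" if "y \<in> S" for y
      using frechet_derivative_at[OF *[OF that]] ** that by metis
    show "Ck_on k (\<lambda>y. \<Sum>b\<in>Basis. (frechet_derivative f (at y) v \<bullet> b) *\<^sub>R frechet_derivative g (at (f y)) b) S"
    proof (intro Ck_on_sum assms(1) Ck_on_bilinear[OF bounded_bilinear_scaleR] Suc.IH)
      fix b :: 'b
      show "Ck_on k (\<lambda>x. frechet_derivative f (at x) v \<bullet> b) S"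
        by (rule Ck_on_linear[OF bounded_linear_inner_left assms(1)]) (use Suc in auto)
    qed (use Suc Ck_on_Suc_imp in auto)
  qed
  then show ?case using * by (auto simp: differentiable_def)
qed

lemma Ck_on_inverse: "Ck_on k (inverse :: 'a::real_normed_field \<Rightarrow> 'a) (- {0})"
proof (induction k)
  case 0
  then show ?case by (auto intro!: continuous_intros)
next
  case (Suc k)
  have op: "open (- {0::'a})" by (simp add: open_Compl)
  have *: "(inverse has_derivative (\<lambda>v. - (inverse y * v * inverse y))) (at y)" if "y \<noteq> 0" for y :: 'a
    using has_derivative_inverse'[OF that] .
  have "Ck_on k (\<lambda>x. frechet_derivative inverse (at x) v) (- {0})" for v :: 'a
  proof (subst Ck_on_cong[OF op])
    show "frechet_derivative inverse (at y) v = - (inverse y * v * inverse y)" if "y \<in> - {0}" for y :: 'a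
      using frechet_derivative_at[OF *] that by (metis ComplD singletonI)
    show "Ck_on k (\<lambda>y::'a. - (inverse y * v * inverse y)) (- {0})"
      by (intro Ck_on_linear[OF bounded_linear_minus[OF bounded_linear_ident]] Ck_on_bilinear[OF bounded_bilinear_mult]
           op Suc.IH Ck_on_const)
  qed
  then show ?case using * by (auto simp: differentiable_def)
qed

lemma Ck_on_exp: "Ck_on k (exp :: real \<Rightarrow> real) UNIV"
proof (induction k)
  case (Suc k)
  have *: "(exp has_derivative (\<lambda>v. exp y * v)) (at y)" for y :: real
    using DERIV_exp[of y] by (simp add: has_field_derivative_def)
  have "Ck_on k (\<lambda>x. frechet_derivative exp (at x) v) UNIV" for v :: real
  proof -
    have "(\<lambda>x. frechet_derivative exp (at x) v) = (\<lambda>x. exp x * v)"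
      using frechet_derivative_at[OF *] by metis
    then show ?thesis
      by (simp only:) (intro Ck_on_bilinear[OF bounded_bilinear_mult] Suc.IH Ck_on_const open_UNIV)
  qed
  then show ?case using * by (auto simp: differentiable_def)
qed (auto intro: continuous_intros)

lemma Ck_on_ln: "Ck_on k (ln :: real \<Rightarrow> real) {0<..}"
proof (cases k)
  case (Suc k)
  have *: "(ln has_derivative (\<lambda>v. inverse y * v)) (at y)" if "y > 0" for y :: real
    using DERIV_ln[OF that] by (simp add: has_field_derivative_def)
  have "Ck_on k (\<lambda>x. frechet_derivative ln (at x) v) {0<..}" for v :: real
  proof (subst Ck_on_cong[OF open_greaterThan])
    show "frechet_derivative ln (at y) v = inverse y * v" if "y \<in> {0<..}" for y :: real
      using frechet_derivative_at[OF *] that by (metis greaterThan_iff)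
    show "Ck_on k (\<lambda>y::real. inverse y * v) {0<..}"
      by (intro Ck_on_bilinear[OF bounded_bilinear_mult] Ck_on_const open_greaterThan
            Ck_on_subset[OF Ck_on_inverse]) auto
  qed
  then show ?thesis using * Suc by (auto simp: differentiable_def)
qed (auto intro!: continuous_intros)

lemma smooth_map_onD:
  assumes "smooth_map_on f S"
  shows "x \<in> S \<Longrightarrow> f differentiable (at x)"
    and "x \<in> S \<Longrightarrow> (f has_derivative frechet_derivative f (at x)) (at x)"
    and "continuous_on S f"
    and "smooth_map_on (\<lambda>x. frechet_derivative f (at x) v) S"
proof -
  have 1: "Ck_on (Suc k) f S" for k using assms by (simp add: smooth_map_on_def del: Ck_on.simps)
  show "x \<in> S \<Longrightarrow> f differentiable (at x)" using 1[of 0] by simp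
  then show "x \<in> S \<Longrightarrow> (f has_derivative frechet_derivative f (at x)) (at x)"
    using frechet_derivative_works by blast
  show "continuous_on S f" using 1 Ck_on_imp_continuous_on by blast
  show "smooth_map_on (\<lambda>x. frechet_derivative f (at x) v) S"
    using 1 by (simp add: smooth_map_on_def)
qed

lemma smooth_map_on_cong:
  "open S \<Longrightarrow> (\<And>y. y \<in> S \<Longrightarrow> f y = g y) \<Longrightarrow> smooth_map_on f S \<longleftrightarrow> smooth_map_on g S"
  by (simp add: smooth_map_on_def Ck_on_cong[of S f g])

lemma smooth_linear:
  "bounded_linear L \<Longrightarrow> open S \<Longrightarrow> smooth_map_on f S \<Longrightarrow> smooth_map_on (\<lambda>x. L (f x)) S"
  unfolding smooth_map_on_def using Ck_on_linear by blast

lemma smooth_bilinear: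
  "bounded_bilinear pr \<Longrightarrow> open S \<Longrightarrow> smooth_map_on f S \<Longrightarrow> smooth_map_on g S \<Longrightarrow> smooth_map_on (\<lambda>x. pr (f x) (g x)) S"
  unfolding smooth_map_on_def using Ck_on_bilinear by blast

lemma smooth_compose:
  fixes f :: "'a::real_normed_vector \<Rightarrow> 'b::euclidean_space"
  shows "smooth_map_on g T \<Longrightarrow> open S \<Longrightarrow> open T \<Longrightarrow> smooth_map_on f S \<Longrightarrow> f ` S \<subseteq> T \<Longrightarrow> smooth_map_on (\<lambda>x. g (f x)) S"
  unfolding smooth_map_on_def using Ck_on_compose by blast

named_theorems smooth_intros

lemma smooth_const [smooth_intros]: "smooth_map_on (\<lambda>x. c) S"
  by (simp add: smooth_map_on_def Ck_on_const)

lemma smooth_add [smooth_intros]: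
  "open S \<Longrightarrow> smooth_map_on f S \<Longrightarrow> smooth_map_on g S \<Longrightarrow> smooth_map_on (\<lambda>x. f x + g x) S"
  unfolding smooth_map_on_def using Ck_on_add by blast

lemma smooth_minus [smooth_intros]: "open S \<Longrightarrow> smooth_map_on f S \<Longrightarrow> smooth_map_on (\<lambda>x. - f x) S"
  by (rule smooth_linear[OF bounded_linear_minus[OF bounded_linear_ident]])

lemma smooth_diff [smooth_intros]:
  "open S \<Longrightarrow> smooth_map_on f S \<Longrightarrow> smooth_map_on g S \<Longrightarrow> smooth_map_on (\<lambda>x. f x - g x) S"
  using smooth_add[of S f "\<lambda>x. - g x"] smooth_minus by auto

lemma smooth_sum [smooth_intros]:
  "open S \<Longrightarrow> (\<And>i. i \<in> I \<Longrightarrow> smooth_map_on (f i) S) \<Longrightarrow> smooth_map_on (\<lambda>x. \<Sum>i\<in>I. f i x) S"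
  by (simp add: smooth_map_on_def Ck_on_sum)

lemma smooth_mult [smooth_intros]:
  fixes f g :: "_ \<Rightarrow> 'b::real_normed_algebra"
  shows "open S \<Longrightarrow> smooth_map_on f S \<Longrightarrow> smooth_map_on g S \<Longrightarrow> smooth_map_on (\<lambda>x. f x * g x) S"
  by (rule smooth_bilinear[OF bounded_bilinear_mult])

lemma smooth_scaleR [smooth_intros]:
  "open S \<Longrightarrow> smooth_map_on f S \<Longrightarrow> smooth_map_on g S \<Longrightarrow> smooth_map_on (\<lambda>x. f x *\<^sub>R g x) S"
  by (rule smooth_bilinear[OF bounded_bilinear_scaleR])

lemma smooth_prod [smooth_intros]:
  fixes f :: "_ \<Rightarrow> _ \<Rightarrow> 'b::real_normed_field"
  shows "open S \<Longrightarrow> (\<And>i. i \<in> I \<Longrightarrow> smooth_map_on (f i) S) \<Longrightarrow> smooth_map_on (\<lambda>x. \<Prod>i\<in>I. f i x) S"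
  by (induction I rule: infinite_finite_induct) (auto intro!: smooth_intros)

lemma smooth_inverse [smooth_intros]:
  fixes f :: "_ \<Rightarrow> 'b::{euclidean_space,real_normed_field}"
  assumes "open S" "smooth_map_on f S" "\<And>x. x \<in> S \<Longrightarrow> f x \<noteq> 0"
  shows "smooth_map_on (\<lambda>x. inverse (f x)) S"
  by (rule smooth_compose[where T = "- {0}"])
     (use assms in \<open>auto simp: smooth_map_on_def Ck_on_inverse open_Compl\<close>)

lemma smooth_divide [smooth_intros]:
  fixes f :: "_ \<Rightarrow> 'b::{euclidean_space,real_normed_field}"
  assumes "open S" "smooth_map_on f S" "smooth_map_on g S" "\<And>x. x \<in> S \<Longrightarrow> g x \<noteq> 0"
  shows "smooth_map_on (\<lambda>x. f x / g x) S"
  unfolding divide_inverse by (intro smooth_intros assms)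

lemma smooth_exp [smooth_intros]:
  fixes f :: "_ \<Rightarrow> real"
  shows "open S \<Longrightarrow> smooth_map_on f S \<Longrightarrow> smooth_map_on (\<lambda>x. exp (f x)) S"
  by (rule smooth_compose[where T = UNIV]) (auto simp: smooth_map_on_def Ck_on_exp)

lemma smooth_ln [smooth_intros]:
  fixes f :: "_ \<Rightarrow> real"
  shows "open S \<Longrightarrow> smooth_map_on f S \<Longrightarrow> (\<And>x. x \<in> S \<Longrightarrow> f x > 0) \<Longrightarrow> smooth_map_on (\<lambda>x. ln (f x)) S"
  by (rule smooth_compose[where T = "{0<..}"]) (auto simp: smooth_map_on_def Ck_on_ln)

lemma smooth_cnj [smooth_intros]: "open S \<Longrightarrow> smooth_map_on f S \<Longrightarrow> smooth_map_on (\<lambda>x. cnj (f x)) S"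
  by (rule smooth_linear[OF bounded_linear_cnj])

lemma smooth_Re [smooth_intros]: "open S \<Longrightarrow> smooth_map_on f S \<Longrightarrow> smooth_map_on (\<lambda>x. Re (f x)) S"
  by (rule smooth_linear[OF bounded_linear_Re])

lemma smooth_Im [smooth_intros]: "open S \<Longrightarrow> smooth_map_on f S \<Longrightarrow> smooth_map_on (\<lambda>x. Im (f x)) S"
  by (rule smooth_linear[OF bounded_linear_Im])

lemma smooth_of_real [smooth_intros]:
  "open S \<Longrightarrow> smooth_map_on f S \<Longrightarrow> smooth_map_on (\<lambda>x. complex_of_real (f x)) S"
  by (rule smooth_linear[OF bounded_linear_of_real])

lemma smooth_nth [smooth_intros]:
  fixes f :: "'a::real_normed_vector \<Rightarrow> 'b::euclidean_space^'m"
  shows "open S \<Longrightarrow> smooth_map_on f S \<Longrightarrow> smooth_map_on (\<lambda>x. f x $ i) S"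
  by (rule smooth_linear[OF bounded_linear_vec_nth])

lemma smooth_det [smooth_intros]:
  fixes H :: "'a::real_normed_vector \<Rightarrow> 'b::{euclidean_space,real_normed_field}^'m^'m"
  assumes "open S" "\<And>i j. smooth_map_on (\<lambda>x. H x $ i $ j) S"
  shows "smooth_map_on (\<lambda>x. det (H x)) S"
  unfolding det_def by (intro smooth_sum smooth_mult smooth_const smooth_prod assms)

text \<open>Both mixed second difference quotients over a small parallelogram are values of the respective
  mixed second derivative near the base point, by two applications of the mean value theorem.\<close>

lemma mixed_difference_eq_second_derivative:
  fixes f :: "'a::real_normed_vector \<Rightarrow> real"
  assumes f: "\<And>y. y \<in> ball x r \<Longrightarrow> f differentiable (at y)"
    and fv: "\<And>y. y \<in> ball x r \<Longrightarrow> (\<lambda>y. frechet_derivative f (at y) v) differentiable (at y)"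
    and s: "s > 0" "s * (norm v + norm w) < r"
  obtains y where "norm (y - x) \<le> s * (norm v + norm w)"
    "f (x + s *\<^sub>R v + s *\<^sub>R w) - f (x + s *\<^sub>R v) - f (x + s *\<^sub>R w) + f x =
      s * s * frechet_derivative (\<lambda>y. frechet_derivative f (at y) v) (at y) w"
proof -
  have close: "norm ((x + a *\<^sub>R v + b *\<^sub>R w) - x) \<le> s * (norm v + norm w)"
    if "0 \<le> a" "a \<le> s" "0 \<le> b" "b \<le> s" for a b
  proof -
    have "norm ((x + a *\<^sub>R v + b *\<^sub>R w) - x) \<le> a * norm v + b * norm w"
      using norm_triangle_ineq[of "a *\<^sub>R v" "b *\<^sub>R w"] that by simp
    also have "\<dots> \<le> s * norm v + s * norm w"
      using that by (intro add_mono mult_right_mono) auto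
    finally show ?thesis by (simp add: algebra_simps)
  qed
  have inb: "x + a *\<^sub>R v + b *\<^sub>R w \<in> ball x r"
    if "0 \<le> a" "a \<le> s" "0 \<le> b" "b \<le> s" for a b
    using close[OF that] s(2) by (simp only: mem_ball dist_norm norm_minus_commute[of x])
  define F where "F y = frechet_derivative f (at y) v" for y
  have D1: "((\<lambda>a. f (x + a *\<^sub>R v + b *\<^sub>R w)) has_real_derivative F (x + a *\<^sub>R v + b *\<^sub>R w)) (at a)"
    if "0 \<le> a" "a \<le> s" "0 \<le> b" "b \<le> s" for a b
  proof -
    have 1: "((\<lambda>a. x + a *\<^sub>R v + b *\<^sub>R w) has_derivative (\<lambda>t. t *\<^sub>R v)) (at a)"
      by (auto intro!: derivative_eq_intros)
    have 2: "(f has_derivative frechet_derivative f (at (x + a *\<^sub>R v + b *\<^sub>R w))) (at (x + a *\<^sub>R v + b *\<^sub>R w))"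
      using f[OF inb[OF that]] frechet_derivative_works by blast
    have "linear (frechet_derivative f (at (x + a *\<^sub>R v + b *\<^sub>R w)))"
      using 2 has_derivative_linear by blast
    then show ?thesis
      using has_derivative_compose[OF 1 2]
      by (simp add: has_field_derivative_def F_def linear_cmul mult.commute[of _ "frechet_derivative f _ _"] fun_eq_iff)
  qed
  obtain a where a: "0 < a" "a < s"
    "(f (x + s *\<^sub>R v + s *\<^sub>R w) - f (x + s *\<^sub>R v + 0 *\<^sub>R w)) - (f (x + 0 *\<^sub>R v + s *\<^sub>R w) - f (x + 0 *\<^sub>R v + 0 *\<^sub>R w))
       = (s - 0) * (F (x + a *\<^sub>R v + s *\<^sub>R w) - F (x + a *\<^sub>R v + 0 *\<^sub>R w))"
    using MVT2[of 0 s "\<lambda>a. f (x + a *\<^sub>R v + s *\<^sub>R w) - f (x + a *\<^sub>R v + 0 *\<^sub>R w)"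
        "\<lambda>a. F (x + a *\<^sub>R v + s *\<^sub>R w) - F (x + a *\<^sub>R v + 0 *\<^sub>R w)"] s(1)
      DERIV_diff[OF D1[of _ s] D1[of _ 0]] by auto
  have D2: "((\<lambda>b. F (x + a *\<^sub>R v + b *\<^sub>R w)) has_real_derivative
       frechet_derivative F (at (x + a *\<^sub>R v + b *\<^sub>R w)) w) (at b)"
    if "0 \<le> b" "b \<le> s" for b
  proof -
    have 1: "((\<lambda>b. x + a *\<^sub>R v + b *\<^sub>R w) has_derivative (\<lambda>t. t *\<^sub>R w)) (at b)"
      by (auto intro!: derivative_eq_intros)
    have 2: "(F has_derivative frechet_derivative F (at (x + a *\<^sub>R v + b *\<^sub>R w))) (at (x + a *\<^sub>R v + b *\<^sub>R w))"
      using fv[OF inb, of a b] that a(1,2) frechet_derivative_works unfolding F_def by fastforce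
    have "linear (frechet_derivative F (at (x + a *\<^sub>R v + b *\<^sub>R w)))"
      using 2 has_derivative_linear by blast
    then show ?thesis
      using has_derivative_compose[OF 1 2]
      by (simp add: has_field_derivative_def linear_cmul mult.commute[of _ "frechet_derivative F _ _"] fun_eq_iff)
  qed
  obtain b where b: "0 < b" "b < s"
    "F (x + a *\<^sub>R v + s *\<^sub>R w) - F (x + a *\<^sub>R v + 0 *\<^sub>R w)
       = (s - 0) * frechet_derivative F (at (x + a *\<^sub>R v + b *\<^sub>R w)) w"
    using MVT2[of 0 s "\<lambda>b. F (x + a *\<^sub>R v + b *\<^sub>R w)"
        "\<lambda>b. frechet_derivative F (at (x + a *\<^sub>R v + b *\<^sub>R w)) w"] s(1) D2 by auto
  show ?thesis
  proof (rule that[of "x + a *\<^sub>R v + b *\<^sub>R w"])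
    show "norm ((x + a *\<^sub>R v + b *\<^sub>R w) - x) \<le> s * (norm v + norm w)"
      using close a b by auto
    show "f (x + s *\<^sub>R v + s *\<^sub>R w) - f (x + s *\<^sub>R v) - f (x + s *\<^sub>R w) + f x =
      s * s * frechet_derivative (\<lambda>y. frechet_derivative f (at y) v) (at (x + a *\<^sub>R v + b *\<^sub>R w)) w"
      using a(3) b(3) unfolding F_def by simp
  qed
qed

lemma second_derivative_symmetric_real:
  fixes f :: "'a::real_normed_vector \<Rightarrow> real"
  assumes "open S" "x \<in> S" "Ck_on 2 f S"
  shows "frechet_derivative (\<lambda>y. frechet_derivative f (at y) v) (at x) w =
         frechet_derivative (\<lambda>y. frechet_derivative f (at y) w) (at x) v"
proof -
  define P where "P y = frechet_derivative (\<lambda>y. frechet_derivative f (at y) v) (at y) w" for y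
  define Q where "Q y = frechet_derivative (\<lambda>y. frechet_derivative f (at y) w) (at y) v" for y
  have C: "\<forall>x\<in>S. f differentiable at x" "\<And>v. \<forall>x\<in>S. (\<lambda>y. frechet_derivative f (at y) v) differentiable at x"
    "continuous_on S P" "continuous_on S Q"
    using assms(3) unfolding P_def Q_def by (auto simp: numeral_2_eq_2)
  obtain R where R: "R > 0" "ball x R \<subseteq> S"
    using assms(1,2) open_contains_ball by blast
  have "\<bar>P x - Q x\<bar> \<le> e" if e: "e > 0" for e
  proof -
    have "continuous (at x) P" "continuous (at x) Q"
      using C assms continuous_on_eq_continuous_at by blast+
    then obtain d1 d2 where d: "d1 > 0" "d2 > 0"
      "\<And>y. dist y x < d1 \<Longrightarrow> dist (P y) (P x) < e/2" "\<And>y. dist y x < d2 \<Longrightarrow> dist (Q y) (Q x) < e/2"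
      using e unfolding continuous_at_eps_delta by (metis half_gt_zero)
    define r where "r = min R (min d1 d2)"
    (* the summand 1 makes N positive also for v = w = 0 *)
    define N where "N = norm v + norm w + 1"
    define s where "s = r / (2 * N)"
    have N: "N > 0" unfolding N_def by (simp add: add_nonneg_pos)
    have r: "r > 0" unfolding r_def using R d by simp
    have s: "s > 0" unfolding s_def using N r by simp
    have sN: "s * (norm v + norm w) < r"
    proof -
      have "s * (norm v + norm w) < s * N" using s by (simp add: N_def)
      also have "\<dots> = r / 2" using N by (simp add: s_def)
      finally show ?thesis using r by simp
    qed
    have ball: "ball x r \<subseteq> S" using R unfolding r_def by auto
    obtain y where y: "norm (y - x) \<le> s * (norm v + norm w)"
      "f (x + s *\<^sub>R v + s *\<^sub>R w) - f (x + s *\<^sub>R v) - f (x + s *\<^sub>R w) + f x = s * s * P y"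
      using mixed_difference_eq_second_derivative[of x r f v s w] C ball s sN unfolding P_def by blast
    obtain z where z: "norm (z - x) \<le> s * (norm w + norm v)"
      "f (x + s *\<^sub>R w + s *\<^sub>R v) - f (x + s *\<^sub>R w) - f (x + s *\<^sub>R v) + f x = s * s * Q z"
      using mixed_difference_eq_second_derivative[of x r f w s v] C ball s
        sN[unfolded add.commute[of "norm v"]] unfolding Q_def by blast
    have "s * s * P y = s * s * Q z" using y(2) z(2) by (simp add: algebra_simps)
    then have "P y = Q z" using s by simp
    moreover have "dist (P y) (P x) < e/2"
      by (rule d(3)) (use y(1) sN in \<open>simp add: dist_norm r_def\<close>)
    moreover have "dist (Q z) (Q x) < e/2"
      by (rule d(4)) (use z(1) sN in \<open>simp add: dist_norm r_def add.commute\<close>)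
    ultimately show ?thesis unfolding dist_real_def by linarith
  qed
  then have "\<bar>P x - Q x\<bar> \<le> 0" using field_le_epsilon[of "\<bar>P x - Q x\<bar>" 0] by simp
  then show ?thesis unfolding P_def Q_def by simp
qed

lemma frechet_derivative_linear_compose:
  assumes "bounded_linear L" "f differentiable (at x)"
  shows "frechet_derivative (\<lambda>y. L (f y)) (at x) v = L (frechet_derivative f (at x) v)"
  by (rule fun_cong[OF frechet_derivative_at[OF bounded_linear.has_derivative[OF assms(1)
     assms(2)[unfolded frechet_derivative_works]], symmetric]])

lemma second_derivative_symmetric:
  fixes f :: "'a::real_normed_vector \<Rightarrow> 'b::euclidean_space"
  assumes S: "open S" "x \<in> S" and f: "smooth_map_on f S"
  shows "frechet_derivative (\<lambda>y. frechet_derivative f (at y) v) (at x) w =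
         frechet_derivative (\<lambda>y. frechet_derivative f (at y) w) (at x) v"
proof (rule euclidean_eqI)
  fix b :: 'b assume "b \<in> Basis"
  have *: "frechet_derivative (\<lambda>y. frechet_derivative f (at y) v) (at x) w \<bullet> b =
     frechet_derivative (\<lambda>y. frechet_derivative (\<lambda>y. f y \<bullet> b) (at y) v) (at x) w" for v w
  proof -
    have 1: "frechet_derivative (\<lambda>y. f y \<bullet> b) (at y) v = frechet_derivative f (at y) v \<bullet> b" if "y \<in> S" for y
      using smooth_map_onD(1)[OF f that]
      by (rule frechet_derivative_linear_compose[OF bounded_linear_inner_left])
    have "frechet_derivative (\<lambda>y. frechet_derivative (\<lambda>y. f y \<bullet> b) (at y) v) (at x) w =
       frechet_derivative (\<lambda>y. frechet_derivative f (at y) v \<bullet> b) (at x) w"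
      using frechet_derivative_cong_open(1)[OF S 1] by (simp add: fun_eq_iff)
    also have "\<dots> = frechet_derivative (\<lambda>y. frechet_derivative f (at y) v) (at x) w \<bullet> b"
      using smooth_map_onD(1)[OF smooth_map_onD(4)[OF f] S(2)]
      by (rule frechet_derivative_linear_compose[OF bounded_linear_inner_left])
    finally show ?thesis by simp
  qed
  have "Ck_on 2 (\<lambda>y. f y \<bullet> b) S"
    using Ck_on_linear[OF bounded_linear_inner_left S(1)] f unfolding smooth_map_on_def by blast
  then show "frechet_derivative (\<lambda>y. frechet_derivative f (at y) v) (at x) w \<bullet> b =
         frechet_derivative (\<lambda>y. frechet_derivative f (at y) w) (at x) v \<bullet> b"
    unfolding * by (rule second_derivative_symmetric_real[OF S])
qed

section \<open>Wirtinger calculus\<close>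

text \<open>A common form of \<open>d\<close>, \<open>\<partial>\<close> and \<open>\<partial>\<close>-bar on functions, so that each rule of differentiation has one proof.\<close>

definition gd :: "complex \<Rightarrow> complex \<Rightarrow> (complex^'n::finite \<Rightarrow> complex) \<Rightarrow> complex^'n \<Rightarrow> complex^'n \<Rightarrow> complex" where
  "gd a b f x v = a * fun_d f x v + b * fun_d f x (\<i> *s v)"

lemma fun_d_gd: "fun_d = gd 1 0"
  and fun_del_gd: "fun_del = gd (1/2) (- \<i>/2)"
  and fun_delbar_gd: "fun_delbar = gd (1/2) (\<i>/2)"
  by (auto simp: fun_eq_iff gd_def fun_del_def fun_delbar_def field_simps)

lemmas gd_specs = fun_d_gd fun_del_gd fun_delbar_gd

lemma fun_d_eqI: "(f has_derivative D) (at x) \<Longrightarrow> fun_d f x = D"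
  using frechet_derivative_at[of f D x] by (simp add: fun_d_def fun_eq_iff)

lemma fun_d_has_derivative: "f differentiable (at x) \<Longrightarrow> (f has_derivative fun_d f x) (at x)"
  unfolding fun_d_def[abs_def] using frechet_derivative_works by blast

lemma cscale_conv_scaleR: "c *s v = Re c *\<^sub>R v + Im c *\<^sub>R (\<i> *s v)" for v :: "complex^'n"
  by (simp add: vec_eq_iff complex_eq_iff)

lemma gd_cong:
  assumes "open S" "x \<in> S" "\<And>y. y \<in> S \<Longrightarrow> f y = g y"
  shows "gd a b f x v = gd a b g x v"
  by (simp add: gd_def fun_d_def frechet_derivative_cong_open(1)[OF assms])

lemma gd_const [simp]: "gd a b (\<lambda>y. c) x v = 0"
  by (simp add: gd_def fun_d_eqI[OF has_derivative_const])

lemma gd_add: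
  assumes "f differentiable (at x)" "g differentiable (at x)"
  shows "gd a b (\<lambda>y. f y + g y) x v = gd a b f x v + gd a b g x v"
  using fun_d_eqI[OF has_derivative_add[OF assms[THEN fun_d_has_derivative]]]
  by (simp add: gd_def algebra_simps)

lemma gd_diff:
  assumes "f differentiable (at x)" "g differentiable (at x)"
  shows "gd a b (\<lambda>y. f y - g y) x v = gd a b f x v - gd a b g x v"
  using fun_d_eqI[OF has_derivative_diff[OF assms[THEN fun_d_has_derivative]]]
  by (simp add: gd_def algebra_simps)

lemma gd_minus:
  assumes "f differentiable (at x)"
  shows "gd a b (\<lambda>y. - f y) x v = - gd a b f x v"
  using fun_d_eqI[OF has_derivative_minus[OF assms[THEN fun_d_has_derivative]]]
  by (simp add: gd_def algebra_simps)

lemma gd_mult: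
  assumes "f differentiable (at x)" "g differentiable (at x)"
  shows "gd a b (\<lambda>y. f y * g y) x v = gd a b f x v * g x + f x * gd a b g x v"
  using fun_d_eqI[OF has_derivative_mult[OF assms[THEN fun_d_has_derivative]]]
  by (simp add: gd_def algebra_simps)

lemma gd_cmult:
  assumes "f differentiable (at x)"
  shows "gd a b (\<lambda>y. c * f y) x v = c * gd a b f x v"
  using gd_mult[of "\<lambda>y. c" x f] assms by simp

lemma gd_sum:
  assumes "\<And>i. i \<in> I \<Longrightarrow> f i differentiable (at x)"
  shows "gd a b (\<lambda>y. \<Sum>i\<in>I. f i y) x v = (\<Sum>i\<in>I. gd a b (f i) x v)"
proof -
  have "fun_d (\<lambda>y. \<Sum>i\<in>I. f i y) x = (\<lambda>v. \<Sum>i\<in>I. fun_d (f i) x v)"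
    by (intro fun_d_eqI has_derivative_sum fun_d_has_derivative assms)
  then show ?thesis by (simp add: gd_def sum.distrib sum_distrib_left)
qed

lemma fun_d_cnj:
  assumes "f differentiable (at x)"
  shows "fun_d (\<lambda>y. cnj (f y)) x v = cnj (fun_d f x v)"
  using fun_d_eqI[OF has_derivative_cnj[OF assms[THEN fun_d_has_derivative]]] by simp

lemma fun_del_cnj:
  assumes "f differentiable (at x)"
  shows "fun_del (\<lambda>y. cnj (f y)) x v = cnj (fun_delbar f x v)"
    and "fun_delbar (\<lambda>y. cnj (f y)) x v = cnj (fun_del f x v)"
  using fun_d_cnj[OF assms] by (simp_all add: fun_del_def fun_delbar_def)

lemma smooth_gd [smooth_intros]:
  "open S \<Longrightarrow> smooth_map_on f S \<Longrightarrow> smooth_map_on (\<lambda>x. gd a b f x v) S"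
  unfolding gd_def fun_d_def by (intro smooth_intros smooth_map_onD(4))

lemma gd_commute:
  assumes S: "open S" "x \<in> S" and f: "smooth_map_on f S"
  shows "gd a b (\<lambda>y. gd c d f y w) x v = gd c d (\<lambda>y. gd a b f y v) x w"
proof -
  have dif: "(\<lambda>y. fun_d f y u) differentiable (at x)" for u
    using smooth_map_onD(1)[OF smooth_map_onD(4)[OF f] S(2)] by (simp add: fun_d_def)
  have sym: "fun_d (\<lambda>y. fun_d f y u) x u' = fun_d (\<lambda>y. fun_d f y u') x u" for u u'
    unfolding fun_d_def by (rule second_derivative_symmetric[OF S f])
  have *: "gd a b (\<lambda>y. gd c d f y w) x v = c * (a * fun_d (\<lambda>y. fun_d f y w) x v + b * fun_d (\<lambda>y. fun_d f y w) x (\<i> *s v))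
      + d * (a * fun_d (\<lambda>y. fun_d f y (\<i> *s w)) x v + b * fun_d (\<lambda>y. fun_d f y (\<i> *s w)) x (\<i> *s v))" for a b c d v w
  proof -
    have "gd a b (\<lambda>y. gd c d f y w) x v = gd a b (\<lambda>y. c * fun_d f y w + d * fun_d f y (\<i> *s w)) x v"
      by (simp add: gd_def[of c d])
    also have "\<dots> = c * gd a b (\<lambda>y. fun_d f y w) x v + d * gd a b (\<lambda>y. fun_d f y (\<i> *s w)) x v"
      by (subst gd_add) (auto intro!: derivative_intros dif simp: gd_cmult dif)
    finally show ?thesis by (simp add: gd_def)
  qed
  show ?thesis unfolding * sym[of w] sym[of "\<i> *s w"] by (simp add: algebra_simps)
qed

lemma fun_d_linear: "f differentiable (at x) \<Longrightarrow> linear (fun_d f x)"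
  using fun_d_has_derivative has_derivative_linear by blast

lemma gd_linear:
  assumes "f differentiable (at x)"
  shows "linear (gd a b f x)"
proof -
  interpret linear "fun_d f x" by (rule fun_d_linear[OF assms])
  have i: "\<i> *s (v + w) = \<i> *s v + \<i> *s w" "\<i> *s (r *\<^sub>R v) = r *\<^sub>R (\<i> *s v)" for v w :: "complex^'a" and r
    by (simp_all add: vec_eq_iff algebra_simps)
  show ?thesis
    by (rule linearI) (simp_all add: gd_def i add scale algebra_simps)
qed

lemma fun_del_scale:
  assumes "f differentiable (at x)"
  shows "fun_del f x (c *s v) = c * fun_del f x v"
    and "fun_delbar f x (c *s v) = cnj c * fun_delbar f x v"
proof -
  interpret d: linear "fun_d f x" by (rule fun_d_linear[OF assms])
  have i: "\<i> *s (\<i> *s v) = - v" "\<i> *s (c *s v) = Re c *\<^sub>R (\<i> *s v) - Im c *\<^sub>R v" for v :: "complex^'a"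
    by (simp_all add: vec_eq_iff complex_eq_iff)
  show "fun_del f x (c *s v) = c * fun_del f x v"
    and "fun_delbar f x (c *s v) = cnj c * fun_delbar f x v"
    unfolding fun_del_def fun_delbar_def i unfolding cscale_conv_scaleR[of c v]
    by (simp_all add: d.add d.diff d.scale complex_eq_iff algebra_simps add_divide_distrib diff_divide_distrib)
qed

lemma fun_d_split: "fun_d f x v = fun_del f x v + fun_delbar f x v"
  by (simp add: fun_del_def fun_delbar_def field_simps)

lemma fun_del_expand:
  assumes "f differentiable (at x)"
  shows "fun_del f x v = (\<Sum>i\<in>UNIV. v $ i * dz i f x)"
    and "fun_delbar f x v = (\<Sum>i\<in>UNIV. cnj (v $ i) * dzbar i f x)"
proof -
  have l: "linear (fun_del f x)" "linear (fun_delbar f x)"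
    using gd_linear[OF assms] by (simp_all add: gd_specs)
  show "fun_del f x v = (\<Sum>i\<in>UNIV. v $ i * dz i f x)"
    by (subst basis_expansion[of v, symmetric])
       (simp only: linear_sum[OF l(1)] fun_del_scale[OF assms] dz_def)
  show "fun_delbar f x v = (\<Sum>i\<in>UNIV. cnj (v $ i) * dzbar i f x)"
    by (subst basis_expansion[of v, symmetric])
       (simp only: linear_sum[OF l(2)] fun_del_scale[OF assms] dzbar_def)
qed

lemma fun_d_of_real:
  assumes "g differentiable (at x)"
  shows "fun_d (\<lambda>y. complex_of_real (g y)) x v = of_real (frechet_derivative g (at x) v)"
  unfolding fun_d_def by (rule frechet_derivative_linear_compose[OF bounded_linear_of_real assms])

lemma gd_ln:
  assumes g: "g differentiable (at x)" "g x > (0::real)"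
  shows "gd a b (\<lambda>y. complex_of_real (ln (g y))) x v = gd a b (\<lambda>y. of_real (g y)) x v / of_real (g x)"
proof -
  have 1: "((\<lambda>y. ln (g y)) has_derivative (\<lambda>v. frechet_derivative g (at x) v * inverse (g x))) (at x)"
    by (rule has_derivative_ln) (use g frechet_derivative_works in blast)+
  have 2: "(\<lambda>y. ln (g y)) differentiable (at x)" using 1 differentiable_def by blast
  have "fun_d (\<lambda>y. complex_of_real (ln (g y))) x v = fun_d (\<lambda>y. of_real (g y)) x v / of_real (g x)" for v
    unfolding fun_d_of_real[OF 2] fun_d_of_real[OF g(1)] frechet_derivative_at[OF 1, symmetric]
    by (simp add: divide_inverse)
  then show ?thesis by (simp add: gd_def add_divide_distrib)
qed

lemma gd_exp:
  assumes g: "g differentiable (at x)"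
  shows "gd a b (\<lambda>y. complex_of_real (exp (g y))) x v = of_real (exp (g x)) * gd a b (\<lambda>y. of_real (g y)) x v"
proof -
  have 1: "((\<lambda>y. exp (g y)) has_derivative (\<lambda>v. frechet_derivative g (at x) v * exp (g x))) (at x)"
    by (rule has_derivative_exp) (use g frechet_derivative_works in blast)
  have 2: "(\<lambda>y. exp (g y)) differentiable (at x)" using 1 differentiable_def by blast
  have "fun_d (\<lambda>y. complex_of_real (exp (g y))) x v = of_real (exp (g x)) * fun_d (\<lambda>y. of_real (g y)) x v" for v
    unfolding fun_d_of_real[OF 2] fun_d_of_real[OF g] frechet_derivative_at[OF 1, symmetric]
    by simp
  then show ?thesis by (simp add: gd_def algebra_simps)
qed

lemma frechet_derivative_chain:
  assumes "t differentiable (at x)" "f differentiable (at (t x))"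
  shows "frechet_derivative (\<lambda>y. f (t y)) (at x) v = frechet_derivative f (at (t x)) (frechet_derivative t (at x) v)"
  by (rule fun_cong[OF frechet_derivative_at[OF
        has_derivative_compose[OF assms[unfolded frechet_derivative_works]]], symmetric])

text \<open>The differential of \<open>t\<close>, being complex linear, commutes with the multiplication by \<open>\<i>\<close> that distinguishes
  \<open>\<partial>\<close> from \<open>d\<close>.\<close>

lemma gd_compose_holomorphic:
  assumes "t differentiable (at x)" "f differentiable (at (t x))"
    and "\<And>c v. frechet_derivative t (at x) (c *s v) = c *s frechet_derivative t (at x) v"
  shows "gd a b (\<lambda>y. f (t y)) x v = gd a b f (t x) (frechet_derivative t (at x) v)"
  unfolding gd_def fun_d_def frechet_derivative_chain[OF assms(1,2)] assms(3) ..

lemmas fun_d_rules = gd_add[where a=1 and b=0, folded gd_specs]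
  gd_diff[where a=1 and b=0, folded gd_specs] gd_minus[where a=1 and b=0, folded gd_specs]
  gd_mult[where a=1 and b=0, folded gd_specs] gd_sum[where a=1 and b=0, folded gd_specs]

section \<open>Determinants and inverses of matrix-valued functions\<close>

text \<open>Cramer's rule: \<open>r B\<close> are the coefficients of \<open>r\<close> as a combination of the rows of \<open>A\<close>.\<close>

lemma det_replace_row:
  fixes A :: "'a::field^'n^'n"
  assumes "B ** A = mat 1"
  shows "det (\<chi> i. if i = k then r else A $ i) = (\<Sum>j\<in>UNIV. r $ j * B $ j $ k) * det A"
proof -
  define x where "x = r v* B"
  have "x v* A = r"
    unfolding x_def vector_matrix_mul_assoc assms by simp
  then have r: "r = (\<Sum>i\<in>UNIV. x $ i *s row i A)"
    by (auto simp: vec_eq_iff vector_matrix_mult_def row_def mult.commute)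
  have "det (\<chi> i. if i = k then r else A $ i) = x $ k * det A"
  proof -
    have "row i A = A $ i" for i by (simp add: row_def vec_eq_iff)
    then show ?thesis unfolding r using cramer_lemma_transpose[of k x A] by (simp only:)
  qed
  also have "x $ k = (\<Sum>j\<in>UNIV. r $ j * B $ j $ k)"
    by (simp add: x_def vector_matrix_mult_def mult.commute)
  finally show ?thesis .
qed

text \<open>Jacobi's formula: the derivative of each product in the Leibniz expansion replaces one factor, so
  the derivative of the determinant is a sum of determinants with one row replaced, which Cramer's rule
  evaluates.\<close>

lemma has_derivative_det:
  fixes G :: "'a::real_normed_vector \<Rightarrow> 'b::real_normed_field^'n^'n"
  assumes G: "\<And>i j. ((\<lambda>y. G y $ i $ j) has_derivative (\<lambda>v. D v $ i $ j)) (at x)"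
    and B: "B ** G x = mat 1"
  shows "((\<lambda>y. det (G y)) has_derivative (\<lambda>v. det (G x) * (\<Sum>i\<in>UNIV. \<Sum>j\<in>UNIV. B $ j $ i * D v $ i $ j))) (at x)"
proof -
  have "((\<lambda>y. det (G y)) has_derivative (\<lambda>v. \<Sum>p | p permutes UNIV. of_int (sign p) *
      (\<Sum>i\<in>UNIV. D v $ i $ p i * (\<Prod>j\<in>UNIV - {i}. G x $ j $ p j)))) (at x)"
    unfolding det_def by (intro has_derivative_sum has_derivative_mult_right has_derivative_prod G)
  moreover have "(\<Sum>p | p permutes UNIV. of_int (sign p) * (\<Sum>i\<in>UNIV. D v $ i $ p i * (\<Prod>j\<in>UNIV - {i}. G x $ j $ p j)))
      = det (G x) * (\<Sum>i\<in>UNIV. \<Sum>j\<in>UNIV. B $ j $ i * D v $ i $ j)" for v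
  proof -
    have "(\<Sum>p | p permutes UNIV. of_int (sign p) * (\<Sum>i\<in>UNIV. D v $ i $ p i * (\<Prod>j\<in>UNIV - {i}. G x $ j $ p j)))
       = (\<Sum>i\<in>UNIV. \<Sum>p | p permutes UNIV. of_int (sign p) * (D v $ i $ p i * (\<Prod>j\<in>UNIV - {i}. G x $ j $ p j)))"
      unfolding sum_distrib_left by (rule sum.swap)
    also have "\<dots> = (\<Sum>i\<in>UNIV. det (\<chi> k. if k = i then D v $ i else G x $ k))"
    proof (rule sum.cong[OF refl])
      fix i :: 'n
      have "D v $ i $ p i * (\<Prod>j\<in>UNIV - {i}. G x $ j $ p j)
         = (\<Prod>j\<in>UNIV. (\<chi> k. if k = i then D v $ i else G x $ k) $ j $ p j)" for p
        by (subst prod.remove[of UNIV i]) (auto intro!: prod.cong)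
      then show "(\<Sum>p | p permutes UNIV. of_int (sign p) * (D v $ i $ p i * (\<Prod>j\<in>UNIV - {i}. G x $ j $ p j)))
         = det (\<chi> k. if k = i then D v $ i else G x $ k)"
        by (simp add: det_def)
    qed
    also have "\<dots> = det (G x) * (\<Sum>i\<in>UNIV. \<Sum>j\<in>UNIV. B $ j $ i * D v $ i $ j)"
      by (simp add: det_replace_row[OF B] sum_distrib_left mult_ac)
    finally show ?thesis .
  qed
  ultimately show ?thesis by simp
qed

lemma matrix_inv_works:
  assumes "invertible A"
  shows "A ** matrix_inv A = mat 1" "matrix_inv A ** A = mat 1"
  using someI_ex[OF assms[unfolded invertible_def]] unfolding matrix_inv_def by auto

lemma hup_contract:
  fixes M :: "complex^'n^'n"
  assumes "invertible M"
  shows "(\<Sum>l\<in>UNIV. hup M k l * M $ j $ l) = (if j = k then 1 else 0)"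
    and "(\<Sum>k\<in>UNIV. hup M k l * M $ k $ m) = (if l = m then 1 else 0)"
proof -
  have "M ** matrix_inv M = mat 1" "matrix_inv M ** M = mat 1"
    using matrix_inv_works[OF assms] by auto
  then have "(M ** matrix_inv M) $ j $ k = (if j = k then 1 else 0)"
    "(matrix_inv M ** M) $ l $ m = (if l = m then 1 else 0)" by (auto simp: mat_def)
  then show "(\<Sum>l\<in>UNIV. hup M k l * M $ j $ l) = (if j = k then 1 else 0)"
    and "(\<Sum>k\<in>UNIV. hup M k l * M $ k $ m) = (if l = m then 1 else 0)"
    by (auto simp: matrix_matrix_mult_def hup_def mult.commute)
qed

lemma matrix_inv_eqI:
  fixes A :: "'a::field^'n^'n"
  assumes "A ** B = mat 1"
  shows "matrix_inv A = B"
proof -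
  have "invertible A" using assms invertible_right_inverse by blast
  then have "matrix_inv A ** A = mat 1" using matrix_inv_works by blast
  then show ?thesis using assms by (metis matrix_mul_assoc matrix_mul_lid matrix_mul_rid)
qed

text \<open>Cramer's rule again; it makes the smoothness of the inverse metric evident.\<close>

lemma hup_eq_det:
  fixes M :: "complex^'n^'n"
  assumes "invertible M"
  shows "hup M k l = det (\<chi> i j. if j = l then (axis k 1 :: complex^'n) $ i else M $ i $ j) / det M"
proof -
  have "M *v (matrix_inv M *v axis k 1) = axis k 1"
    using assms matrix_inv_works[of M] by (simp add: matrix_vector_mul_assoc)
  then have "matrix_inv M *v axis k 1 =
      (\<chi> l. det (\<chi> i j. if j = l then (axis k 1 :: complex^'n) $ i else M $ i $ j) / det M)"
    using cramer[of M] assms invertible_det_nz by blast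
  then have "(matrix_inv M *v axis k 1) $ l = det (\<chi> i j. if j = l then (axis k 1 :: complex^'n) $ i else M $ i $ j) / det M"
    by simp
  then show ?thesis
    by (simp add: hup_def matrix_vector_mult_def axis_def if_distrib[of "\<lambda>x. _ * x"] cong: if_cong)
qed

lemma smooth_hup [smooth_intros]:
  fixes H :: "complex^'n \<Rightarrow> complex^'n^'n"
  assumes S: "open S" and H: "smooth_map_on H S" and inv: "\<And>x. x \<in> S \<Longrightarrow> invertible (H x)"
  shows "smooth_map_on (\<lambda>x. hup (H x) k l) S"
proof (subst smooth_map_on_cong[OF S hup_eq_det[OF inv]])
  have "smooth_map_on (\<lambda>x. (\<chi> i j. if j = l then (axis k 1 :: complex^'n) $ i else H x $ i $ j) $ p $ q) S" for p q
    by (cases "q = l") (auto intro!: smooth_intros S H)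
  then show "smooth_map_on (\<lambda>x. det (\<chi> i j. if j = l then (axis k 1 :: complex^'n) $ i else H x $ i $ j) / det (H x)) S"
    using inv by (intro smooth_divide smooth_det S) (auto simp: invertible_det_nz intro!: smooth_nth S H)
qed

text \<open>Obtained by differentiating \<open>h\<^sup>k\<^sup>q h\<^sub>p\<^sub>q = \<delta>\<^sup>k\<^sub>p\<close>.\<close>

lemma gd_hup:
  fixes H :: "complex^'n \<Rightarrow> complex^'n^'n"
  assumes S: "open S" "x \<in> S" and H: "smooth_map_on H S" and inv: "\<And>x. x \<in> S \<Longrightarrow> invertible (H x)"
  shows "gd a b (\<lambda>y. hup (H y) k l) x v =
     - (\<Sum>q\<in>UNIV. \<Sum>p\<in>UNIV. hup (H x) k q * gd a b (\<lambda>y. H y $ p $ q) x v * hup (H x) p l)"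
proof -
  have dh: "(\<lambda>y. hup (H y) k l) differentiable (at x)" for k l
    by (rule smooth_map_onD(1)[OF smooth_hup[OF S(1) H inv] S(2)])
  have dH: "(\<lambda>y. H y $ k $ l) differentiable (at x)" for k l
    by (rule smooth_map_onD(1)[OF _ S(2)]) (intro smooth_intros S H)
  have 1: "(\<Sum>q\<in>UNIV. gd a b (\<lambda>y. hup (H y) k q) x v * H x $ p $ q) = - (\<Sum>q\<in>UNIV. hup (H x) k q * gd a b (\<lambda>y. H y $ p $ q) x v)" for p
  proof -
    have "0 = gd a b (\<lambda>y. (if p = k then 1 else 0)) x v" by simp
    also have "\<dots> = gd a b (\<lambda>y. \<Sum>q\<in>UNIV. hup (H y) k q * H y $ p $ q) x v"
      by (rule gd_cong[OF S]) (simp add: hup_contract(1)[OF inv])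
    also have "\<dots> = (\<Sum>q\<in>UNIV. gd a b (\<lambda>y. hup (H y) k q) x v * H x $ p $ q + hup (H x) k q * gd a b (\<lambda>y. H y $ p $ q) x v)"
      by (subst gd_sum) (auto intro!: derivative_intros dh dH gd_mult sum.cong)
    finally show ?thesis by (simp add: sum.distrib eq_neg_iff_add_eq_0)
  qed
  have "gd a b (\<lambda>y. hup (H y) k l) x v = (\<Sum>q\<in>UNIV. gd a b (\<lambda>y. hup (H y) k q) x v * (if l = q then 1 else 0))"
    by (simp add: if_distrib[of "\<lambda>x. _ * x"] cong: if_cong)
  also have "\<dots> = (\<Sum>q\<in>UNIV. gd a b (\<lambda>y. hup (H y) k q) x v * (\<Sum>p\<in>UNIV. hup (H x) p l * H x $ p $ q))"
    by (simp add: hup_contract(2)[OF inv[OF S(2)]])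
  also have "\<dots> = (\<Sum>p\<in>UNIV. (\<Sum>q\<in>UNIV. gd a b (\<lambda>y. hup (H y) k q) x v * H x $ p $ q) * hup (H x) p l)"
    unfolding sum_distrib_left sum_distrib_right by (subst sum.swap) (simp add: mult_ac)
  also have "\<dots> = - (\<Sum>q\<in>UNIV. \<Sum>p\<in>UNIV. hup (H x) k q * gd a b (\<lambda>y. H y $ p $ q) x v * hup (H x) p l)"
    unfolding 1 minus_mult_left[symmetric] sum_negf sum_distrib_right by (subst sum.swap) simp
  finally show ?thesis .
qed

lemma gd_det:
  fixes H :: "complex^'n \<Rightarrow> complex^'n^'n"
  assumes dH: "\<And>i j. (\<lambda>y. H y $ i $ j) differentiable (at x)" and inv: "invertible (H x)"
  shows "(\<lambda>y. det (H y)) differentiable (at x)"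
    and "gd a b (\<lambda>y. det (H y)) x v = det (H x) * (\<Sum>i\<in>UNIV. \<Sum>j\<in>UNIV. hup (H x) i j * gd a b (\<lambda>y. H y $ i $ j) x v)"
proof -
  have "((\<lambda>y. det (H y)) has_derivative (\<lambda>v. det (H x) * (\<Sum>i\<in>UNIV. \<Sum>j\<in>UNIV. matrix_inv (H x) $ j $ i *
       (\<chi> i j. fun_d (\<lambda>y. H y $ i $ j) x v) $ i $ j))) (at x)"
    by (rule has_derivative_det) (use dH fun_d_has_derivative inv matrix_inv_works[of "H x"] in auto)
  then have *: "((\<lambda>y. det (H y)) has_derivative (\<lambda>v. det (H x) * (\<Sum>i\<in>UNIV. \<Sum>j\<in>UNIV. hup (H x) i j * fun_d (\<lambda>y. H y $ i $ j) x v))) (at x)"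
    by (simp add: hup_def)
  show "(\<lambda>y. det (H y)) differentiable (at x)" using * differentiable_def by blast
  show "gd a b (\<lambda>y. det (H y)) x v = det (H x) * (\<Sum>i\<in>UNIV. \<Sum>j\<in>UNIV. hup (H x) i j * gd a b (\<lambda>y. H y $ i $ j) x v)"
    unfolding gd_def fun_d_eqI[OF *]
    by (simp add: algebra_simps sum.distrib sum_distrib_left)
qed

section \<open>Hermitian matrices\<close>

lemma sesq_axis: "sesq M (axis i 1) (axis j 1) = M $ i $ j"
  by (simp add: sesq_def axis_def if_distrib[of cnj] if_distrib[of "\<lambda>x. _ * x"] if_distrib[of "\<lambda>x. x * _"] cong: if_cong)

lemma hermitian_posdefD:
  assumes "hermitian_posdef M"
  shows "cnj (M $ i $ j) = M $ j $ i" and "v \<noteq> 0 \<Longrightarrow> Re (sesq M v v) > 0"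
proof -
  have "M $ j $ i = cnj (M $ i $ j)" using assms unfolding hermitian_posdef_def by blast
  then show "cnj (M $ i $ j) = M $ j $ i" by (rule sym)
  show "v \<noteq> 0 \<Longrightarrow> Re (sesq M v v) > 0" using assms unfolding hermitian_posdef_def by blast
qed

lemma hermitian_posdef_invertible:
  assumes "hermitian_posdef M"
  shows "invertible M"
proof -
  have "x = 0" if "M *v x = 0" for x
  proof (rule ccontr)
    assume "x \<noteq> 0"
    define w where "w = (\<chi> i. cnj (x $ i))"
    have "w \<noteq> 0" using \<open>x \<noteq> 0\<close> by (auto simp: w_def vec_eq_iff)
    moreover have "sesq M w w = (\<Sum>i\<in>UNIV. w $ i * (M *v x) $ i)"
      by (simp add: sesq_def w_def matrix_vector_mult_def sum_distrib_left mult_ac)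
    ultimately have "w \<noteq> 0" "sesq M w w = 0" using that by simp_all
    then show False using assms unfolding hermitian_posdef_def by force
  qed
  then show ?thesis
    using matrix_left_invertible_ker[of M] invertible_left_inverse[of M] by blast
qed

lemma det_hermitian_real:
  assumes "hermitian_posdef M"
  shows "Im (det M) = 0"
proof -
  have "cnj (det M) = det (\<chi> i j. cnj (M $ i $ j))"
    by (simp add: det_def)
  also have "(\<chi> i j. cnj (M $ i $ j)) = transpose M"
    by (simp add: hermitian_posdefD(1)[OF assms] transpose_def vec_eq_iff)
  finally have "cnj (det M) = det M" by (simp add: det_transpose)
  then show ?thesis by (simp add: complex_eq_iff)
qed

text \<open>The determinant is real and nonzero on the segment from the identity to a positive definite matrix, so it
  keeps its sign there.\<close>

lemma det_hermitian_pos: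
  fixes M :: "complex^'n^'n"
  assumes M: "hermitian_posdef M"
  shows "Re (det M) > 0" "det M = of_real (Re (det M))"
proof -
  define P where "P t = (1 - t) *\<^sub>R mat 1 + t *\<^sub>R M" for t :: real
  have P: "hermitian_posdef (P t)" if t: "0 \<le> t" "t \<le> 1" for t
    unfolding hermitian_posdef_def
  proof (intro conjI allI impI)
    show "P t $ j $ i = cnj (P t $ i $ j)" for i j
      by (auto simp: P_def hermitian_posdefD(1)[OF M] mat_def)
    fix v :: "complex^'n" assume v: "v \<noteq> 0"
    have "sesq (P t) v v = of_real (1 - t) * sesq (mat 1) v v + of_real t * sesq M v v"
    proof -
      have "P t $ i $ j = of_real (1 - t) * mat 1 $ i $ j + of_real t * M $ i $ j" for i j
        by (simp add: P_def) (simp add: scaleR_conv_of_real)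
      then show ?thesis by (simp add: sesq_def distrib_right sum.distrib sum_distrib_left mult.assoc)
    qed
    moreover have "sesq (mat 1) v v = of_real (\<Sum>i\<in>UNIV. (cmod (v $ i))\<^sup>2)"
      by (simp add: sesq_def mat_def if_distrib[of "\<lambda>x. x * _"] cong: if_cong)
         (simp add: complex_norm_square[symmetric])
    moreover have "(\<Sum>i\<in>UNIV. (cmod (v $ i))\<^sup>2) > 0"
    proof -
      obtain i where "v $ i \<noteq> 0" using v by (auto simp: vec_eq_iff)
      then show ?thesis by (intro sum_pos2[of _ i]) auto
    qed
    moreover have "Re (sesq M v v) > 0" by (rule hermitian_posdefD(2)[OF M v])
    ultimately show "Re (sesq (P t) v v) > 0"
      using t by (cases "t = 0") (auto intro: add_nonneg_pos)
  qed
  have nz: "Re (det (P t)) \<noteq> 0" if "0 \<le> t" "t \<le> 1" for t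
    using hermitian_posdef_invertible[OF P[OF that]] det_hermitian_real[OF P[OF that]]
    by (auto simp: invertible_det_nz complex_eq_iff)
  have cont: "continuous_on {0..1} (\<lambda>t. Re (det (P t)))"
    unfolding det_def P_def by (auto intro!: continuous_intros)
  have "Re (det M) > 0"
  proof (rule ccontr)
    assume "\<not> Re (det M) > 0"
    then have "Re (det (P 1)) \<le> 0" "0 \<le> Re (det (P 0))" by (auto simp: P_def)
    then obtain t where "0 \<le> t" "t \<le> 1" "Re (det (P t)) = 0"
      using IVT2'[of "\<lambda>t. Re (det (P t))" 1 0 0] cont by auto
    then show False using nz by blast
  qed
  then show "Re (det M) > 0" "det M = of_real (Re (det M))"
    using det_hermitian_real[OF M] by (auto simp: complex_eq_iff)
qed

lemma cnj_hup:
  assumes M: "hermitian_posdef M"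
  shows "cnj (hup M k l) = hup M l k"
proof -
  note inv = hermitian_posdef_invertible[OF M]
  define B where "B = (\<chi> l k. cnj (hup M l k))"
  have "M ** B = mat 1"
  proof -
    have "(M ** B) $ i $ j = mat 1 $ i $ j" for i j
    proof -
      have "(\<Sum>k\<in>UNIV. M $ i $ k * B $ k $ j) = cnj (\<Sum>k\<in>UNIV. hup M k j * M $ k $ i)"
        by (simp add: B_def hermitian_posdefD(1)[OF M] mult.commute)
      then show ?thesis
        by (simp add: hup_contract(2)[OF inv] matrix_matrix_mult_def mat_def)
    qed
    then show ?thesis by (simp add: vec_eq_iff)
  qed
  then have "matrix_inv M = B" by (rule matrix_inv_eqI)
  then have "matrix_inv M $ k $ l = B $ k $ l" by simp
  then show ?thesis by (simp add: B_def hup_def[of M l k])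
qed

text \<open>With \<open>v\<close> the vector dual to the covector \<open>a\<close>, the sum is the conjugate of \<open>sesq M v v\<close>.\<close>

lemma hup_pos:
  fixes M :: "complex^'n^'n"
  assumes M: "hermitian_posdef M"
  defines "Q \<equiv> \<lambda>a. \<Sum>k\<in>UNIV. \<Sum>l\<in>UNIV. hup M k l * a k * cnj (a l)"
  shows "Im (Q a) = 0" "Re (Q a) \<ge> 0" "Re (Q a) = 0 \<Longrightarrow> a k = 0"
proof -
  note inv = hermitian_posdef_invertible[OF M]
  define v where "v = (\<chi> l. cnj (\<Sum>k\<in>UNIV. hup M k l * a k))"
  have a: "a j = (\<Sum>l\<in>UNIV. M $ j $ l * cnj (v $ l))" for j
  proof -
    have "(\<Sum>l\<in>UNIV. M $ j $ l * cnj (v $ l)) = (\<Sum>k\<in>UNIV. (\<Sum>l\<in>UNIV. hup M k l * M $ j $ l) * a k)"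
      unfolding v_def by (simp add: sum_distrib_left sum_distrib_right) (subst sum.swap, simp add: mult_ac)
    also have "\<dots> = a j" by (simp add: hup_contract(1)[OF inv] if_distrib[of "\<lambda>x. x * _"] cong: if_cong)
    finally show ?thesis by simp
  qed
  have "Q a = (\<Sum>l\<in>UNIV. cnj (v $ l) * cnj (a l))"
    unfolding Q_def v_def by (simp add: sum_distrib_left sum_distrib_right) (subst sum.swap, simp add: mult_ac)
  also have "\<dots> = cnj (sesq M v v)"
    unfolding a sesq_def by (simp add: sum_distrib_left mult_ac)
  finally have Q: "Q a = cnj (sesq M v v)" .
  have "cnj (sesq M v v) = sesq M v v"
  proof -
    have "cnj (sesq M v v) = (\<Sum>i\<in>UNIV. \<Sum>j\<in>UNIV. M $ j $ i * cnj (v $ i) * v $ j)"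
      unfolding sesq_def by (simp add: hermitian_posdefD(1)[OF M])
    also have "\<dots> = sesq M v v" unfolding sesq_def by (subst sum.swap) (simp add: mult_ac)
    finally show ?thesis .
  qed
  then show "Im (Q a) = 0" unfolding Q by (simp add: complex_eq_iff)
  show "Re (Q a) \<ge> 0" unfolding Q
  proof (cases "v = 0")
    case False
    then show "Re (cnj (sesq M v v)) \<ge> 0" using hermitian_posdefD(2)[OF M, of v] by simp
  qed (simp add: sesq_def)
  show "a k = 0" if "Re (Q a) = 0"
  proof -
    have "v = 0" using that hermitian_posdefD(2)[OF M, of v] unfolding Q by fastforce
    then show ?thesis using a by simp
  qed
qed

lemma sesq_pullback_matrix:
  assumes "\<And>v w. sesq M v w = sesq M' (J *v v) (J *v w)"
  shows "M = transpose J ** M' ** (\<chi> i j. cnj (J $ i $ j))"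
proof -
  have "M $ i $ j = (transpose J ** M' ** (\<chi> i j. cnj (J $ i $ j))) $ i $ j" for i j
  proof -
    have "M $ i $ j = sesq M' (J *v axis i 1) (J *v axis j 1)"
      using assms[of "axis i 1" "axis j 1"] by (simp add: sesq_axis)
    also have "\<dots> = (\<Sum>p\<in>UNIV. \<Sum>q\<in>UNIV. M' $ p $ q * J $ p $ i * cnj (J $ q $ j))"
    proof -
      have "(J *v axis i 1) $ p = J $ p $ i" for i p
        by (simp add: matrix_vector_mult_def axis_def if_distrib[of "\<lambda>x. _ * x"] cong: if_cong)
      then show ?thesis by (simp add: sesq_def)
    qed
    also have "\<dots> = (\<Sum>q\<in>UNIV. \<Sum>p\<in>UNIV. M' $ p $ q * J $ p $ i * cnj (J $ q $ j))"
      by (rule sum.swap)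
    also have "\<dots> = (transpose J ** M' ** (\<chi> i j. cnj (J $ i $ j))) $ i $ j"
      by (simp add: matrix_matrix_mult_def transpose_def sum_distrib_left sum_distrib_right mult_ac)
    finally show ?thesis .
  qed
  then show ?thesis by (simp add: vec_eq_iff)
qed

text \<open>A change of variables \<open>J\<close> conjugates the matrix \<open>M\<^sup>-\<^sup>1 N\<close> by the complex conjugate of \<open>J\<close>; the sums are its trace.\<close>

lemma hup_trace_invariant:
  fixes J :: "complex^'n^'n"
  assumes M: "\<And>v w. sesq M v w = sesq M' (J *v v) (J *v w)"
    and N: "\<And>v w. sesq N v w = sesq N' (J *v v) (J *v w)"
    and inv: "invertible M" "invertible M'"
  shows "(\<Sum>k\<in>UNIV. \<Sum>l\<in>UNIV. hup M k l * N $ k $ l) = (\<Sum>k\<in>UNIV. \<Sum>l\<in>UNIV. hup M' k l * N' $ k $ l)"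
proof -
  define K where "K = (\<chi> i j. cnj (J $ i $ j))"
  define X where "X = matrix_inv M ** N"
  define X' where "X' = matrix_inv M' ** N'"
  have tr: "(\<Sum>k\<in>UNIV. \<Sum>l\<in>UNIV. hup M k l * N $ k $ l) = trace (matrix_inv M ** N)" for M N :: "complex^'n^'n"
    unfolding trace_def matrix_matrix_mult_def hup_def by (subst sum.swap) simp
  have eqM: "M = transpose J ** M' ** K" and eqN: "N = transpose J ** N' ** K"
    using sesq_pullback_matrix[OF M] sesq_pullback_matrix[OF N] by (simp_all add: K_def)
  have i: "M ** matrix_inv M = mat 1" "M' ** matrix_inv M' = mat 1" "matrix_inv M' ** M' = mat 1"
    using inv matrix_inv_works by auto
  have nz: "det (transpose J) \<noteq> 0" "det K \<noteq> 0"
    using inv(1) unfolding invertible_det_nz eqM det_mul by auto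
  obtain JI KI where J: "JI ** transpose J = mat 1" and K: "KI ** K = mat 1" "K ** KI = mat 1"
    using nz by (meson invertible_det_nz invertible_def)
  have "transpose J ** (M' ** (K ** X)) = transpose J ** (M' ** (X' ** K))"
  proof -
    have "transpose J ** (M' ** (K ** X)) = M ** X" unfolding eqM by (simp add: matrix_mul_assoc)
    also have "\<dots> = N" unfolding X_def by (simp add: matrix_mul_assoc i)
    also have "\<dots> = transpose J ** ((M' ** X') ** K)"
      unfolding X'_def eqN by (simp add: matrix_mul_assoc i)
    finally show ?thesis by (simp add: matrix_mul_assoc)
  qed
  then have "M' ** (K ** X) = M' ** (X' ** K)"
    using J by (metis matrix_mul_assoc matrix_mul_lid)
  then have "K ** X = X' ** K"
    using i(3) by (metis matrix_mul_assoc matrix_mul_lid)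
  then have "X = KI ** (X' ** K)"
    using K by (metis matrix_mul_assoc matrix_mul_lid)
  then have "trace X = trace (KI ** (X' ** K))" by (rule arg_cong)
  also have "\<dots> = trace ((X' ** K) ** KI)" by (rule trace_mul_sym)
  also have "\<dots> = trace X'" by (simp add: matrix_mul_assoc[symmetric] K)
  finally show ?thesis unfolding tr X_def X'_def .
qed

section \<open>Exterior algebra on lists of vectors\<close>

text \<open>Products and contractions are pointwise operations, so the algebra is done for the values of forms at a
  point.\<close>

type_synonym 'n pform = "(complex^'n) list \<Rightarrow> complex"

definition pwedge :: "'n::finite pform \<Rightarrow> 'n pform \<Rightarrow> 'n pform" where
  "pwedge a b vs = (\<Sum>I\<in>Pow {..<length vs}.
     (-1) ^ card {(i, j). i < j \<and> i \<in> {..<length vs} - I \<and> j \<in> I} * a (nths vs I) * b (nths vs (- I)))"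

lemma wedge_eq_pwedge: "wedge \<alpha> \<beta> x = pwedge (\<alpha> x) (\<beta> x)"
  by (simp add: wedge_def pwedge_def fun_eq_iff)

definition contract :: "complex^'n::finite \<Rightarrow> 'n pform \<Rightarrow> 'n pform" where
  "contract v a ws = a (v # ws)"

text \<open>The grading involution. It keeps track of signs for forms of mixed degree.\<close>

definition parity :: "'n::finite pform \<Rightarrow> 'n pform" where
  "parity a ws = (-1) ^ length ws * a ws"

lemma parity_parity [simp]: "parity (parity a) = a"
  by (simp add: parity_def fun_eq_iff flip: power_add mult.assoc)

lemma contract_parity: "contract v (parity a) = (\<lambda>ws. - parity (contract v a) ws)"
  by (simp add: parity_def contract_def fun_eq_iff)

lemma pwedge_Nil [simp]: "pwedge a b [] = a [] * b []"
  by (simp add: pwedge_def)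

text \<open>The effect of an additional first argument on the sign of a shuffle: it creates no inversion if it goes to
  the first factor, and one inversion with each argument of the first factor otherwise.\<close>

lemma pwedge_sign_insert:
  assumes "I \<subseteq> {..<n::nat}"
  shows "card {(i, j). i < j \<and> i \<in> {..<Suc n} - insert 0 (Suc ` I) \<and> j \<in> insert 0 (Suc ` I)}
       = card {(i, j). i < j \<and> i \<in> {..<n} - I \<and> j \<in> I}" (is "card ?A = card ?B")
proof -
  have "?A = map_prod Suc Suc ` ?B"
  proof (intro equalityI subsetI)
    fix p assume "p \<in> ?A"
    then obtain i j where p: "p = (i, j)" "i < j" "i < Suc n" "i \<notin> insert 0 (Suc ` I)" "j \<in> insert 0 (Suc ` I)"
      by auto
    then obtain i' j' where "i = Suc i'" "j = Suc j'" by (cases i; cases j) auto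
    then show "p \<in> map_prod Suc Suc ` ?B" using p by (auto intro!: image_eqI[of _ _ "(i', j')"])
  qed auto
  then show ?thesis by (simp add: card_image inj_on_def)
qed

lemma pwedge_sign_shift:
  assumes "I \<subseteq> {..<n::nat}"
  shows "card {(i, j). i < j \<and> i \<in> {..<Suc n} - Suc ` I \<and> j \<in> Suc ` I}
       = card I + card {(i, j). i < j \<and> i \<in> {..<n} - I \<and> j \<in> I}" (is "card ?A = card I + card ?B")
proof -
  have "?A = (\<lambda>j. (0, Suc j)) ` I \<union> map_prod Suc Suc ` ?B"
  proof (intro equalityI subsetI)
    fix p assume "p \<in> ?A"
    then obtain i j where p: "p = (i, j)" "i < j" "i < Suc n" "i \<notin> Suc ` I" "j \<in> Suc ` I"
      by auto
    then obtain j' where "j = Suc j'" by auto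
    show "p \<in> (\<lambda>j. (0, Suc j)) ` I \<union> map_prod Suc Suc ` ?B"
    proof (cases i)
      case (Suc i')
      then show ?thesis using p \<open>j = Suc j'\<close> by (auto intro!: image_eqI[of _ _ "(i', j')"])
    qed (use p in auto)
  qed auto
  moreover have "finite ?B"
    by (rule finite_subset[of _ "{..<n} \<times> {..<n}"]) (use assms in auto)
  moreover have "finite I" using assms finite_subset by blast
  ultimately show ?thesis
    by (simp add: card_Un_disjoint[of "(\<lambda>j. (0, Suc j)) ` I"] card_image inj_on_def image_iff disjoint_iff)
qed

text \<open>Contraction by the first argument is an antiderivation: a shuffle passes that argument either to the
  first factor, at no cost in sign, or to the second one, past all arguments of the first. This recursion
  over the argument list replaces sums over shuffles in everything that follows.\<close>

lemma pwedge_Cons: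
  "pwedge a b (v # ws) = pwedge (contract v a) b ws + pwedge (parity a) (contract v b) ws"
proof -
  define n where "n = length ws"
  define F where "F I = (-1) ^ card {(i, j). i < j \<and> i \<in> {..<Suc n} - I \<and> j \<in> I} *
     a (nths (v # ws) I) * b (nths (v # ws) (- I))" for I
  have Pow: "Pow {..<Suc n} = (\<lambda>I. insert 0 (Suc ` I)) ` Pow {..<n} \<union> (\<lambda>I. Suc ` I) ` Pow {..<n}"
  proof -
    have "{..<Suc n} = insert 0 (Suc ` {..<n})" by (simp add: lessThan_Suc_eq_insert_0)
    then show ?thesis by (simp add: Pow_insert image_Pow_surj image_image[symmetric]) blast
  qed
  have dj: "(\<lambda>I. insert 0 (Suc ` I)) ` Pow {..<n} \<inter> (\<lambda>I. Suc ` I) ` Pow {..<n} = {}" by auto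
  have inj: "inj_on (\<lambda>I. insert 0 (Suc ` I)) (Pow {..<n})" "inj_on (\<lambda>I. Suc ` I) (Pow {..<n})"
    by (auto simp: inj_on_def)
  have s1: "{j. Suc j \<in> insert 0 (Suc ` I)} = I" "{j. Suc j \<in> - insert 0 (Suc ` I)} = - I"
     "{j. Suc j \<in> Suc ` I} = I" "{j. Suc j \<in> - Suc ` I} = - I" for I by auto
  have nt: "nths (v # ws) (insert 0 (Suc ` I)) = v # nths ws I" "nths (v # ws) (- insert 0 (Suc ` I)) = nths ws (- I)"
    "nths (v # ws) (Suc ` I) = nths ws I" "nths (v # ws) (- Suc ` I) = v # nths ws (- I)" for I
    unfolding nths_Cons s1 by auto
  have c: "length (nths ws I) = card I" if "I \<subseteq> {..<n}" for I
    using that by (auto simp: length_nths n_def intro!: arg_cong[of _ _ card])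
  have "pwedge a b (v # ws) = sum F (Pow {..<Suc n})"
    by (simp add: pwedge_def F_def n_def)
  also have "\<dots> = (\<Sum>I\<in>Pow {..<n}. F (insert 0 (Suc ` I))) + (\<Sum>I\<in>Pow {..<n}. F (Suc ` I))"
    unfolding Pow by (subst sum.union_disjoint[OF _ _ dj]) (simp_all add: sum.reindex[OF inj(1)] sum.reindex[OF inj(2)])
  also have "(\<Sum>I\<in>Pow {..<n}. F (insert 0 (Suc ` I))) = pwedge (contract v a) b ws"
    unfolding pwedge_def n_def[symmetric]
    by (intro sum.cong refl) (simp only: F_def nt contract_def Pow_iff pwedge_sign_insert)
  also have "(\<Sum>I\<in>Pow {..<n}. F (Suc ` I)) = pwedge (parity a) (contract v b) ws"
    unfolding pwedge_def n_def[symmetric]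
    by (intro sum.cong refl) (simp only: F_def nt contract_def parity_def Pow_iff pwedge_sign_shift c power_add mult_ac)
  finally show ?thesis .
qed

lemma contract_pwedge:
  "contract v (pwedge a b) = (\<lambda>ws. pwedge (contract v a) b ws + pwedge (parity a) (contract v b) ws)"
  by (simp add: fun_eq_iff pwedge_Cons contract_def[of v "pwedge a b"])

lemma pwedge_add:
  "pwedge (\<lambda>ws. a ws + a' ws) b vs = pwedge a b vs + pwedge a' b vs"
  "pwedge a (\<lambda>ws. b ws + b' ws) vs = pwedge a b vs + pwedge a b' vs"
  by (simp_all add: pwedge_def algebra_simps sum.distrib)

lemma pwedge_scale:
  "pwedge (\<lambda>ws. c * a ws) b vs = c * pwedge a b vs"
  "pwedge a (\<lambda>ws. c * b ws) vs = c * pwedge a b vs"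
  by (simp_all add: pwedge_def algebra_simps sum_distrib_left)

lemma pwedge_minus:
  "pwedge (\<lambda>ws. - a ws) b vs = - pwedge a b vs"
  "pwedge a (\<lambda>ws. - b ws) vs = - pwedge a b vs"
  by (simp_all add: pwedge_def sum_negf)

lemma pwedge_diff:
  "pwedge (\<lambda>ws. a ws - a' ws) b vs = pwedge a b vs - pwedge a' b vs"
  "pwedge a (\<lambda>ws. b ws - b' ws) vs = pwedge a b vs - pwedge a b' vs"
  by (simp_all add: pwedge_def algebra_simps sum_subtractf)

lemma pwedge_zero [simp]: "pwedge (\<lambda>ws. 0) b vs = 0" "pwedge a (\<lambda>ws. 0) vs = 0"
  by (simp_all add: pwedge_def)

lemma pwedge_sum:
  "pwedge (\<lambda>ws. \<Sum>i\<in>A. f i ws) b vs = (\<Sum>i\<in>A. pwedge (f i) b vs)"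
  "pwedge a (\<lambda>ws. \<Sum>i\<in>A. f i ws) vs = (\<Sum>i\<in>A. pwedge a (f i) vs)"
  by (induction A rule: infinite_finite_induct) (simp_all add: pwedge_add)

lemma parity_pwedge: "parity (pwedge a b) vs = pwedge (parity a) (parity b) vs"
proof (induction vs arbitrary: a b)
  case (Cons v ws)
  have "parity (pwedge a b) (v # ws) = - parity (contract v (pwedge a b)) ws"
    by (simp add: parity_def contract_def)
  also have "\<dots> = - (parity (pwedge (contract v a) b) ws + parity (pwedge (parity a) (contract v b)) ws)"
    unfolding contract_pwedge by (simp add: parity_def algebra_simps)
  finally show ?case by (simp add: Cons pwedge_Cons contract_parity pwedge_minus)
qed (simp add: parity_def)

lemma pwedge_assoc: "pwedge (pwedge a b) c vs = pwedge a (pwedge b c) vs"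
proof (induction vs arbitrary: a b c)
  case (Cons v ws)
  have "parity (pwedge a b) = pwedge (parity a) (parity b)" by (simp add: fun_eq_iff parity_pwedge)
  then show ?case by (simp add: pwedge_Cons contract_pwedge pwedge_add Cons)
qed simp

text \<open>For \<open>e = (-1)\<^sup>p\<close> and \<open>d = (-1)\<^sup>q\<close> the factor is \<open>(-1)\<^sup>p\<^sup>q\<close>. It is a function of \<open>e\<close> and \<open>d\<close> because contraction,
  on which the induction rests, only changes these signs.\<close>

lemma pwedge_graded_commute:
  assumes "parity a = (\<lambda>ws. e * a ws)" "parity b = (\<lambda>ws. d * b ws)" "e \<in> {1, -1}" "d \<in> {1, -1}"
  shows "pwedge a b vs = (1 + e + d - e * d) / 2 * pwedge b a vs"
  using assms
proof (induction vs arbitrary: a b e d)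
  case Nil
  then have "parity a [] = e * a []" "parity b [] = d * b []" by simp_all
  then have "a [] = 0 \<or> e = 1" "b [] = 0 \<or> d = 1" by (simp_all add: parity_def)
  then show ?case by auto
next
  case (Cons v ws)
  have 1: "parity (contract v a) = (\<lambda>ws. - e * contract v a ws)"
    if "parity a = (\<lambda>ws. e * a ws)" for a :: "'a pform" and e
  proof -
    have "parity (contract v a) ws = - parity a (v # ws)" for ws by (simp add: parity_def contract_def)
    then show ?thesis using that by (simp add: contract_def fun_eq_iff)
  qed
  have em: "- e \<in> {1, - 1}" "- d \<in> {1, - 1}" using Cons.prems(3,4) by auto
  have "pwedge a b (v # ws) = (1 + - e + d - - e * d) / 2 * pwedge b (contract v a) ws
       + e * ((1 + e + - d - e * - d) / 2 * pwedge (contract v b) a ws)"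
    unfolding pwedge_Cons Cons.prems(1) pwedge_scale
      Cons.IH[OF 1[OF Cons.prems(1)] Cons.prems(2) em(1) Cons.prems(4)]
      Cons.IH[OF Cons.prems(1) 1[OF Cons.prems(2)] Cons.prems(3) em(2)] ..
  moreover have "pwedge b a (v # ws) = pwedge (contract v b) a ws + d * pwedge b (contract v a) ws"
    unfolding pwedge_Cons Cons.prems(2) pwedge_scale ..
  moreover have "e = 1 \<or> e = -1" "d = 1 \<or> d = -1" using Cons.prems(3,4) by auto
  ultimately show ?case by (elim disjE) (simp_all only:, simp_all)
qed

definition unit_form :: "'n::finite pform" where
  "unit_form vs = (if vs = [] then 1 else 0)"

lemma pwedge_unit [simp]: "pwedge a unit_form vs = a vs"
proof (induction vs arbitrary: a)
  case (Cons v ws)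
  have "contract v unit_form = (\<lambda>ws. 0)" by (simp add: contract_def unit_form_def fun_eq_iff)
  then show ?case by (simp add: pwedge_Cons Cons) (simp add: contract_def)
qed (simp add: unit_form_def)

definition of_degree :: "nat \<Rightarrow> 'n::finite pform \<Rightarrow> bool" where
  "of_degree k a \<longleftrightarrow> (\<forall>vs. length vs \<noteq> k \<longrightarrow> a vs = 0)"

lemma of_degree_parity: "of_degree k a \<Longrightarrow> parity a = (\<lambda>ws. (-1) ^ k * a ws)"
  by (auto simp: of_degree_def parity_def fun_eq_iff)

lemma of_degree_contract: "of_degree (Suc k) a \<Longrightarrow> of_degree k (contract v a)"
  by (auto simp: of_degree_def contract_def)

lemma of_degree_pwedge:
  assumes "of_degree k a" "of_degree l b"
  shows "of_degree (k + l) (pwedge a b)"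
  unfolding of_degree_def
proof (intro allI impI)
  fix vs :: "(complex^'a) list" assume len: "length vs \<noteq> k + l"
  have "length (nths vs I) + length (nths vs (- I)) = length vs" for I
  proof -
    have "length (nths vs I) + length (nths vs (- I)) = card ({i. i < length vs \<and> i \<in> I} \<union> {i. i < length vs \<and> i \<in> - I})"
      unfolding length_nths by (subst card_Un_disjoint) auto
    also have "{i. i < length vs \<and> i \<in> I} \<union> {i. i < length vs \<and> i \<in> - I} = {..<length vs}" by auto
    finally show ?thesis by simp
  qed
  then have ab: "a (nths vs I) = 0 \<or> b (nths vs (- I)) = 0" for I
    using assms len unfolding of_degree_def by metis
  have "(-1) ^ card {(i, j). i < j \<and> i \<in> {..<length vs} - I \<and> j \<in> I} * a (nths vs I) * b (nths vs (- I)) = 0" for I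
    using ab[of I] by (elim disjE) simp_all
  then show "pwedge a b vs = 0" unfolding pwedge_def by (intro sum.neutral) blast
qed

lemma pwedge_degree_0:
  "of_degree 0 a \<Longrightarrow> pwedge a b vs = a [] * b vs"
proof (induction vs arbitrary: b)
  case (Cons v ws)
  have "contract v a = (\<lambda>ws. 0)" "parity a = a"
    using Cons.prems of_degree_parity[OF Cons.prems] by (simp_all add: of_degree_def contract_def fun_eq_iff)
  then show ?case using Cons by (simp add: pwedge_Cons) (simp add: contract_def)
qed simp

lemma pwedge_degree_1_Cons:
  assumes "of_degree 1 a"
  shows "pwedge a b (v # ws) = a [v] * b ws - pwedge a (contract v b) ws"
  using pwedge_degree_0[OF of_degree_contract[of 0 a v]] assms
  by (simp add: pwedge_Cons of_degree_parity pwedge_minus contract_def)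

section \<open>Alternating forms\<close>

lemmas scaleR_complex = scaleR_conv_of_real[where 'a = complex]

text \<open>It suffices to test adjacent equal arguments. Unlike the condition on all lists with repeated entries, this
  passes easily through recursions over the argument list.\<close>

definition altform :: "'n::finite pform \<Rightarrow> bool" where
  "altform a \<longleftrightarrow> (\<forall>us v ws. a (us @ v # v # ws) = 0) \<and> (\<forall>us ws. linear (\<lambda>v. a (us @ v # ws)))"

lemma altform_adjacent: "altform a \<Longrightarrow> a (us @ v # v # ws) = 0"
  and altform_linear: "altform a \<Longrightarrow> linear (\<lambda>v. a (us @ v # ws))"
  by (auto simp: altform_def)

lemma altform_swap:
  assumes "altform a"
  shows "a (us @ v # w # ws) = - a (us @ w # v # ws)"
proof -
  have l: "a (us @ (v + w) # ws) = a (us @ v # ws) + a (us @ w # ws)" for us v w ws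
    by (rule linear_add[OF altform_linear[OF assms]])
  have "0 = a (us @ (v + w) # (v + w) # ws)" by (simp add: altform_adjacent[OF assms])
  also have "\<dots> = a (us @ v # v # ws) + a (us @ v # w # ws) + (a (us @ w # v # ws) + a (us @ w # w # ws))"
    using l[of us v w "(v + w) # ws"] l[of "us @ [v]" v w ws] l[of "us @ [w]" v w ws] by simp
  finally show ?thesis by (simp add: altform_adjacent[OF assms] eq_neg_iff_add_eq_0)
qed

lemma altform_repeat:
  assumes "altform a"
  shows "a (us @ v # ws @ v # zs) = 0"
proof (induction ws arbitrary: us)
  case (Cons w ws)
  have "a (us @ v # w # ws @ v # zs) = - a ((us @ [w]) @ v # ws @ v # zs)"
    using altform_swap[OF assms, of us v w "ws @ v # zs"] by simp
  then show ?case using Cons[of "us @ [w]"] by simp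
qed (simp add: altform_adjacent[OF assms])

lemma altform_not_distinct:
  assumes "altform a" "\<not> distinct vs"
  shows "a vs = 0"
proof -
  obtain xs ys zs y where "vs = xs @ [y] @ ys @ [y] @ zs" using not_distinct_decomp[OF assms(2)] by blast
  then show ?thesis using altform_repeat[OF assms(1)] by simp
qed

lemma altform_contract: "altform a \<Longrightarrow> altform (contract v a)"
  unfolding altform_def[of "contract v a"] contract_def
  using altform_adjacent[of a "v # _"] altform_linear[of a "v # _"] by simp

lemma altform_parity: 
  assumes "altform a" shows "altform (parity a)"
  unfolding altform_def
proof (intro conjI allI)
  show "linear (\<lambda>v. parity a (us @ v # ws))" for us ws
    by (rule linearI) (simp_all add: parity_def linear_add[OF altform_linear[OF assms]]
        linear_scale[OF altform_linear[OF assms]] scaleR_complex algebra_simps)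
qed (use assms in \<open>simp add: parity_def altform_def\<close>)

text \<open>Once the recursion has reached a repeated argument \<open>v\<close>, the terms with both copies in one factor vanish,
  and the two terms with one copy in each factor cancel.\<close>

lemma altform_pwedge:
  assumes "altform a" "altform b"
  shows "altform (pwedge a b)"
proof -
  have lin: "linear (\<lambda>v. pwedge (contract v a) b ws)" "linear (\<lambda>v. pwedge b (contract v a) ws)"
    if a: "altform a" for a b :: "'a pform" and ws
  proof -
    have "linear (\<lambda>v. contract v a us)" for us using altform_linear[OF a, of "[]"] by (simp add: contract_def)
    note l = linear_add[OF this] linear_scale[OF this]
    have c: "contract (v + w) a = (\<lambda>us. contract v a us + contract w a us)"
      "contract (r *\<^sub>R v) a = (\<lambda>us. of_real r * contract v a us)" for v w r
      by (simp_all add: fun_eq_iff l scaleR_complex)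
    show "linear (\<lambda>v. pwedge (contract v a) b ws)" "linear (\<lambda>v. pwedge b (contract v a) ws)"
      by (auto intro!: linearI simp: c pwedge_add pwedge_scale scaleR_complex)
  qed
  have z: "contract v (contract v a) = (\<lambda>ws. 0)" if "altform a" for a :: "'a pform" and v
    using altform_adjacent[OF that, of "[]"] by (simp add: contract_def fun_eq_iff)
  have 1: "pwedge a b (us @ v # v # ws) = 0" if "altform a" "altform b" for us v ws and a b :: "'a pform"
    using that
  proof (induction us arbitrary: a b)
    case Nil
    then show ?case
      by (simp add: pwedge_Cons z contract_parity pwedge_minus)
  next
    case (Cons u us)
    then show ?case by (simp add: pwedge_Cons altform_contract altform_parity)
  qed
  have 2: "linear (\<lambda>v. pwedge a b (us @ v # ws))" if "altform a" "altform b" for us ws and a b :: "'a pform"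
    using that
  proof (induction us arbitrary: a b)
    case Nil
    then show ?case by (simp add: pwedge_Cons linear_compose_add lin)
  next
    case (Cons u us)
    then show ?case by (simp add: pwedge_Cons linear_compose_add altform_contract altform_parity)
  qed
  show ?thesis using 1[OF assms] 2[OF assms] unfolding altform_def by blast
qed

text \<open>More arguments than the real dimension: expanding all of them in a basis leaves repeated basis
  vectors.\<close>

lemma altform_degree_too_large:
  fixes a :: "'n::finite pform"
  assumes a: "altform a" and len: "length vs > 2 * CARD('n)"
  shows "a vs = 0"
proof -
  have "a (us @ vs) = 0" if "set us \<subseteq> Basis" "length us + length vs > DIM(complex^'n)" for us
    using that
  proof (induction vs arbitrary: us)
    case Nil
    then have "\<not> distinct us"
      using card_mono[OF finite_Basis, of "set us"] distinct_card[of us] by auto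
    then show ?case using altform_not_distinct[OF a] by simp
  next
    case (Cons v vs)
    have "a (us @ v # vs) = a (us @ (\<Sum>b\<in>Basis. (v \<bullet> b) *\<^sub>R b) # vs)"
      by (simp add: euclidean_representation)
    also have "\<dots> = (\<Sum>b\<in>Basis. (v \<bullet> b) *\<^sub>R a (us @ b # vs))"
      by (simp only: linear_sum[OF altform_linear[OF a]] linear_scale[OF altform_linear[OF a]])
    also have "\<dots> = 0"
      using Cons.IH[of "us @ [_]"] Cons.prems by (intro sum.neutral) auto
    finally show ?case .
  qed
  from this[of "[]"] show ?thesis using len by simp
qed

section \<open>Contraction with the bivector dual to the fundamental form\<close>

text \<open>Contraction with the complex tangent vector \<open>p v + q J v\<close>, where \<open>J\<close> is the complex structure and the form
  is extended complex linearly.\<close>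

definition ccontract :: "complex \<Rightarrow> complex \<Rightarrow> complex^'n::finite \<Rightarrow> 'n pform \<Rightarrow> 'n pform" where
  "ccontract p q v a ws = p * contract v a ws + q * contract (\<i> *s v) a ws"

text \<open>Contraction with \<open>\<partial>/\<partial>z\<^sup>i\<close> and with \<open>\<partial>/\<partial>(cnj z)\<^sup>i\<close>.\<close>

definition zcontract :: "'n::finite \<Rightarrow> 'n pform \<Rightarrow> 'n pform" where
  "zcontract i = ccontract (1/2) (- \<i>/2) (axis i 1)"

definition zbcontract :: "'n::finite \<Rightarrow> 'n pform \<Rightarrow> 'n pform" where
  "zbcontract i = ccontract (1/2) (\<i>/2) (axis i 1)"

lemma ccontract_pwedge:
  "ccontract p q v (pwedge a b) = (\<lambda>ws. pwedge (ccontract p q v a) b ws + pwedge (parity a) (ccontract p q v b) ws)"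
  unfolding ccontract_def contract_pwedge
  by (simp add: fun_eq_iff pwedge_add pwedge_scale algebra_simps)

lemma ccontract_add:
  "ccontract p q v (\<lambda>ws. a ws + b ws) = (\<lambda>ws. ccontract p q v a ws + ccontract p q v b ws)"
  by (simp add: ccontract_def contract_def fun_eq_iff algebra_simps)

lemma of_degree_ccontract: "of_degree (Suc k) a \<Longrightarrow> of_degree k (ccontract p q v a)"
  by (simp add: ccontract_def of_degree_def contract_def)

lemma ccontract_twice_pwedge:
  assumes w: "of_degree 2 w"
  shows "ccontract p' q' v' (ccontract p q v (pwedge w g)) ws =
     ccontract p' q' v' (ccontract p q v w) [] * g ws
     - pwedge (ccontract p q v w) (ccontract p' q' v' g) ws
     + pwedge (ccontract p' q' v' w) (ccontract p q v g) ws
     + pwedge w (ccontract p' q' v' (ccontract p q v g)) ws"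
proof -
  have pw: "parity w = w" using of_degree_parity[OF w] by simp
  have d1: "of_degree 1 (ccontract p q v w)" using w of_degree_ccontract[of 1 w] by (simp add: numeral_2_eq_2)
  have d0: "of_degree 0 (ccontract p' q' v' (ccontract p q v w))" using d1 of_degree_ccontract[of 0] by simp
  show ?thesis
    unfolding ccontract_pwedge ccontract_add pw of_degree_parity[OF d1] pwedge_degree_0[OF d0]
    by (simp add: pwedge_minus)
qed

definition dz_form :: "'n::finite \<Rightarrow> 'n pform" where
  "dz_form i ws = (case ws of [u] \<Rightarrow> u $ i | _ \<Rightarrow> 0)"

definition dzb_form :: "'n::finite \<Rightarrow> 'n pform" where
  "dzb_form i ws = (case ws of [u] \<Rightarrow> cnj (u $ i) | _ \<Rightarrow> 0)"

lemma of_degree_dz_form: "of_degree 1 (dz_form i)" "of_degree 1 (dzb_form i)"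
  by (auto simp: of_degree_def dz_form_def dzb_form_def split: list.splits)

lemma altform_ccontract_anticommute:
  assumes "altform a"
  shows "contract v (ccontract p q u a) = (\<lambda>ws. - ccontract p q u (contract v a) ws)"
proof -
  have *: "a (v # w # ws) = - a (w # v # ws)" for w ws
    by (rule altform_swap[OF assms, of "[]", unfolded append_Nil])
  show ?thesis
  proof
    fix ws
    show "contract v (ccontract p q u a) ws = - ccontract p q u (contract v a) ws"
      unfolding contract_def ccontract_def *[of u ws] *[of "\<i> *s u" ws] by (simp add: algebra_simps)
  qed
qed

lemma altform_expand_first:
  fixes a :: "'n::finite pform"
  assumes "altform a"
  shows "(\<Sum>i\<in>UNIV. v $ i * zcontract i a ws + cnj (v $ i) * zbcontract i a ws) = a (v # ws)"
proof -
  note l = altform_linear[OF assms, of "[]" ws, simplified]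
  have "a (v # ws) = a ((\<Sum>i\<in>UNIV. v $ i *s axis i 1) # ws)" by (simp add: basis_expansion)
  also have "\<dots> = (\<Sum>i\<in>UNIV. a (v $ i *s axis i 1 # ws))" by (rule linear_sum[OF l])
  also have "\<dots> = (\<Sum>i\<in>UNIV. of_real (Re (v $ i)) * a (axis i 1 # ws) + of_real (Im (v $ i)) * a (\<i> *s axis i 1 # ws))"
    by (subst cscale_conv_scaleR) (simp only: linear_add[OF l] linear_scale[OF l] scaleR_complex)
  also have "\<dots> = (\<Sum>i\<in>UNIV. v $ i * zcontract i a ws + cnj (v $ i) * zbcontract i a ws)"
    by (intro sum.cong refl)
       (simp add: zcontract_def zbcontract_def ccontract_def contract_def complex_eq_iff algebra_simps add_divide_distrib diff_divide_distrib)
  finally show ?thesis ..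
qed

text \<open>Euler's identity: contracting with each basis vector and wedging with its dual multiplies a form by
  its degree.\<close>

lemma altform_euler:
  fixes a :: "'n::finite pform"
  assumes "altform a"
  shows "(\<Sum>i\<in>UNIV. pwedge (dz_form i) (zcontract i a) ws + pwedge (dzb_form i) (zbcontract i a) ws)
     = of_nat (length ws) * a ws"
  using assms
proof (induction ws arbitrary: a)
  case Nil
  then show ?case by (simp add: dz_form_def dzb_form_def)
next
  case (Cons v ws)
  have "(\<Sum>i\<in>UNIV. pwedge (dz_form i) (zcontract i a) (v # ws) + pwedge (dzb_form i) (zbcontract i a) (v # ws))
     = (\<Sum>i\<in>UNIV. v $ i * zcontract i a ws + cnj (v $ i) * zbcontract i a ws)
     + (\<Sum>i\<in>UNIV. pwedge (dz_form i) (zcontract i (contract v a)) ws + pwedge (dzb_form i) (zbcontract i (contract v a)) ws)"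
    by (simp add: pwedge_degree_1_Cons[OF of_degree_dz_form(1)] pwedge_degree_1_Cons[OF of_degree_dz_form(2)]
        zcontract_def zbcontract_def altform_ccontract_anticommute[OF Cons.prems] pwedge_minus sum.distrib sum_subtractf
        dz_form_def[of _ "[v]"] dzb_form_def[of _ "[v]"])
  also have "\<dots> = a (v # ws) + of_nat (length ws) * contract v a ws"
    by (simp add: altform_expand_first[OF Cons.prems] Cons.IH[OF altform_contract[OF Cons.prems]])
  finally show ?case by (simp add: contract_def algebra_simps)
qed

text \<open>The adjoint of the multiplication with \<open>\<omega>\<close>, up to a constant factor.\<close>

definition lambda_op :: "complex^'n^'n \<Rightarrow> 'n::finite pform \<Rightarrow> 'n pform" where
  "lambda_op M a ws = (\<Sum>i\<in>UNIV. \<Sum>j\<in>UNIV. hup M i j * zbcontract j (zcontract i a) ws)"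

definition form11_at :: "complex^'n^'n \<Rightarrow> 'n::finite pform" where
  "form11_at M vs = (case vs of [v, w] \<Rightarrow> \<i> * (sesq M v w - sesq M w v) | _ \<Rightarrow> 0)"

lemma form11_eq_at: "form11 H x = form11_at (H x)"
  by (simp add: form11_def form11_at_def fun_eq_iff)

lemma sesq_linear:
  "sesq M (v + v') w = sesq M v w + sesq M v' w" "sesq M v (w + w') = sesq M v w + sesq M v w'"
  "sesq M (c *s v) w = c * sesq M v w" "sesq M v (c *s w) = cnj c * sesq M v w"
  "sesq M (r *\<^sub>R v) w = of_real r * sesq M v w" "sesq M v (r *\<^sub>R w) = of_real r * sesq M v w"
  by (simp_all add: sesq_def algebra_simps sum.distrib sum_distrib_left scaleR_complex)

lemma of_degree_form11: "of_degree 2 (form11_at M)"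
  by (auto simp: of_degree_def form11_at_def split: list.splits)

lemma altform_form11: "altform (form11_at M)"
  unfolding altform_def
proof (intro conjI allI)
  fix us ws :: "(complex^'a) list" and v
  show "form11_at M (us @ v # v # ws) = 0"
    by (cases us; cases ws) (auto simp: form11_at_def split: list.splits)
  consider w where "us = []" "ws = [w]" | w where "us = [w]" "ws = []" | "length (us @ v # ws) \<noteq> 2"
  proof -
    have "length (us @ v # ws) \<noteq> 2 \<or> us = [] \<and> length ws = 1 \<or> length us = 1 \<and> ws = []"
      by (cases us; cases ws) simp_all
    then show ?thesis using that by (auto simp: length_Suc_conv)
  qed
  then show "linear (\<lambda>v. form11_at M (us @ v # ws))"
  proof cases
    case 3
    then have "form11_at M (us @ v # ws) = 0" for v
      using of_degree_form11[of M] unfolding of_degree_def by simp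
    then show ?thesis by (simp add: linear_iff)
  qed (auto simp: form11_at_def sesq_linear algebra_simps scaleR_complex intro!: linearI)
qed

lemma zcontract_form11:
  "zcontract i (form11_at M) ws = \<i> * (\<Sum>l\<in>UNIV. M $ i $ l * dzb_form l ws)"
  "zbcontract j (form11_at M) ws = - \<i> * (\<Sum>k\<in>UNIV. M $ k $ j * dz_form k ws)"
proof -
  have e: "sesq M (axis i 1) u = (\<Sum>l\<in>UNIV. M $ i $ l * cnj (u $ l))" "sesq M u (axis j 1) = (\<Sum>k\<in>UNIV. M $ k $ j * u $ k)" for u i j
    by (simp_all add: sesq_def axis_def if_distrib[of cnj] if_distrib[of "\<lambda>x. _ * x"] if_distrib[of "\<lambda>x. x * _"] cong: if_cong)
       (subst sum.swap, simp)
  show "zcontract i (form11_at M) ws = \<i> * (\<Sum>l\<in>UNIV. M $ i $ l * dzb_form l ws)"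
  proof (cases "length ws = 1")
    case True
    then obtain u where "ws = [u]" by (auto simp: length_Suc_conv)
    then show ?thesis
      by (simp add: zcontract_def ccontract_def contract_def form11_at_def dzb_form_def sesq_linear flip: e)
         (simp add: field_simps)
  next
    case False
    then have "dzb_form l ws = 0" for l by (auto simp: dzb_form_def split: list.splits)
    then show ?thesis
      using False of_degree_ccontract[of 1 "form11_at M"] of_degree_form11[of M]
      by (simp add: of_degree_def zcontract_def numeral_2_eq_2)
  qed
  show "zbcontract j (form11_at M) ws = - \<i> * (\<Sum>k\<in>UNIV. M $ k $ j * dz_form k ws)"
  proof (cases "length ws = 1")
    case True
    then obtain u where "ws = [u]" by (auto simp: length_Suc_conv)
    then show ?thesis
      by (simp add: zbcontract_def ccontract_def contract_def form11_at_def dz_form_def sesq_linear flip: e)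
         (simp add: field_simps)
  next
    case False
    then have "dz_form l ws = 0" for l by (auto simp: dz_form_def split: list.splits)
    then show ?thesis
      using False of_degree_ccontract[of 1 "form11_at M"] of_degree_form11[of M]
      by (simp add: of_degree_def zbcontract_def numeral_2_eq_2)
  qed
qed

text \<open>The commutator of the Lefschetz operator with its (unnormalised) adjoint is the degree counted from the
  middle. Of the four terms of the double contraction of \<open>\<omega> \<and> g\<close>, the one with both contractions on \<open>\<omega>\<close> gives
  the dimension, the two with one contraction on each factor give the degree by Euler's identity, and the one
  with both contractions on \<open>g\<close> belongs to the commutator.\<close>

lemma lambda_op_pwedge_form11:
  fixes g :: "'n::finite pform"
  assumes inv: "invertible M" and g: "altform g"
  shows "lambda_op M (pwedge (form11_at M) g) ws =
     \<i> * (of_nat CARD('n) - of_nat (length ws)) * g ws + pwedge (form11_at M) (lambda_op M g) ws"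
proof -
  let ?w = "form11_at M"
  have z0: "zbcontract j (zcontract i ?w) [] = \<i> * M $ i $ j" for i j
  proof -
    have "zcontract i ?w [axis j 1] = \<i> * M $ i $ j" "zcontract i ?w [\<i> *s axis j 1] = M $ i $ j"
      unfolding zcontract_form11 by (simp_all add: dzb_form_def axis_def if_distrib[of cnj] if_distrib[of "\<lambda>x. _ * x"] cong: if_cong)
       (simp add: complex_eq_iff)
    then show ?thesis by (simp add: zbcontract_def ccontract_def contract_def field_simps)
  qed
  have key: "zbcontract j (zcontract i (pwedge ?w g)) ws = \<i> * M $ i $ j * g ws
     - pwedge (zcontract i ?w) (zbcontract j g) ws + pwedge (zbcontract j ?w) (zcontract i g) ws
     + pwedge ?w (zbcontract j (zcontract i g)) ws" for i j
    unfolding z0[symmetric] unfolding zcontract_def zbcontract_def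
    by (rule ccontract_twice_pwedge[OF of_degree_form11])
  have "lambda_op M (pwedge ?w g) ws =
     (\<Sum>i\<in>UNIV. \<Sum>j\<in>UNIV. hup M i j * (\<i> * M $ i $ j * g ws))
     - (\<Sum>i\<in>UNIV. \<Sum>j\<in>UNIV. hup M i j * pwedge (zcontract i ?w) (zbcontract j g) ws)
     + (\<Sum>i\<in>UNIV. \<Sum>j\<in>UNIV. hup M i j * pwedge (zbcontract j ?w) (zcontract i g) ws)
     + (\<Sum>i\<in>UNIV. \<Sum>j\<in>UNIV. hup M i j * pwedge ?w (zbcontract j (zcontract i g)) ws)"
    by (simp only: lambda_op_def key distrib_left right_diff_distrib sum.distrib sum_subtractf)
  also have "(\<Sum>i\<in>UNIV. \<Sum>j\<in>UNIV. hup M i j * (\<i> * M $ i $ j * g ws)) = \<i> * of_nat CARD('n) * g ws"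
  proof -
    have "(\<Sum>i\<in>UNIV. \<Sum>j\<in>UNIV. hup M i j * (\<i> * M $ i $ j * g ws)) =
        (\<Sum>i\<in>UNIV. (\<Sum>j\<in>UNIV. hup M i j * M $ i $ j) * (\<i> * g ws))"
      unfolding sum_distrib_right by (simp add: mult_ac)
    also have "\<dots> = (\<Sum>i\<in>(UNIV::'n set). \<i> * g ws)"
      by (simp only: hup_contract(1)[OF inv] refl if_True mult_1)
    finally show ?thesis by (simp add: mult_ac)
  qed
  also have "(\<Sum>i\<in>UNIV. \<Sum>j\<in>UNIV. hup M i j * pwedge (zcontract i ?w) (zbcontract j g) ws)
     = \<i> * (\<Sum>j\<in>UNIV. pwedge (dzb_form j) (zbcontract j g) ws)"
  proof -
    have A: "(\<Sum>i\<in>UNIV. \<Sum>j\<in>UNIV. hup M i j * pwedge (zcontract i ?w) (zbcontract j g) ws)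
       = (\<Sum>j\<in>UNIV. pwedge (\<lambda>us. \<Sum>i\<in>UNIV. hup M i j * zcontract i ?w us) (zbcontract j g) ws)"
      by (subst sum.swap) (simp add: pwedge_sum pwedge_scale)
    have B: "(\<lambda>us. \<Sum>i\<in>UNIV. hup M i j * zcontract i ?w us) = (\<lambda>us. \<i> * dzb_form j us)" for j
    proof
      fix us
      have "(\<Sum>i\<in>UNIV. hup M i j * zcontract i ?w us) = \<i> * (\<Sum>l\<in>UNIV. (\<Sum>i\<in>UNIV. hup M i j * M $ i $ l) * dzb_form l us)"
        unfolding zcontract_form11 sum_distrib_left sum_distrib_right
        by (subst sum.swap) (simp add: mult_ac)
      then show "(\<Sum>i\<in>UNIV. hup M i j * zcontract i ?w us) = \<i> * dzb_form j us"
        by (simp add: hup_contract(2)[OF inv] if_distrib[of "\<lambda>x. x * _"] cong: if_cong)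
    qed
    show ?thesis unfolding A B by (simp add: pwedge_scale sum_distrib_left)
  qed
  also have "(\<Sum>i\<in>UNIV. \<Sum>j\<in>UNIV. hup M i j * pwedge (zbcontract j ?w) (zcontract i g) ws)
     = - \<i> * (\<Sum>i\<in>UNIV. pwedge (dz_form i) (zcontract i g) ws)"
  proof -
    have A: "(\<Sum>i\<in>UNIV. \<Sum>j\<in>UNIV. hup M i j * pwedge (zbcontract j ?w) (zcontract i g) ws)
       = (\<Sum>i\<in>UNIV. pwedge (\<lambda>us. \<Sum>j\<in>UNIV. hup M i j * zbcontract j ?w us) (zcontract i g) ws)"
      by (simp add: pwedge_sum pwedge_scale)
    have B: "(\<lambda>us. \<Sum>j\<in>UNIV. hup M i j * zbcontract j ?w us) = (\<lambda>us. - \<i> * dz_form i us)" for i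
    proof
      fix us
      have "(\<Sum>j\<in>UNIV. hup M i j * zbcontract j ?w us) = - \<i> * (\<Sum>k\<in>UNIV. (\<Sum>j\<in>UNIV. hup M i j * M $ k $ j) * dz_form k us)"
        unfolding zcontract_form11 sum_distrib_left sum_distrib_right
        by (subst sum.swap) (simp add: mult_ac)
      then show "(\<Sum>j\<in>UNIV. hup M i j * zbcontract j ?w us) = - \<i> * dz_form i us"
        by (simp add: hup_contract(1)[OF inv] if_distrib[of "\<lambda>x. x * _"] cong: if_cong)
    qed
    show ?thesis unfolding A B by (simp only: pwedge_scale sum_distrib_left)
  qed
  also have "(\<Sum>i\<in>UNIV. \<Sum>j\<in>UNIV. hup M i j * pwedge ?w (zbcontract j (zcontract i g)) ws) = pwedge ?w (lambda_op M g) ws"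
    unfolding lambda_op_def[abs_def] by (simp add: pwedge_sum pwedge_scale)
  finally have *: "lambda_op M (pwedge ?w g) ws = \<i> * of_nat CARD('n) * g ws
     - \<i> * (\<Sum>j\<in>UNIV. pwedge (dzb_form j) (zbcontract j g) ws)
     + - \<i> * (\<Sum>i\<in>UNIV. pwedge (dz_form i) (zcontract i g) ws) + pwedge ?w (lambda_op M g) ws" .
  show ?thesis unfolding * left_diff_distrib right_diff_distrib mult.assoc altform_euler[OF g, symmetric]
    by (simp add: sum.distrib algebra_simps)
qed

text \<open>A primitive 3-form \<open>b\<close> on a space of complex dimension \<open>n\<close> satisfies
  \<open>\<omega>\<^sup>n\<^sup>-\<^sup>2 \<and> b = 0\<close>: applying the contraction to \<open>\<omega>\<^sup>n\<^sup>-\<^sup>1 \<and> b\<close>, which vanishes for its degree, gives a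
  nonzero multiple of it.\<close>

lemma primitive_three_form:
  fixes b :: "'n::finite pform"
  assumes inv: "invertible M" and b: "altform b" "of_degree 3 b" and prim: "\<And>ws. lambda_op M b ws = 0"
    and n: "CARD('n) = Suc (Suc m)"
  shows "(pwedge (form11_at M) ^^ m) b ws = 0"
proof -
  define L where "L r = (pwedge (form11_at M) ^^ r) b" for r
  have L: "L (Suc r) = pwedge (form11_at M) (L r)" for r by (simp add: L_def)
  have alt: "altform (L r)" for r
    by (induction r) (simp_all add: L altform_pwedge altform_form11, simp add: L_def b)
  have deg: "of_degree (3 + 2 * r) (L r)" for r
  proof (induction r)
    case (Suc r)
    then show ?case using of_degree_pwedge[OF of_degree_form11[of M] Suc] by (simp add: L algebra_simps)
  qed (simp add: L_def b)
  \<comment> \<open>\<open>(r + 1) (n - 3 - r)\<close> is the sum of \<open>n - (3 + 2 j)\<close> over \<open>j \<le> r\<close>, one commutator for each factor \<open>\<omega>\<close>.\<close>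
  have lam: "lambda_op M (L (Suc r)) ws = \<i> * of_int ((int r + 1) * (int CARD('n) - 3 - int r)) * L r ws" for r ws
  proof (induction r arbitrary: ws)
    case 0
    have "lambda_op M (L 0) = (\<lambda>ws. 0)" using prim by (simp add: L_def fun_eq_iff)
    then show ?case
      using deg[of 0] lambda_op_pwedge_form11[OF inv alt[of 0], of ws]
      by (cases "length ws = 3") (simp_all add: L of_degree_def)
  next
    case (Suc r)
    have "lambda_op M (L (Suc r)) = (\<lambda>ws. \<i> * of_int ((int r + 1) * (int CARD('n) - 3 - int r)) * L r ws)"
      using Suc.IH by (simp add: fun_eq_iff)
    then have "lambda_op M (L (Suc (Suc r))) ws = \<i> * (of_nat CARD('n) - of_nat (length ws)) * L (Suc r) ws
        + \<i> * of_int ((int r + 1) * (int CARD('n) - 3 - int r)) * L (Suc r) ws"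
      unfolding L[of "Suc r"] lambda_op_pwedge_form11[OF inv alt[of "Suc r"]]
      by (simp only: pwedge_scale L[of r, symmetric])
    then show ?case using deg[of "Suc r"]
      by (cases "length ws = 3 + 2 * Suc r") (simp_all add: of_degree_def algebra_simps)
  qed
  have "L (Suc m) ws = 0" for ws
  proof (cases "length ws = 3 + 2 * Suc m")
    case True
    then show ?thesis using altform_degree_too_large[OF alt, of ws] n by simp
  qed (use deg[of "Suc m"] in \<open>simp add: of_degree_def\<close>)
  then have "lambda_op M (L (Suc m)) ws = 0"
    by (simp add: lambda_op_def zcontract_def zbcontract_def ccontract_def contract_def)
  moreover have "complex_of_int ((int m + 1) * (int CARD('n) - 3 - int m)) \<noteq> 0"
    unfolding of_int_eq_0_iff using n by simp
  ultimately show ?thesis unfolding lam by (simp add: L_def)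
qed

section \<open>Exterior derivatives\<close>

lemma ext_deriv_Nil [simp]: "ext_deriv D \<eta> x [] = 0"
  by (simp add: ext_deriv_def)

text \<open>Cartan's formula for a constant vector field, read as a recursion over the argument list.\<close>

lemma ext_deriv_Cons:
  "ext_deriv D \<eta> x (v # ws) = D (\<lambda>y. \<eta> y ws) x v - ext_deriv D (\<lambda>y. contract v (\<eta> y)) x ws"
  by (simp add: ext_deriv_def sum.lessThan_Suc_shift contract_def sum_negf del: sum.lessThan_Suc)

definition dform_diff :: "'n::finite dform \<Rightarrow> complex^'n \<Rightarrow> bool" where
  "dform_diff \<eta> x \<longleftrightarrow> (\<forall>vs. (\<lambda>y. \<eta> y vs) differentiable (at x))"

lemma dform_diff_contract: "dform_diff \<eta> x \<Longrightarrow> dform_diff (\<lambda>y. contract v (\<eta> y)) x"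
  by (simp add: dform_diff_def contract_def)

lemma dform_diff_parity: "dform_diff \<eta> x \<Longrightarrow> dform_diff (\<lambda>y. parity (\<eta> y)) x"
  by (auto simp: dform_diff_def parity_def intro!: derivative_intros)

lemma dform_diff_pwedge:
  "dform_diff \<alpha> x \<Longrightarrow> dform_diff \<beta> x \<Longrightarrow> dform_diff (\<lambda>y. pwedge (\<alpha> y) (\<beta> y)) x"
  by (auto simp: dform_diff_def pwedge_def intro!: differentiable_sum differentiable_mult differentiable_const)

lemma fun_d_pwedge:
  assumes "dform_diff \<alpha> x" "dform_diff \<beta> x"
  shows "fun_d (\<lambda>y. pwedge (\<alpha> y) (\<beta> y) ws) x v =
     pwedge (\<lambda>us. fun_d (\<lambda>y. \<alpha> y us) x v) (\<beta> x) ws + pwedge (\<alpha> x) (\<lambda>us. fun_d (\<lambda>y. \<beta> y us) x v) ws"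
proof -
  have d: "(\<lambda>y. \<alpha> y us) differentiable (at x)" "(\<lambda>y. \<beta> y us) differentiable (at x)" for us
    using assms by (auto simp: dform_diff_def)
  have t: "fun_d (\<lambda>y. c * \<alpha> y us * \<beta> y us') x v = c * fun_d (\<lambda>y. \<alpha> y us) x v * \<beta> x us' + c * \<alpha> x us * fun_d (\<lambda>y. \<beta> y us') x v"
    for c us us'
    unfolding fun_d_gd
    by (subst gd_mult) (auto intro!: differentiable_mult differentiable_const d simp: gd_cmult[OF d(1)])
  show ?thesis
    unfolding pwedge_def
    by (subst fun_d_rules(5))
       (auto intro!: differentiable_mult differentiable_const d simp: t sum.distrib)
qed

lemma ext_deriv_add:
  assumes "dform_diff \<alpha> x" "dform_diff \<beta> x"
  shows "form_d (\<lambda>y vs. \<alpha> y vs + \<beta> y vs) x vs = form_d \<alpha> x vs + form_d \<beta> x vs"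
  using assms by (simp add: ext_deriv_def dform_diff_def fun_d_rules algebra_simps sum.distrib)

lemma ext_deriv_parity:
  assumes "dform_diff \<alpha> x"
  shows "form_d (\<lambda>y. parity (\<alpha> y)) x vs = - parity (form_d \<alpha> x) vs"
proof -
  have d: "(\<lambda>y. \<alpha> y us) differentiable (at x)" for us using assms by (auto simp: dform_diff_def)
  have "fun_d (\<lambda>y. parity (\<alpha> y) (take i vs @ drop (Suc i) vs)) x w
      = - ((-1) ^ length vs * fun_d (\<lambda>y. \<alpha> y (take i vs @ drop (Suc i) vs)) x w)" if "i < length vs" for i w
  proof -
    have "length vs = Suc (length (take i vs @ drop (Suc i) vs))" using that by simp
    then have "(-1::complex) ^ length vs = - ((-1) ^ length (take i vs @ drop (Suc i) vs))" by (metis power_Suc mult_minus1)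
    then show ?thesis unfolding parity_def fun_d_gd gd_cmult[OF d] by simp
  qed
  then show ?thesis
    by (simp add: ext_deriv_def parity_def[of "ext_deriv fun_d \<alpha> x"] sum_distrib_left sum_negf mult_ac)
qed

lemma ext_deriv_pwedge:
  assumes "dform_diff \<alpha> x" "dform_diff \<beta> x"
  shows "form_d (\<lambda>y. pwedge (\<alpha> y) (\<beta> y)) x vs =
     pwedge (form_d \<alpha> x) (\<beta> x) vs + pwedge (parity (\<alpha> x)) (form_d \<beta> x) vs"
  using assms
proof (induction vs arbitrary: \<alpha> \<beta>)
  case (Cons v ws)
  let ?c = "\<lambda>\<alpha> y. contract v (\<alpha> y)"
  note d = Cons.prems dform_diff_contract[OF Cons.prems(1)] dform_diff_contract[OF Cons.prems(2)] dform_diff_parity[OF Cons.prems(1)]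
  have c: "contract v (form_d \<alpha> x) = (\<lambda>us. fun_d (\<lambda>y. \<alpha> y us) x v - form_d (?c \<alpha>) x us)" for \<alpha>
    by (simp add: contract_def ext_deriv_Cons fun_eq_iff)
  have p: "form_d (\<lambda>y. parity (\<alpha> y)) x = (\<lambda>us. - parity (form_d \<alpha> x) us)"
    by (simp add: fun_eq_iff ext_deriv_parity[OF Cons.prems(1)])
  have "form_d (\<lambda>y. pwedge (\<alpha> y) (\<beta> y)) x (v # ws) =
      pwedge (\<lambda>us. fun_d (\<lambda>y. \<alpha> y us) x v) (\<beta> x) ws + pwedge (\<alpha> x) (\<lambda>us. fun_d (\<lambda>y. \<beta> y us) x v) ws
      - (pwedge (form_d (?c \<alpha>) x) (\<beta> x) ws + pwedge (parity (?c \<alpha> x)) (form_d \<beta> x) ws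
        + (pwedge (form_d (\<lambda>y. parity (\<alpha> y)) x) (?c \<beta> x) ws + pwedge (\<alpha> x) (form_d (?c \<beta>) x) ws))"
    unfolding ext_deriv_Cons contract_pwedge fun_d_pwedge[OF Cons.prems]
    by (subst ext_deriv_add) (simp_all add: dform_diff_pwedge d Cons.IH)
  also have "\<dots> = pwedge (form_d \<alpha> x) (\<beta> x) (v # ws) + pwedge (parity (\<alpha> x)) (form_d \<beta> x) (v # ws)"
    unfolding pwedge_Cons c p contract_parity by (simp add: pwedge_diff pwedge_minus)
  finally show ?case .
qed simp

lemma pwedge_power_commute:
  assumes w: "of_degree 2 w" and b: "of_degree 3 b"
  shows "pwedge b ((pwedge w ^^ m) unit_form) = (pwedge w ^^ m) b"
proof (induction m)
  case 0
  then show ?case by (simp add: fun_eq_iff)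
next
  case (Suc m)
  have "pwedge b w vs = pwedge w b vs" for vs
    using pwedge_graded_commute[of b "-1" w 1 vs] of_degree_parity[OF w] of_degree_parity[OF b] by simp
  then have c: "pwedge b w = pwedge w b" by (simp add: fun_eq_iff)
  have "pwedge b (pwedge w ((pwedge w ^^ m) unit_form)) vs = pwedge w (pwedge b ((pwedge w ^^ m) unit_form)) vs" for vs
    by (simp flip: pwedge_assoc add: c)
  then show ?case by (simp add: Suc fun_eq_iff)
qed

lemma zero_form_one: "zero_form (\<lambda>_. 1) x = unit_form"
  by (simp add: fun_eq_iff zero_form_def unit_form_def)

lemma wedge_power_eq: "wedge_power \<alpha> m x = (pwedge (\<alpha> x) ^^ m) unit_form"
  by (induction m) (simp_all add: wedge_eq_pwedge zero_form_one)

text \<open>The Leibniz rule, where the even form \<open>w\<close> commutes with \<open>dw\<close>.\<close>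

lemma form_d_wedge_power:
  assumes d: "dform_diff w x" and w: "\<And>y. of_degree 2 (w y)" and b: "of_degree 3 (form_d w x)"
  shows "form_d (wedge_power w (Suc m)) x vs = of_nat (Suc m) * (pwedge (w x) ^^ m) (form_d w x) vs"
proof (induction m arbitrary: vs)
  case 0
  have "form_d (wedge_power w (Suc 0)) x = form_d w x"
    by (simp add: ext_deriv_def fun_eq_iff wedge_eq_pwedge zero_form_one)
  then show ?case by simp
next
  case (Suc m)
  have dw: "dform_diff (wedge_power w m) x" for m
  proof (induction m)
    case (Suc m)
    then show ?case using dform_diff_pwedge[OF d Suc] by (simp add: dform_diff_def wedge_eq_pwedge)
  qed (simp add: dform_diff_def zero_form_def)
  have pw: "parity (w x) = w x" using of_degree_parity[OF w[of x]] by simp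
  have "form_d (wedge_power w (Suc (Suc m))) x vs = form_d (\<lambda>y. pwedge (w y) (wedge_power w (Suc m) y)) x vs"
    by (simp add: ext_deriv_def wedge_eq_pwedge)
  also have "\<dots> = pwedge (form_d w x) (wedge_power w (Suc m) x) vs + pwedge (w x) (form_d (wedge_power w (Suc m)) x) vs"
    unfolding ext_deriv_pwedge[OF d dw] pw ..
  also have "form_d (wedge_power w (Suc m)) x = (\<lambda>vs. of_nat (Suc m) * (pwedge (w x) ^^ m) (form_d w x) vs)"
    by (rule ext) (rule Suc)
  also have "pwedge (form_d w x) (wedge_power w (Suc m) x) = (pwedge (w x) ^^ Suc m) (form_d w x)"
    unfolding wedge_power_eq by (rule pwedge_power_commute[OF w b])
  finally have e: "form_d (wedge_power w (Suc (Suc m))) x vs = (pwedge (w x) ^^ Suc m) (form_d w x) vs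
     + pwedge (w x) (\<lambda>vs. of_nat (Suc m) * (pwedge (w x) ^^ m) (form_d w x) vs) vs" .
  show ?case unfolding e pwedge_scale by (simp add: algebra_simps)
qed

text \<open>The recursion moves a repeated argument to the front, where its two derivatives cancel.\<close>

lemma altform_form_d:
  assumes d: "dform_diff \<eta> x" and alt: "\<And>y. altform (\<eta> y)"
  shows "altform (form_d \<eta> x)"
proof -
  have 1: "form_d \<eta> x (us @ v # v # ws) = 0" if "dform_diff \<eta> x" "\<And>y. altform (\<eta> y)" for us v ws and \<eta> :: "'a dform"
    using that
  proof (induction us arbitrary: \<eta>)
    case Nil
    have "contract v (contract v (\<eta> y)) = (\<lambda>ws. 0)" for y
      using altform_adjacent[OF Nil(2), where us="[]"] by (simp add: contract_def fun_eq_iff)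
    then show ?case by (simp add: ext_deriv_Cons) (simp add: contract_def ext_deriv_def fun_d_gd)
  next
    case (Cons u us)
    have "\<eta> y (us @ v # v # ws) = 0" for y using altform_adjacent[OF Cons.prems(2)] by simp
    then show ?case
      using Cons by (simp add: ext_deriv_Cons dform_diff_contract altform_contract fun_d_gd)
  qed
  have 2: "linear (\<lambda>v. form_d \<eta> x (us @ v # ws))" if "dform_diff \<eta> x" "\<And>y. altform (\<eta> y)" for us ws and \<eta> :: "'a dform"
    using that
  proof (induction us arbitrary: \<eta>)
    case Nil
    have dd: "(\<lambda>y. \<eta> y us) differentiable (at x)" for us using Nil(1) by (auto simp: dform_diff_def)
    have l: "\<eta> y ((v + w) # us) = \<eta> y (v # us) + \<eta> y (w # us)" "\<eta> y ((r *\<^sub>R v) # us) = of_real r * \<eta> y (v # us)" for y v w us r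
      using linear_add[OF altform_linear[OF Nil(2), where us="[]", unfolded append_Nil]] linear_scale[OF altform_linear[OF Nil(2), where us="[]", unfolded append_Nil]]
      by (simp_all add: scaleR_complex)
    have "linear (\<lambda>v. ext_deriv fun_d (\<lambda>y. contract v (\<eta> y)) x ws)"
      by (rule linearI)
         (simp_all add: ext_deriv_def contract_def l fun_d_gd gd_add dd gd_cmult algebra_simps sum.distrib sum_distrib_left scaleR_complex)
    then show ?case by (simp add: ext_deriv_Cons linear_compose_sub fun_d_linear dd)
  next
    case (Cons u us)
    have dd: "(\<lambda>y. \<eta> y us) differentiable (at x)" for us using Cons(2) by (auto simp: dform_diff_def)
    have l: "\<eta> y (us @ (v + w) # ws) = \<eta> y (us @ v # ws) + \<eta> y (us @ w # ws)" "\<eta> y (us @ (r *\<^sub>R v) # ws) = of_real r * \<eta> y (us @ v # ws)" for y v w r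
      using linear_add[OF altform_linear[OF Cons(3), where us=us and ws=ws]] linear_scale[OF altform_linear[OF Cons(3), where us=us and ws=ws]]
      by (simp_all add: scaleR_complex)
    have "linear (\<lambda>v. fun_d (\<lambda>y. \<eta> y (us @ v # ws)) x u)"
      by (rule linearI) (simp_all add: l fun_d_gd gd_add gd_cmult dd scaleR_complex)
    then show ?case
      using Cons.IH[of "\<lambda>y. contract u (\<eta> y)"] Cons.prems
      by (simp add: ext_deriv_Cons linear_compose_sub dform_diff_contract altform_contract)
  qed
  show ?thesis using 1[OF assms] 2[OF assms] unfolding altform_def by blast
qed

lemma ext_deriv_degree:
  assumes "\<And>y. of_degree k (\<eta> y)" "\<And>v. D (\<lambda>y. 0) x v = 0"
  shows "of_degree (Suc k) (ext_deriv D \<eta> x)"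
proof -
  have "\<eta> y (take i vs @ drop (Suc i) vs) = 0" if "length vs \<noteq> Suc k" "i < length vs" for vs i y
    using assms(1)[of y] that by (simp add: of_degree_def)
  then show ?thesis by (simp add: of_degree_def ext_deriv_def assms(2))
qed

lemma D_zero: "fun_d (\<lambda>y. 0) x v = 0" "fun_del (\<lambda>y. 0) x v = 0" "fun_delbar (\<lambda>y. 0) x v = 0"
  by (simp_all add: gd_specs)

section \<open>The trace of the torsion of the Chern connection\<close>

text \<open>The torsion of the Chern connection, with its upper index lowered, on constant vector fields.\<close>

definition torsion :: "(complex^'n::finite \<Rightarrow> complex^'n^'n) \<Rightarrow> complex^'n \<Rightarrow> complex^'n \<Rightarrow> complex^'n \<Rightarrow> complex^'n \<Rightarrow> complex" where
  "torsion H x u v w = fun_del (\<lambda>y. sesq (H y) v w) x u - fun_del (\<lambda>y. sesq (H y) u w) x v"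

text \<open>The (1,0)-form \<open>\<theta>\<^sub>i = h\<^sup>k\<^sup>l (\<partial>\<^sub>i h\<^sub>k\<^sub>l - \<partial>\<^sub>k h\<^sub>i\<^sub>l)\<close>, whose vanishing characterises balanced metrics.\<close>

definition theta :: "(complex^'n::finite \<Rightarrow> complex^'n^'n) \<Rightarrow> complex^'n \<Rightarrow> complex^'n \<Rightarrow> complex" where
  "theta H x v = (\<Sum>k\<in>UNIV. \<Sum>l\<in>UNIV. hup (H x) k l * torsion H x v (axis k 1) (axis l 1))"

lemma sesq_gd:
  assumes "\<And>k l. (\<lambda>y. H y $ k $ l) differentiable (at x)"
  shows "gd a b (\<lambda>y. sesq (H y) v w) x u = sesq (\<chi> k l. gd a b (\<lambda>y. H y $ k $ l) x u) v w"
    and "(\<lambda>y. sesq (H y) v w) differentiable (at x)"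
proof -
  have t: "gd a b (\<lambda>y. H y $ k $ l * v $ k * cnj (w $ l)) x u = gd a b (\<lambda>y. H y $ k $ l) x u * v $ k * cnj (w $ l)" for k l
    using gd_mult[of "\<lambda>y. H y $ k $ l" x "\<lambda>y. v $ k * cnj (w $ l)" a b u] assms by (simp add: mult.assoc)
  have d: "(\<lambda>y. H y $ k $ l * v $ k * cnj (w $ l)) differentiable (at x)" for k l
    by (intro differentiable_mult assms differentiable_const)
  have dd: "(\<lambda>y. \<Sum>l\<in>UNIV. H y $ k $ l * v $ k * cnj (w $ l)) differentiable (at x)" for k
    by (intro differentiable_sum ballI d finite)
  have inner: "gd a b (\<lambda>y. \<Sum>l\<in>UNIV. H y $ k $ l * v $ k * cnj (w $ l)) x u
      = (\<Sum>l\<in>UNIV. gd a b (\<lambda>y. H y $ k $ l) x u * v $ k * cnj (w $ l))" for k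
    by (subst gd_sum) (simp_all add: assms t)
  show "gd a b (\<lambda>y. sesq (H y) v w) x u = sesq (\<chi> k l. gd a b (\<lambda>y. H y $ k $ l) x u) v w"
    unfolding sesq_def by (subst gd_sum, rule dd) (simp add: inner)
  show "(\<lambda>y. sesq (H y) v w) differentiable (at x)"
    unfolding sesq_def by (intro differentiable_sum ballI d finite)
qed

locale metric_chart =
  fixes S :: "(complex^'n::finite) set" and H :: "complex^'n \<Rightarrow> complex^'n^'n"
  assumes open_S: "open S" and smooth_H: "smooth_map_on H S" and posdef: "x \<in> S \<Longrightarrow> hermitian_posdef (H x)"
begin

lemma inv_H: "x \<in> S \<Longrightarrow> invertible (H x)"
  using posdef hermitian_posdef_invertible by blast

lemma smooth_entry: "smooth_map_on (\<lambda>y. H y $ i $ j) S"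
  by (intro smooth_nth open_S smooth_H)

lemma diff_entry: "x \<in> S \<Longrightarrow> (\<lambda>y. H y $ i $ j) differentiable (at x)"
  using smooth_map_onD(1)[OF smooth_entry] .

lemma smooth_sesq: "smooth_map_on (\<lambda>y. sesq (H y) v w) S"
  unfolding sesq_def by (intro smooth_intros open_S smooth_entry)

lemma sesq_cnj: "x \<in> S \<Longrightarrow> cnj (sesq (H x) v w) = sesq (H x) w v"
proof -
  assume x: "x \<in> S"
  have "cnj (sesq (H x) v w) = (\<Sum>i\<in>UNIV. \<Sum>j\<in>UNIV. H x $ j $ i * cnj (v $ i) * w $ j)"
    by (simp add: sesq_def hermitian_posdefD(1)[OF posdef[OF x]])
  also have "\<dots> = sesq (H x) w v" unfolding sesq_def by (subst sum.swap) (simp add: mult_ac)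
  finally show ?thesis .
qed

lemma cnj_fun_del_sesq: "x \<in> S \<Longrightarrow> cnj (fun_del (\<lambda>y. sesq (H y) v w) x u) = fun_delbar (\<lambda>y. sesq (H y) w v) x u"
proof -
  assume x: "x \<in> S"
  have "cnj (fun_del (\<lambda>y. sesq (H y) v w) x u) = fun_delbar (\<lambda>y. cnj (sesq (H y) v w)) x u"
    by (simp add: fun_del_cnj smooth_map_onD(1)[OF smooth_sesq x])
  also have "\<dots> = fun_delbar (\<lambda>y. sesq (H y) w v) x u"
    unfolding fun_delbar_gd by (rule gd_cong[OF open_S x]) (rule sesq_cnj)
  finally show ?thesis .
qed

lemma cnj_theta:
  assumes x: "x \<in> S"
  shows "cnj (theta H x v) = (\<Sum>k\<in>UNIV. \<Sum>l\<in>UNIV. hup (H x) k l *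
     (fun_delbar (\<lambda>y. sesq (H y) (axis k 1) (axis l 1)) x v - fun_delbar (\<lambda>y. sesq (H y) (axis k 1) v) x (axis l 1)))"
proof -
  have "cnj (theta H x v) = (\<Sum>k\<in>UNIV. \<Sum>l\<in>UNIV. hup (H x) l k *
     (fun_delbar (\<lambda>y. sesq (H y) (axis l 1) (axis k 1)) x v - fun_delbar (\<lambda>y. sesq (H y) (axis l 1) v) x (axis k 1)))"
    by (simp add: theta_def torsion_def cnj_hup[OF posdef[OF x]] cnj_fun_del_sesq[OF x])
  then show ?thesis by (subst (asm) sum.swap) simp
qed

lemma theta_axis:
  assumes "x \<in> S"
  shows "theta H x (axis i 1) = (\<Sum>k\<in>UNIV. \<Sum>l\<in>UNIV. hup (H x) k l * (dz i (\<lambda>y. H y $ k $ l) x - dz k (\<lambda>y. H y $ i $ l) x))"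
  by (simp add: theta_def torsion_def dz_def sesq_axis)

lemma cnj_theta_axis:
  assumes "x \<in> S"
  shows "cnj (theta H x (axis j 1)) = (\<Sum>k\<in>UNIV. \<Sum>l\<in>UNIV. hup (H x) k l * (dzbar j (\<lambda>y. H y $ k $ l) x - dzbar l (\<lambda>y. H y $ k $ j) x))"
  by (simp add: cnj_theta[OF assms] dzbar_def sesq_axis)

lemma torsion_linear:
  assumes x: "x \<in> S"
  shows "torsion H x (c *s u + u') v w = c * torsion H x u v w + torsion H x u' v w"
    "torsion H x u (c *s v + v') w = c * torsion H x u v w + torsion H x u v' w"
    "torsion H x u v (c *s w + w') = cnj c * torsion H x u v w + torsion H x u v w'"
proof -
  note d = sesq_gd(2)[OF diff_entry[OF x]]
  have l: "linear (fun_del (\<lambda>y. sesq (H y) v w) x)" for v w using gd_linear[OF d] by (simp add: fun_del_gd)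
  have e: "fun_del (\<lambda>y. sesq (H y) v w) x (c *s u + u') = c * fun_del (\<lambda>y. sesq (H y) v w) x u + fun_del (\<lambda>y. sesq (H y) v w) x u'" for u u' v w c
    by (simp add: linear_add[OF l] fun_del_scale[OF d])
  have f: "fun_del (\<lambda>y. sesq (H y) (c *s v + v') w) x u = c * fun_del (\<lambda>y. sesq (H y) v w) x u + fun_del (\<lambda>y. sesq (H y) v' w) x u"
    "fun_del (\<lambda>y. sesq (H y) v (c *s w + w')) x u = cnj c * fun_del (\<lambda>y. sesq (H y) v w) x u + fun_del (\<lambda>y. sesq (H y) v w') x u"  for u v v' w w' c
    unfolding fun_del_gd sesq_gd(1)[OF diff_entry[OF x]] by (simp_all add: sesq_linear)
  show "torsion H x (c *s u + u') v w = c * torsion H x u v w + torsion H x u' v w"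
    "torsion H x u (c *s v + v') w = c * torsion H x u v w + torsion H x u v' w"
    "torsion H x u v (c *s w + w') = cnj c * torsion H x u v w + torsion H x u v w'"
    unfolding torsion_def e f by (simp_all add: algebra_simps)
qed

lemma theta_linear:
  assumes x: "x \<in> S"
  shows "theta H x (c *s u + u') = c * theta H x u + theta H x u'"
  unfolding theta_def torsion_linear(1)[OF x]
  by (simp add: algebra_simps sum.distrib sum_distrib_left)

lemma theta_expand:
  assumes x: "x \<in> S"
  shows "theta H x v = (\<Sum>i\<in>UNIV. v $ i * theta H x (axis i 1))"
proof -
  have z: "theta H x 0 = 0" using theta_linear[OF x, of "-1" 0 0] by simp
  have s: "theta H x (c *s v) = c * theta H x v" for c v using theta_linear[OF x, of c v 0] z by simp
  have a: "theta H x (u + v) = theta H x u + theta H x v" for u v using theta_linear[OF x, of 1 u v] by simp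
  have "theta H x (\<Sum>i\<in>I. v $ i *s axis i 1) = (\<Sum>i\<in>I. v $ i * theta H x (axis i 1))" if "finite I" for I :: "'n set"
    using that by (induction I rule: finite_induct) (simp_all add: z a s)
  from this[of UNIV] show ?thesis by (simp add: basis_expansion)
qed

lemma smooth_theta: "smooth_map_on (\<lambda>x. theta H x v) S"
  unfolding theta_def torsion_def fun_del_gd
  by (intro smooth_intros open_S smooth_H inv_H smooth_sesq)

lemma dform_diff_form11: "x \<in> S \<Longrightarrow> dform_diff (form11 H) x"
  unfolding dform_diff_def
proof
  fix vs assume x: "x \<in> S"
  show "(\<lambda>y. form11 H y vs) differentiable at x"
  proof (cases "\<exists>v w. vs = [v, w]")
    case True
    then show ?thesis
      by (auto simp: form11_def intro!: differentiable_mult differentiable_diff differentiable_const sesq_gd(2) diff_entry x)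
  next
    case False
    then have "form11 H y vs = 0" for y by (auto simp: form11_def split: list.splits)
    then show ?thesis by simp
  qed
qed

lemma form_d_form11:
  assumes x: "x \<in> S"
  shows "form_d (form11 H) x [u, v, w] = \<i> *
    (fun_d (\<lambda>y. sesq (H y) v w) x u - fun_d (\<lambda>y. sesq (H y) w v) x u
     - (fun_d (\<lambda>y. sesq (H y) u w) x v - fun_d (\<lambda>y. sesq (H y) w u) x v)
     + (fun_d (\<lambda>y. sesq (H y) u v) x w - fun_d (\<lambda>y. sesq (H y) v u) x w))"
proof -
  note d = sesq_gd(2)[OF diff_entry[OF x]]
  have "fun_d (\<lambda>y. \<i> * (sesq (H y) v w - sesq (H y) w v)) x u = \<i> * (fun_d (\<lambda>y. sesq (H y) v w) x u - fun_d (\<lambda>y. sesq (H y) w v) x u)" for u v w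
    unfolding fun_d_gd by (subst gd_cmult) (simp_all add: differentiable_diff d gd_diff)
  then show ?thesis
    by (simp add: ext_deriv_Cons contract_def form11_def algebra_simps)
qed

text \<open>The contraction of \<open>d\<omega>\<close> is, up to a factor, \<open>\<theta>\<close> plus its conjugate.\<close>

lemma lambda_op_d_form11:
  assumes x: "x \<in> S"
  shows "lambda_op (H x) (form_d (form11 H) x) [w] = \<i> * (theta H x w + cnj (theta H x w))"
proof -
  note d = diff_entry[OF x]
  define s where "s u = sesq (\<chi> k l. fun_d (\<lambda>y. H y $ k $ l) x u)" for u
  have s: "fun_d (\<lambda>y. sesq (H y) v w) x u = s u v w" for u v w
    using sesq_gd(1)[OF d, of 1 0 v w u] unfolding s_def fun_d_gd .
  note sl = sesq_linear(3,4)[of "\<chi> k l. fun_d (\<lambda>y. H y $ k $ l) x _", folded s_def]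
  have D: "fun_del (\<lambda>y. sesq (H y) v w) x u = (s u v w - \<i> * s (\<i> *s u) v w) / 2"
    "fun_delbar (\<lambda>y. sesq (H y) v w) x u = (s u v w + \<i> * s (\<i> *s u) v w) / 2" for u v w
    by (simp_all add: fun_del_def fun_delbar_def s)
  have sp: "s w u v = fun_del (\<lambda>y. sesq (H y) u v) x w + fun_delbar (\<lambda>y. sesq (H y) u v) x w" for u v
    using fun_d_split[of "\<lambda>y. sesq (H y) u v" x w] by (simp add: s)
  have key: "zbcontract j (zcontract i (form_d (form11 H) x)) [w] = \<i> *
       (torsion H x w (axis i 1) (axis j 1) +
       (fun_delbar (\<lambda>y. sesq (H y) (axis i 1) (axis j 1)) x w - fun_delbar (\<lambda>y. sesq (H y) (axis i 1) w) x (axis j 1)))" for i j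
    unfolding zbcontract_def zcontract_def ccontract_def contract_def form_d_form11[OF x] s sl torsion_def D
    by (simp add: field_simps)
  show ?thesis
    unfolding lambda_op_def key cnj_theta[OF x] unfolding theta_def
    by (simp add: algebra_simps sum.distrib sum_distrib_left sum_subtractf)
qed

text \<open>If \<open>\<theta> = 0\<close> then \<open>d\<omega>\<close> is primitive, so \<open>d(\<omega>\<^sup>n\<^sup>-\<^sup>1) = (n-1) \<omega>\<^sup>n\<^sup>-\<^sup>2 \<and> d\<omega>\<close> vanishes.\<close>

lemma theta_zero_imp_balanced:
  assumes x: "x \<in> S" and th: "\<And>v. theta H x v = 0"
  shows "form_d (wedge_power (form11 H) (CARD('n) - 1)) x vs = 0"
proof (cases "CARD('n) = 1")
  case True
  then show ?thesis by (simp add: ext_deriv_def zero_form_def[abs_def] fun_d_gd)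
next
  case False
  then obtain m where n: "CARD('n) = Suc (Suc m)"
    by (metis One_nat_def Suc_diff_1 nat.exhaust zero_less_card_finite)
  let ?b = "form_d (form11 H) x"
  have deg2: "of_degree 2 (form11 H y)" for y by (simp add: form11_eq_at of_degree_form11)
  have b: "altform ?b" "of_degree 3 ?b"
    using altform_form_d[OF dform_diff_form11[OF x]] ext_deriv_degree[where \<eta> = "form11 H" and D = fun_d and k = 2 and x = x, OF deg2 D_zero(1)]
    by (simp_all add: form11_eq_at altform_form11 numeral_3_eq_3 numeral_2_eq_2)
  have prim: "lambda_op (H x) ?b ws = 0" for ws
  proof (cases "length ws = 1")
    case True
    then show ?thesis using lambda_op_d_form11[OF x] th by (auto simp: length_Suc_conv)
  next
    case False
    have "of_degree 1 (zbcontract j (zcontract i ?b))" for i j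
      unfolding zbcontract_def zcontract_def using b(2)
      by (intro of_degree_ccontract) (simp add: numeral_3_eq_3)
    then show ?thesis using False unfolding lambda_op_def of_degree_def by simp
  qed
  have "(pwedge (form11_at (H x)) ^^ m) ?b vs = 0"
    by (rule primitive_three_form[OF inv_H[OF x] b prim n])
  then show ?thesis
    using form_d_wedge_power[OF dform_diff_form11[OF x] deg2 b(2), of m vs] n by (simp add: form11_eq_at)
qed

section \<open>The trace of the Levi-Civita curvature\<close>

lemma gd_ln_det:
  assumes x: "x \<in> S"
  shows "gd a b (\<lambda>y. of_real (ln (Re (det (H y))))) x v = (\<Sum>k\<in>UNIV. \<Sum>l\<in>UNIV. hup (H x) k l * gd a b (\<lambda>y. H y $ k $ l) x v)"
proof -
  have nz: "det (H x) \<noteq> 0" using inv_H[OF x] invertible_det_nz by blast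
  have "gd a b (\<lambda>y. of_real (ln (Re (det (H y))))) x v = gd a b (\<lambda>y. of_real (Re (det (H y)))) x v / of_real (Re (det (H x)))"
    by (rule gd_ln[where g = "\<lambda>y. Re (det (H y))", OF smooth_map_onD(1)[OF smooth_Re[OF open_S smooth_det[OF open_S smooth_entry]] x]
          det_hermitian_pos(1)[OF posdef[OF x]]])
  also have "gd a b (\<lambda>y. of_real (Re (det (H y)))) x v = gd a b (\<lambda>y. det (H y)) x v"
    by (rule gd_cong[OF open_S x]) (metis det_hermitian_pos(2) posdef)
  also have "of_real (Re (det (H x))) = det (H x)" using det_hermitian_pos(2)[OF posdef[OF x]] by simp
  finally show ?thesis using gd_det(2)[OF diff_entry[OF x] inv_H[OF x]] nz by simp
qed

text \<open>In \<open>2 \<Gamma>\<^sub>i\<^sub>k\<^sup>k = h\<^sup>k\<^sup>l (\<partial>\<^sub>i h\<^sub>k\<^sub>l + \<partial>\<^sub>k h\<^sub>i\<^sub>l)\<close> the first term is the derivative of \<open>log det h\<close>, and the second one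
  differs from it by \<open>\<theta>\<^sub>i\<close>.\<close>

lemma lc_gamma_trace:
  assumes x: "x \<in> S"
  shows "(\<Sum>k\<in>UNIV. lc_gamma H i k k x) = dz i (\<lambda>y. of_real (ln (Re (det (H y))))) x - 1/2 * theta H x (axis i 1)"
proof -
  have "dz i (\<lambda>y. of_real (ln (Re (det (H y))))) x = (\<Sum>k\<in>UNIV. \<Sum>l\<in>UNIV. hup (H x) k l * dz i (\<lambda>y. H y $ k $ l) x)"
    unfolding dz_def fun_del_gd by (rule gd_ln_det[OF x])
  then show ?thesis
    unfolding theta_axis[OF x] lc_gamma_def
    by (simp add: sum_distrib_left sum_subtractf[symmetric]) (simp add: field_simps)
qed

lemma lc_gamma_bar_trace:
  assumes x: "x \<in> S"
  shows "(\<Sum>k\<in>UNIV. lc_gamma_bar H j k k x) = 1/2 * cnj (theta H x (axis j 1))"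
  unfolding cnj_theta_axis[OF x] lc_gamma_bar_def by (simp add: sum_distrib_left)

lemma smooth_lc_gamma: "smooth_map_on (lc_gamma H i j k) S" "smooth_map_on (lc_gamma_bar H i j k) S"
proof -
  show "smooth_map_on (lc_gamma H i j k) S"
    unfolding lc_gamma_def[abs_def] dz_def fun_del_gd
    by (intro smooth_intros open_S smooth_H inv_H smooth_entry)
  show "smooth_map_on (lc_gamma_bar H i j k) S"
    unfolding lc_gamma_bar_def[abs_def] dzbar_def fun_delbar_gd
    by (intro smooth_intros open_S smooth_H inv_H smooth_entry)
qed

text \<open>The products of Christoffel symbols cancel in the trace, because \<open>\<Gamma>\<^sub>i\<^sub>j\<^sup>k\<close> is symmetric in its lower indices.
  Hence the Ricci curvature depends on the traces of the Christoffel symbols only.\<close>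

lemma lc_curv_trace:
  assumes x: "x \<in> S"
  shows "(\<Sum>k\<in>UNIV. lc_curv H i j k k x) = - dzbar j (dz i (\<lambda>y. of_real (ln (Re (det (H y)))))) x
     + 1/2 * dzbar j (\<lambda>y. theta H y (axis i 1)) x + 1/2 * dz i (\<lambda>y. cnj (theta H y (axis j 1))) x"
proof -
  let ?\<psi> = "\<lambda>y. complex_of_real (ln (Re (det (H y))))"
  note g = smooth_map_onD(1)[OF smooth_lc_gamma(1) x] smooth_map_onD(1)[OF smooth_lc_gamma(2) x]
  have sym: "lc_gamma H i k s x = lc_gamma H k i s x" for k s
    by (simp add: lc_gamma_def add.commute)
  have "(\<Sum>k\<in>UNIV. \<Sum>s\<in>UNIV. lc_gamma_bar H j k s x * lc_gamma H s i k x) = (\<Sum>k\<in>UNIV. \<Sum>s\<in>UNIV. lc_gamma H i k s x * lc_gamma_bar H j s k x)"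
    by (subst sum.swap) (simp add: sym mult.commute)
  then have quad: "(\<Sum>k\<in>UNIV. \<Sum>s\<in>UNIV. lc_gamma H i k s x * lc_gamma_bar H j s k x - lc_gamma_bar H j k s x * lc_gamma H s i k x) = 0"
    by (simp add: sum_subtractf)
  have "(\<Sum>k\<in>UNIV. lc_curv H i j k k x) = - (dzbar j (\<lambda>y. \<Sum>k\<in>UNIV. lc_gamma H i k k y) x - dz i (\<lambda>y. \<Sum>k\<in>UNIV. lc_gamma_bar H j k k y) x)"
    unfolding lc_curv_def sum_negf sum.distrib sum_subtractf quad[unfolded sum_subtractf]
    unfolding dzbar_def dz_def fun_del_gd fun_delbar_gd by (simp add: gd_sum g quad[unfolded sum_subtractf])
  also have "dzbar j (\<lambda>y. \<Sum>k\<in>UNIV. lc_gamma H i k k y) x = dzbar j (\<lambda>y. dz i ?\<psi> y - 1/2 * theta H y (axis i 1)) x"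
    unfolding dzbar_def fun_delbar_gd by (rule gd_cong[OF open_S x]) (rule lc_gamma_trace)
  also have "\<dots> = dzbar j (dz i ?\<psi>) x - 1/2 * dzbar j (\<lambda>y. theta H y (axis i 1)) x"
  proof -
    have "smooth_map_on ?\<psi> S"
      by (intro smooth_of_real smooth_ln smooth_Re smooth_det open_S smooth_entry)
         (auto intro: det_hermitian_pos(1) posdef)
    then have "dz i ?\<psi> differentiable (at x)"
      unfolding dz_def[abs_def] fun_del_gd by (rule smooth_map_onD(1)[OF smooth_gd[OF open_S] x])
    moreover have "(\<lambda>y. theta H y (axis i 1)) differentiable (at x)" by (rule smooth_map_onD(1)[OF smooth_theta x])
    ultimately show ?thesis
      unfolding dzbar_def fun_delbar_gd by (simp add: gd_diff gd_cmult[of _ _ _ _ "1/2", simplified] differentiable_mult)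
  qed
  also have "dz i (\<lambda>y. \<Sum>k\<in>UNIV. lc_gamma_bar H j k k y) x = dz i (\<lambda>y. 1/2 * cnj (theta H y (axis j 1))) x"
    unfolding dz_def fun_del_gd by (rule gd_cong[OF open_S x]) (rule lc_gamma_bar_trace)
  also have "\<dots> = 1/2 * dz i (\<lambda>y. cnj (theta H y (axis j 1))) x"
    unfolding dz_def fun_del_gd
    by (rule gd_cmult) (intro smooth_map_onD(1)[OF _ x] smooth_cnj smooth_theta open_S)
  finally show ?thesis by simp
qed

end

section \<open>Real coordinates\<close>

text \<open>The change of variables formula is about \<open>\<real>\<^sup>m\<close> with a well-ordered index type. The
  type \<^typ>\<open>'n bit0\<close> has twice as many elements as \<^typ>\<open>'n\<close> and is well-ordered.\<close>

definition cpx :: "real^('n::finite bit0) \<Rightarrow> complex^'n" where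
  "cpx = (SOME f. linear f \<and> (\<forall>x. norm (f x) = norm x) \<and> bij f)"

definition rl :: "complex^'n::finite \<Rightarrow> real^('n bit0)" where
  "rl = inv cpx"

lemma cpx:
  fixes x :: "real^('n::finite bit0)"
  shows "linear (cpx :: real^('n bit0) \<Rightarrow> complex^'n)" "norm (cpx x) = norm x" "bij (cpx :: real^('n bit0) \<Rightarrow> complex^'n)"
proof -
  have "DIM(real^('n bit0)) = DIM(complex^'n)" by simp
  then obtain f :: "real^('n bit0) \<Rightarrow> complex^'n" and g
    where f: "linear f" "\<And>x. norm (f x) = norm x" "\<And>x. g (f x) = x" "\<And>y. f (g y) = y"
    using isomorphisms_UNIV_UNIV[where 'M="real^('n bit0)" and 'N="complex^'n"] by metis
  have "bij f" by (rule o_bij[of g]) (auto simp: f fun_eq_iff)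
  then have "\<exists>f::real^('n bit0) \<Rightarrow> complex^'n. linear f \<and> (\<forall>x. norm (f x) = norm x) \<and> bij f" using f by blast
  from someI_ex[OF this]
  show "linear (cpx :: real^('n bit0) \<Rightarrow> complex^'n)" "norm (cpx x) = norm x" "bij (cpx :: real^('n bit0) \<Rightarrow> complex^'n)"
    unfolding cpx_def by blast+
qed

lemma rl_cpx [simp]: "rl (cpx x) = x" "cpx (rl z) = z"
  unfolding rl_def by (rule inv_f_f[OF bij_is_inj[OF cpx(3)]], rule surj_f_inv_f[OF bij_is_surj[OF cpx(3)]])

lemma linear_rl: "linear rl"
proof (rule linearI)
  fix x y :: "complex^'a" and r
  have "cpx (rl (x + y)) = cpx (rl x + rl y)" by (simp only: rl_cpx linear_add[OF cpx(1)])
  then show "rl (x + y) = rl x + rl y" by (rule injD[OF bij_is_inj[OF cpx(3)]])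
  have "cpx (rl (r *\<^sub>R x)) = cpx (r *\<^sub>R rl x)" by (simp only: rl_cpx linear_scale[OF cpx(1)])
  then show "rl (r *\<^sub>R x) = r *\<^sub>R rl x" by (rule injD[OF bij_is_inj[OF cpx(3)]])
qed

lemma inner_cpx: "cpx x \<bullet> cpx y = x \<bullet> y"
  unfolding dot_norm by (simp only: linear_add[OF cpx(1), symmetric] cpx(2))

lemma bounded_linear_cpx: "bounded_linear (cpx :: _ \<Rightarrow> complex^'n)" "bounded_linear (rl :: complex^'n \<Rightarrow> _)"
  using cpx(1) linear_rl linear_conv_bounded_linear by blast+

lemma continuous_on_cpx: "continuous_on T (cpx :: _ \<Rightarrow> complex^'n)" "continuous_on U (rl :: complex^'n \<Rightarrow> _)"
  by (simp_all add: linear_continuous_on bounded_linear_cpx)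

lemma vimage_cpx: "cpx -` S = rl ` S"
  by (auto intro: image_eqI[of _ rl "cpx _"])

lemma open_vimage_cpx: "open S \<Longrightarrow> open (cpx -` (S :: (complex^'n) set))"
  by (rule open_vimage[OF _ continuous_on_cpx(1)])

definition rmat :: "(complex^'n::finite \<Rightarrow> complex^'n) \<Rightarrow> real^('n bit0)^('n bit0)" where
  "rmat L = matrix (\<lambda>y. rl (L (cpx y)))"

section \<open>Integration in a coordinate domain\<close>

lemma continuous_on_zero_extension:
  fixes f :: "'a::t2_space \<Rightarrow> 'b::real_normed_vector"
  assumes "open U" "compact K" "continuous_on U f" "\<And>y. y \<in> U - K \<Longrightarrow> f y = 0" "K \<subseteq> U"
  shows "continuous_on UNIV (\<lambda>y. if y \<in> U then f y else 0)" (is "continuous_on UNIV ?g")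
proof -
  have oK: "open (- K)" using assms(2) by (simp add: compact_imp_closed open_Compl)
  have "continuous_on U ?g" using assms(3) by (simp cong: continuous_on_cong)
  moreover have "continuous_on (- K) ?g"
  proof -
    have "?g y = 0" if "y \<in> - K" for y using assms(4) that by auto
    then show ?thesis by (intro continuous_on_eq[OF continuous_on_const[of _ 0]]) simp
  qed
  ultimately have "continuous_on (U \<union> - K) ?g" using continuous_on_open_Un[OF assms(1) oK] by blast
  moreover have "U \<union> - K = UNIV" using assms(5) by auto
  ultimately show ?thesis by simp
qed

lemma integral_eq_UNIV:
  fixes f :: "'a::euclidean_space \<Rightarrow> real"
  assumes "\<And>x. x \<notin> T \<Longrightarrow> f x = 0"
  shows "integral T f = integral UNIV f"
proof -
  have "f = (\<lambda>x. if x \<in> T then f x else 0)" using assms by auto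
  then show ?thesis using integral_restrict_UNIV[of T f] by simp
qed

text \<open>The integral of a directional derivative of a compactly supported function is the derivative of the
  integrals of its translates, which are all the same.\<close>

lemma integral_derivative_compact_support:
  fixes f :: "'a::euclidean_space \<Rightarrow> real"
  assumes U: "open U" and K: "compact K" "K \<subseteq> U"
    and f: "\<And>y. y \<in> U \<Longrightarrow> f differentiable (at y)" "\<And>y. y \<in> U - K \<Longrightarrow> f y = 0"
    and cont: "continuous_on U (\<lambda>y. frechet_derivative f (at y) e)"
  shows "integral U (\<lambda>y. frechet_derivative f (at y) e) = 0"
proof -
  define g where "g y = (if y \<in> U then f y else 0)" for y
  define D where "D y = frechet_derivative g (at y) e" for y
  have oK: "open (- K)" using K by (simp add: compact_imp_closed open_Compl)
  have gU: "g y = f y" if "y \<in> U" for y using that by (simp add: g_def)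
  have gK: "g y = 0" if "y \<in> - K" for y using that f(2) by (simp add: g_def)
  have const0: "frechet_derivative (\<lambda>y. 0::real) (at y) e = 0" for y :: 'a
    using frechet_derivative_at[OF has_derivative_const[of "0::real" "at y"]] by metis
  have gd: "g differentiable (at y)" for y
  proof (cases "y \<in> U")
    case True
    then show ?thesis using frechet_derivative_cong_open(2)[OF U True gU] f(1) by simp
  next
    case False
    then have "y \<in> - K" using K by auto
    then show ?thesis using frechet_derivative_cong_open(2)[OF oK _ gK] by simp
  qed
  have DK: "D y = 0" if "y \<in> - K" for y
    using frechet_derivative_cong_open(1)[OF oK that gK] const0 by (simp add: D_def)
  have DU: "D y = frechet_derivative f (at y) e" if "y \<in> U" for y
    using frechet_derivative_cong_open(1)[OF U that gU] by (simp add: D_def)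
  have D_eq: "D = (\<lambda>y. if y \<in> U then frechet_derivative f (at y) e else 0)"
    using DU DK K by (auto simp: fun_eq_iff)
  have contD: "continuous_on UNIV D"
    unfolding D_eq by (rule continuous_on_zero_extension[OF U K(1) cont _ K(2)]) (use DU DK in force)
  have contg: "continuous_on UNIV g"
    using gd by (simp add: continuous_at_imp_continuous_on differentiable_imp_continuous_within)
  obtain R where R: "R > 0" "\<And>x. x \<in> K \<Longrightarrow> norm x \<le> R"
    using compact_imp_bounded[OF K(1)] bounded_pos by blast
  obtain a :: 'a where a: "cball 0 (R + norm e) \<subseteq> cbox (- a) a"
    using bounded_subset_cbox_symmetric[OF bounded_cball] by blast
  define F where "F t = integral (cbox (- a) a) (\<lambda>x. g (t *\<^sub>R e + x))" for t
  have F: "F t = integral UNIV g" if t: "t \<in> {-1..1}" for t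
  proof -
    have "F t = integral (cbox (- a) a) (g \<circ> ((+) (t *\<^sub>R e)))" by (simp add: F_def o_def)
    also have "\<dots> = integral (cbox (- a + t *\<^sub>R e) (a + t *\<^sub>R e)) g" by (rule integral_shift_cbox_plus)
    also have "\<dots> = integral UNIV g"
    proof (rule integral_eq_UNIV, rule gK, rule ComplI)
      fix x assume x: "x \<notin> cbox (- a + t *\<^sub>R e) (a + t *\<^sub>R e)" and "x \<in> K"
      then have "norm (x - t *\<^sub>R e) \<le> R + \<bar>t\<bar> * norm e"
        using R(2) norm_triangle_ineq4[of x "t *\<^sub>R e"] by (smt (verit) norm_scaleR)
      also have "\<dots> \<le> R + norm e" using t mult_right_mono[of "\<bar>t\<bar>" 1 "norm e"] by auto
      finally have "x - t *\<^sub>R e \<in> cbox (- a) a" using a by auto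
      then show False using x by (force simp: mem_box algebra_simps inner_simps)
    qed
    finally show ?thesis .
  qed
  have "((\<lambda>t. integral (cbox (- a) a) (\<lambda>x. g (t *\<^sub>R e + x))) has_vector_derivative
      integral (cbox (- a) a) (\<lambda>x. D (0 *\<^sub>R e + x))) (at 0 within {-1..1})"
  proof (rule leibniz_rule_vector_derivative[where fx = "\<lambda>t x. D (t *\<^sub>R e + x)"])
    fix t :: real and x
    have 1: "((\<lambda>t. t *\<^sub>R e + x) has_derivative (\<lambda>t. t *\<^sub>R e)) (at t within {-1..1})"
      by (auto intro!: derivative_eq_intros)
    have 2: "(g has_derivative frechet_derivative g (at (t *\<^sub>R e + x))) (at (t *\<^sub>R e + x))"
      using gd frechet_derivative_works by blast
    have "linear (frechet_derivative g (at (t *\<^sub>R e + x)))"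
      using 2 has_derivative_linear by blast
    then show "((\<lambda>t. g (t *\<^sub>R e + x)) has_vector_derivative D (t *\<^sub>R e + x)) (at t within {-1..1})"
      using has_derivative_compose[OF 1 2] by (simp add: has_vector_derivative_def D_def linear_cmul)
  next
    fix t :: real
    show "(\<lambda>x. g (t *\<^sub>R e + x)) integrable_on cbox (- a) a"
      by (intro integrable_continuous continuous_on_compose2[OF contg] continuous_intros) auto
  next
    show "continuous_on ({-1..1} \<times> cbox (- a) a) (\<lambda>(t, x). D (t *\<^sub>R e + x))"
      unfolding split_beta by (intro continuous_on_compose2[OF contD] continuous_intros) auto
  qed auto
  then have 1: "(F has_vector_derivative integral (cbox (- a) a) D) (at 0 within {-1..1})"
    unfolding F_def[abs_def] by simp
  have 2: "(F has_vector_derivative 0) (at 0 within {-1..1})"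
    by (rule has_vector_derivative_transform[of _ _ F "\<lambda>t. integral UNIV g"]) (auto simp: F)
  have "at (0::real) within {-1..1} \<noteq> bot"
    by (simp add: at_within_Icc_at)
  then have "integral (cbox (- a) a) D = 0"
    using vector_derivative_unique_within[OF _ 1 2] by blast
  moreover have "integral (cbox (- a) a) D = integral UNIV D"
  proof (rule integral_eq_UNIV, rule DK, rule ComplI)
    fix x assume "x \<notin> cbox (- a) a" "x \<in> K"
    then show False using a R(2)[of x] by (auto simp: subset_iff) (smt (verit) norm_ge_zero)
  qed
  ultimately show ?thesis
    unfolding D_eq integral_restrict_UNIV by simp
qed

text \<open>The integral over a domain of \<open>\<complex>\<^sup>n\<close>, and the integrands used: continuous functions vanishing
  outside a compact subset of the domain.\<close>

definition cint :: "(complex^'n::finite) set \<Rightarrow> (complex^'n \<Rightarrow> real) \<Rightarrow> real" where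
  "cint S f = integral (cpx -` S) (\<lambda>y. f (cpx y))"

definition cc_on :: "(complex^'n::finite) set \<Rightarrow> (complex^'n \<Rightarrow> real) \<Rightarrow> bool" where
  "cc_on S f \<longleftrightarrow> open S \<and> continuous_on S f \<and> (\<exists>K. compact K \<and> K \<subseteq> S \<and> (\<forall>x\<in>S - K. f x = 0))"

lemma compact_vimage_cpx: "compact K \<Longrightarrow> compact (cpx -` (K :: (complex^'n) set))"
  unfolding vimage_cpx by (intro compact_continuous_image continuous_on_cpx)

lemma cc_on_extension:
  assumes "cc_on S f"
  shows "continuous_on UNIV (\<lambda>y. if y \<in> cpx -` S then f (cpx y) else 0)"
    and "\<exists>K. compact K \<and> (\<forall>y. y \<notin> K \<longrightarrow> (if y \<in> cpx -` S then f (cpx y) else 0) = 0)"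
proof -
  obtain K where K: "open S" "continuous_on S f" "compact K" "K \<subseteq> S" "\<And>x. x \<in> S - K \<Longrightarrow> f x = 0"
    using assms unfolding cc_on_def by blast
  have "continuous_on (cpx -` S) (\<lambda>y. f (cpx y))"
    by (rule continuous_on_compose2[OF K(2) continuous_on_cpx(1)]) auto
  then show "continuous_on UNIV (\<lambda>y. if y \<in> cpx -` S then f (cpx y) else 0)"
    by (intro continuous_on_zero_extension[of _ "cpx -` K"] open_vimage_cpx compact_vimage_cpx K) (use K in auto)
  show "\<exists>K. compact K \<and> (\<forall>y. y \<notin> K \<longrightarrow> (if y \<in> cpx -` S then f (cpx y) else 0) = 0)"
    using compact_vimage_cpx[OF K(3)] K(5) by (intro exI[of _ "cpx -` K"]) auto
qed

lemma cc_on_absolutely_integrable: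
  assumes "cc_on S f"
  shows "(\<lambda>y. f (cpx y)) absolutely_integrable_on (cpx -` S)"
proof -
  let ?g = "\<lambda>y. if y \<in> cpx -` S then f (cpx y) else 0"
  obtain K where K: "compact K" "\<And>y. y \<notin> K \<Longrightarrow> ?g y = 0" using cc_on_extension(2)[OF assms] by blast
  obtain a where a: "K \<subseteq> cbox (- a) a" using bounded_subset_cbox_symmetric[OF compact_imp_bounded[OF K(1)]] by blast
  have "?g absolutely_integrable_on cbox (- a) a"
    by (intro absolutely_integrable_continuous continuous_on_subset[OF cc_on_extension(1)[OF assms]]) auto
  then have "(\<lambda>x. if x \<in> cbox (- a) a then ?g x else 0) absolutely_integrable_on UNIV"
    by (simp only: absolutely_integrable_restrict_UNIV)
  also have "(\<lambda>x. if x \<in> cbox (- a) a then ?g x else 0) = ?g"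
    using K(2) a by (force simp: fun_eq_iff)
  finally show ?thesis by (simp only: absolutely_integrable_restrict_UNIV)
qed

lemma cint_cong: "(\<And>x. x \<in> S \<Longrightarrow> f x = g x) \<Longrightarrow> cint S f = cint S g"
  unfolding cint_def by (rule integral_cong) simp

lemma cint_sum:
  assumes "finite I" "\<And>i. i \<in> I \<Longrightarrow> cc_on S (f i)"
  shows "cint S (\<lambda>x. \<Sum>i\<in>I. f i x) = (\<Sum>i\<in>I. cint S (f i))"
  unfolding cint_def
  by (rule integral_sum[OF assms(1)]) (rule set_lebesgue_integral_eq_integral(1)[OF cc_on_absolutely_integrable[OF assms(2)]])

lemma cint_subset:
  assumes "T \<subseteq> S" "\<And>x. x \<in> S - T \<Longrightarrow> f x = 0"
  shows "cint T f = cint S f"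
proof -
  have "(\<lambda>y. if y \<in> cpx -` T then f (cpx y) else 0) = (\<lambda>y. if y \<in> cpx -` S then f (cpx y) else 0)"
    using assms by (auto simp: fun_eq_iff)
  then show ?thesis unfolding cint_def
    using integral_restrict_UNIV[of "cpx -` T" "\<lambda>y. f (cpx y)"] integral_restrict_UNIV[of "cpx -` S" "\<lambda>y. f (cpx y)"] by simp
qed

lemma cint_derivative:
  fixes f :: "complex^'n::finite \<Rightarrow> real"
  assumes S: "open S" and K: "compact K" "K \<subseteq> S"
    and f: "\<And>y. y \<in> S \<Longrightarrow> f differentiable (at y)" "\<And>y. y \<in> S - K \<Longrightarrow> f y = 0"
    and cont: "continuous_on S (\<lambda>y. frechet_derivative f (at y) v)"
  shows "cint S (\<lambda>x. frechet_derivative f (at x) v) = 0"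
proof -
  have der: "((\<lambda>y. f (cpx y)) has_derivative (\<lambda>w. frechet_derivative f (at (cpx y)) (cpx w))) (at y)" if "cpx y \<in> S" for y
    using has_derivative_compose[OF bounded_linear_imp_has_derivative[OF bounded_linear_cpx(1)] f(1)[OF that, unfolded frechet_derivative_works]] .
  have fd: "frechet_derivative (\<lambda>y. f (cpx y)) (at y) (rl v) = frechet_derivative f (at (cpx y)) v" if "cpx y \<in> S" for y
    using fun_cong[OF frechet_derivative_at[OF der[OF that]], of "rl v"] by simp
  have "integral (cpx -` S) (\<lambda>y. frechet_derivative (\<lambda>y. f (cpx y)) (at y) (rl v)) = 0"
  proof (rule integral_derivative_compact_support[OF open_vimage_cpx[OF S] compact_vimage_cpx[OF K(1)]])
    show "cpx -` K \<subseteq> cpx -` S" using K by auto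
    show "(\<lambda>y. f (cpx y)) differentiable (at y)" if "y \<in> cpx -` S" for y
      using der[of y] that differentiable_def by auto
    have "continuous_on (cpx -` S) (\<lambda>y. frechet_derivative f (at (cpx y)) v)"
      by (rule continuous_on_compose2[OF cont continuous_on_cpx(1)]) auto
    then show "continuous_on (cpx -` S) (\<lambda>y. frechet_derivative (\<lambda>y. f (cpx y)) (at y) (rl v))"
      by (rule continuous_on_eq) (simp add: fd)
  qed (use f in auto)
  moreover have "integral (cpx -` S) (\<lambda>y. frechet_derivative (\<lambda>y. f (cpx y)) (at y) (rl v)) = cint S (\<lambda>x. frechet_derivative f (at x) v)"
    unfolding cint_def by (rule integral_cong) (simp add: fd)
  ultimately show ?thesis by simp
qed

lemma cint_eq_0_imp:
  assumes f: "cc_on S f" "\<And>x. x \<in> S \<Longrightarrow> f x \<ge> 0" "cint S f = 0" and x: "x \<in> S"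
  shows "f x = 0"
proof -
  let ?g = "\<lambda>y. if y \<in> cpx -` S then f (cpx y) else 0"
  obtain K where K: "compact K" "\<And>y. y \<notin> K \<Longrightarrow> ?g y = 0" using cc_on_extension(2)[OF f(1)] by blast
  have "bounded (insert (rl x) K)" using K compact_imp_bounded by auto
  then obtain a where a: "insert (rl x) K \<subseteq> box (- a) a"
    using bounded_subset_box_symmetric by blast
  have "integral (cbox (- a) a) ?g = integral UNIV ?g"
    by (rule integral_eq_UNIV) (use K(2) a box_subset_cbox in blast)
  also have "\<dots> = 0" using f(3) unfolding cint_def integral_restrict_UNIV .
  finally have 0: "integral (cbox (- a) a) ?g = 0" .
  have cont: "continuous_on (cbox (- a) a) ?g" using cc_on_extension(1)[OF f(1)] continuous_on_subset by blast
  have "(?g has_integral 0) (cbox (- a) a)"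
    using integrable_integral[OF integrable_continuous[OF cont]] 0 by simp
  moreover have "rl x \<in> box (- a) a" using a by simp
  moreover have "box (- a) a \<subseteq> cbox (- a) a" by (rule box_subset_cbox)
  ultimately have "?g (rl x) = 0"
    by (intro has_integral_0_cbox_imp_0[OF cont]) (use f(2) in auto)
  then show ?thesis using x by simp
qed

lemma cint_change_of_variables:
  fixes t :: "complex^'n::finite \<Rightarrow> complex^'n"
  assumes S: "open S" and t: "\<And>x. x \<in> S \<Longrightarrow> t differentiable (at x)" "inj_on t S" "t ` S = S'"
    and F': "cc_on S' F'"
    and F: "\<And>x. x \<in> S \<Longrightarrow> F x = \<bar>det (rmat (frechet_derivative t (at x)))\<bar> * F' (t x)"
  shows "cint S F = cint S' F'"
proof -
  define g where "g y = rl (t (cpx y))" for y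
  define g' where "g' y w = rl (frechet_derivative t (at (cpx y)) (cpx w))" for y w
  have der: "(g has_derivative g' y) (at y within cpx -` S)" if "y \<in> cpx -` S" for y
  proof -
    have "(t has_derivative frechet_derivative t (at (cpx y))) (at (cpx y))"
      using t(1) that frechet_derivative_works by auto
    from has_derivative_compose[OF has_derivative_compose[OF bounded_linear_imp_has_derivative[OF bounded_linear_cpx(1)] this]
        bounded_linear_imp_has_derivative[OF bounded_linear_cpx(2)]]
    show ?thesis unfolding g_def[abs_def] g'_def[abs_def] by (rule has_derivative_at_withinI)
  qed
  have im: "g ` (cpx -` S) = cpx -` S'"
    unfolding vimage_cpx g_def image_image using t(3) by (auto simp: image_iff)
  have inj: "inj_on g (cpx -` S)"
  proof (rule inj_onI)
    fix x y assume xy: "x \<in> cpx -` S" "y \<in> cpx -` S" "g x = g y"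
    then have "t (cpx x) = t (cpx y)" unfolding g_def by (metis rl_cpx(2))
    then have "cpx x = cpx y" using t(2) xy by (auto dest: inj_onD)
    then show "x = y" by (metis rl_cpx(1))
  qed
  define f where "f y = (\<chi> i. F' (cpx y) :: real^1)" for y
  have f1: "f y $ 1 = F' (cpx y)" for y by (simp add: f_def)
  have "f absolutely_integrable_on (cpx -` S')"
    unfolding absolutely_integrable_on_1_iff f1 by (rule cc_on_absolutely_integrable[OF F'])
  then have *: "integral (cpx -` S) (\<lambda>x. \<bar>det (matrix (g' x))\<bar> *\<^sub>R f (g x)) = integral (cpx -` S') f"
    using has_absolute_integral_change_of_variables[OF _ der inj, of f "integral (cpx -` S') f"] im
      open_vimage_cpx[OF S] by (simp add: borel_open)
  have "cint S F = integral (cpx -` S) (\<lambda>x. (\<bar>det (matrix (g' x))\<bar> *\<^sub>R f (g x)) $ 1)"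
    unfolding cint_def
    by (rule integral_cong) (simp add: F f1 g_def g'_def[abs_def] rmat_def)
  also have "\<dots> = integral (cpx -` S) (\<lambda>x. \<bar>det (matrix (g' x))\<bar> *\<^sub>R f (g x)) $ 1"
    using arg_cong[OF integral_on_1_eq[of "cpx -` S" "\<lambda>x. \<bar>det (matrix (g' x))\<bar> *\<^sub>R f (g x)"], of "\<lambda>v. v $ 1"] by simp
  also have "\<dots> = cint S' F'"
    unfolding * using arg_cong[OF integral_on_1_eq[of "cpx -` S'" f], of "\<lambda>v. v $ 1"] by (simp add: f1 cint_def)
  finally show ?thesis .
qed

section \<open>Charts of a compact manifold\<close>

lemma chart_bij:
  assumes "chart_on X c"
  shows "bij_betw (snd c) (fst c) (cimage c)" "fst c \<subseteq> topspace X" "open (cimage c)"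
proof -
  show sub: "fst c \<subseteq> topspace X" and "open (cimage c)" using assms openin_subset unfolding chart_on_def by auto
  have "homeomorphic_map (subtopology X (fst c)) (top_of_set (cimage c)) (snd c)"
    using assms unfolding chart_on_def by blast
  then show "bij_betw (snd c) (fst c) (cimage c)"
    using sub by (simp add: bij_betw_def homeomorphic_eq_everything_map Int_absorb1)
qed

lemma cinv_facts:
  assumes "chart_on X c"
  shows "p \<in> fst c \<Longrightarrow> cinv c (snd c p) = p" "p \<in> fst c \<Longrightarrow> snd c p \<in> cimage c"
    "x \<in> cimage c \<Longrightarrow> cinv c x \<in> fst c" "x \<in> cimage c \<Longrightarrow> snd c (cinv c x) = x"
  using chart_bij(1)[OF assms] unfolding bij_betw_def cinv_def cimage_def
  by (auto intro: inv_into_into f_inv_into_f)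

lemma overlap_facts:
  assumes "chart_on X c" "chart_on X c'"
  shows "overlap c c' = {x \<in> cimage c. cinv c x \<in> fst c'}"
    "x \<in> overlap c c' \<Longrightarrow> transition c c' x = snd c' (cinv c x)"
    "x \<in> overlap c c' \<Longrightarrow> transition c c' x \<in> overlap c' c"
    "x \<in> overlap c c' \<Longrightarrow> cinv c' (transition c c' x) = cinv c x"
    "x \<in> overlap c c' \<Longrightarrow> x \<in> cimage c"
    "x \<in> overlap c c' \<Longrightarrow> transition c c' x \<in> cimage c'"
    "inj_on (transition c c') (overlap c c')" "transition c c' ` overlap c c' = overlap c' c"
proof -
  note a = cinv_facts[OF assms(1)] and b = cinv_facts[OF assms(2)]
  have 1: "overlap c c' = {x \<in> cimage c. cinv c x \<in> fst c'}" if "chart_on X c" "chart_on X c'" for c c' :: "('a, 'b) chart"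
  proof (intro equalityI subsetI)
    fix x assume "x \<in> overlap c c'"
    then show "x \<in> {x \<in> cimage c. cinv c x \<in> fst c'}"
      using cinv_facts(1,2)[OF that(1)] by (auto simp: overlap_def)
  next
    fix x assume "x \<in> {x \<in> cimage c. cinv c x \<in> fst c'}"
    then show "x \<in> overlap c c'"
      using cinv_facts(3,4)[OF that(1), of x] by (auto simp: overlap_def intro!: image_eqI[of _ _ "cinv c x"])
  qed
  show "overlap c c' = {x \<in> cimage c. cinv c x \<in> fst c'}" by (rule 1[OF assms])
  have 2: "transition c c' x = snd c' (cinv c x)" for c c' :: "('a, 'b) chart" and x
    by (simp add: transition_def)
  show "x \<in> overlap c c' \<Longrightarrow> transition c c' x = snd c' (cinv c x)" by (rule 2)
  have 3: "x \<in> overlap c c' \<Longrightarrow> transition c c' x \<in> overlap c' c" for x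
    unfolding 2 1[OF assms] 1[OF assms(2,1)] using a b by auto
  have 4: "x \<in> overlap c c' \<Longrightarrow> cinv c' (transition c c' x) = cinv c x" for x
    unfolding 2 1[OF assms] using b by auto
  show "x \<in> overlap c c' \<Longrightarrow> transition c c' x \<in> overlap c' c" by (rule 3)
  show "x \<in> overlap c c' \<Longrightarrow> cinv c' (transition c c' x) = cinv c x" by (rule 4)
  show "x \<in> overlap c c' \<Longrightarrow> x \<in> cimage c" unfolding 1[OF assms] by simp
  show "x \<in> overlap c c' \<Longrightarrow> transition c c' x \<in> cimage c'"
    unfolding 2 1[OF assms] using b by auto
  show "inj_on (transition c c') (overlap c c')"
  proof (rule inj_onI)
    fix x y assume "x \<in> overlap c c'" "y \<in> overlap c c'" "transition c c' x = transition c c' y"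
    then have "cinv c x = cinv c y" "x \<in> cimage c" "y \<in> cimage c" using 4[of x] 4[of y] 1[OF assms] by auto
    then show "x = y" using a(4) by metis
  qed
  have "y \<in> transition c c' ` overlap c c'" if y: "y \<in> overlap c' c" for y
  proof (rule image_eqI)
    have y': "y \<in> cimage c'" "cinv c' y \<in> fst c" using y 1[OF assms(2,1)] by auto
    show "snd c (cinv c' y) \<in> overlap c c'" unfolding overlap_def using b(3)[OF y'(1)] y'(2) by blast
    show "y = transition c c' (snd c (cinv c' y))" unfolding 2 a(1)[OF y'(2)] b(4)[OF y'(1)] ..
  qed
  then show "transition c c' ` overlap c c' = overlap c' c" using 3 by auto
qed

lemma chart_open_image:
  assumes "chart_on X c" "openin X W"
  shows "open (snd c ` (W \<inter> fst c))"
proof -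
  have "openin (subtopology X (fst c)) (W \<inter> fst c)" using assms(2) by (rule openin_subtopology_Int)
  then have "openin (top_of_set (cimage c)) (snd c ` (W \<inter> fst c))"
    using assms(1) homeomorphic_imp_open_map unfolding chart_on_def open_map_def by blast
  then show ?thesis using chart_bij(3)[OF assms(1)] openin_open_trans by blast
qed

lemma open_overlap: "chart_on X c \<Longrightarrow> chart_on X c' \<Longrightarrow> open (overlap c c')"
  using chart_open_image[of X c "fst c'"] unfolding overlap_def by (simp add: chart_on_def Int_commute)

lemma chart_open_vimage:
  assumes "chart_on X c" "open U"
  shows "openin X {p \<in> fst c. snd c p \<in> U}"
proof -
  have "continuous_map (subtopology X (fst c)) (top_of_set (cimage c)) (snd c)"
    using assms(1) homeomorphic_imp_continuous_map unfolding chart_on_def by blast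
  then have "openin (subtopology X (fst c)) {p \<in> topspace (subtopology X (fst c)). snd c p \<in> U \<inter> cimage c}"
    using assms(2) by (intro openin_continuous_map_preimage) (auto simp: openin_open)
  also have "{p \<in> topspace (subtopology X (fst c)). snd c p \<in> U \<inter> cimage c} = {p \<in> fst c. snd c p \<in> U}"
    using chart_bij(2)[OF assms(1)] cinv_facts(2)[OF assms(1)] by auto
  finally show ?thesis using assms(1) openin_trans_full unfolding chart_on_def by blast
qed

lemma chart_compact_cinv:
  assumes "chart_on X c" "compact K" "K \<subseteq> cimage c"
  shows "compactin X {p \<in> fst c. snd c p \<in> K}"
proof -
  have h: "homeomorphic_map (subtopology X (fst c)) (top_of_set (cimage c)) (snd c)"
    using assms(1) unfolding chart_on_def by blast
  have top: "topspace (subtopology X (fst c)) = fst c" using chart_bij(2)[OF assms(1)] by auto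
  have im: "snd c ` {p \<in> fst c. snd c p \<in> K} = K"
    using assms(3) unfolding cimage_def by auto
  have "compactin (subtopology X (fst c)) {p \<in> fst c. snd c p \<in> K}"
    using homeomorphic_map_compactness[OF h, of "{p \<in> fst c. snd c p \<in> K}"] im assms(2,3) top
    by (simp add: compactin_subtopology) (use chart_bij(2)[OF assms(1)] in blast)
  then show ?thesis by (simp add: compactin_subtopology)
qed

lemma chart_compact_image:
  assumes "chart_on X c" "compactin X Q" "Q \<subseteq> fst c"
  shows "compact (snd c ` Q)"
proof -
  have h: "homeomorphic_map (subtopology X (fst c)) (top_of_set (cimage c)) (snd c)"
    using assms(1) unfolding chart_on_def by blast
  have "compactin (subtopology X (fst c)) Q" using assms by (simp add: compactin_subtopology)
  then have "compactin (top_of_set (cimage c)) (snd c ` Q)"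
    using homeomorphic_imp_continuous_map[OF h] image_compactin by blast
  then show ?thesis by (simp add: compactin_subtopology)
qed

lemma complex_manifoldD:
  assumes "complex_manifold X A"
  shows "c \<in> A \<Longrightarrow> chart_on X c" "p \<in> topspace X \<Longrightarrow> \<exists>c\<in>A. p \<in> fst c" "Hausdorff_space X"
    and "c \<in> A \<Longrightarrow> c' \<in> A \<Longrightarrow> holomorphic_map_on (transition c c') (overlap c c')"
  using assms unfolding complex_manifold_def by auto

section \<open>Bump functions and a partition of unity\<close>

text \<open>Continuously differentiable functions suffice for integration by parts, and for them the square of
  a positive part serves as a bump.\<close>

lemma Ck_on_square_pos: "Ck_on (Suc 0) (\<lambda>t::real. (max 0 t)\<^sup>2) UNIV"
proof -
  have der: "((\<lambda>t::real. (max 0 t)\<^sup>2) has_real_derivative 2 * max 0 t) (at t)" for t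
  proof (cases t "0::real" rule: linorder_cases)
    case greater
    have "((\<lambda>t::real. t\<^sup>2) has_real_derivative 2 * t) (at t)" by (auto intro!: derivative_eq_intros)
    then have "((\<lambda>t::real. (max 0 t)\<^sup>2) has_real_derivative 2 * t) (at t)"
      by (rule has_field_derivative_transform_within_open[of _ _ _ "{0<..}"]) (use greater in auto)
    then show ?thesis using greater by simp
  next
    case less
    have "((\<lambda>t::real. 0) has_real_derivative 0) (at t)" by simp
    then have "((\<lambda>t::real. (max 0 t)\<^sup>2) has_real_derivative 0) (at t)"
      by (rule has_field_derivative_transform_within_open[of _ _ _ "{..<0}"]) (use less in auto)
    then show ?thesis using less by simp
  next
    case equal
    have "((\<lambda>h::real. (max 0 h)\<^sup>2 / h) \<longlongrightarrow> 0) (at 0)"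
    proof (rule Lim_null_comparison[of _ "\<lambda>h. \<bar>h\<bar>"])
      show "\<forall>\<^sub>F h in at 0. norm ((max 0 h)\<^sup>2 / h) \<le> \<bar>h::real\<bar>"
        by (rule always_eventually) (auto simp: max_def power2_eq_square)
      show "((\<lambda>h::real. \<bar>h\<bar>) \<longlongrightarrow> 0) (at 0)" by (auto intro!: tendsto_eq_intros)
    qed
    then show ?thesis using equal by (simp add: has_field_derivative_iff)
  qed
  have fd: "frechet_derivative (\<lambda>t::real. (max 0 t)\<^sup>2) (at t) v = 2 * max 0 t * v" for t v
    using frechet_derivative_at[OF der[unfolded has_field_derivative_def]] by metis
  have "continuous_on UNIV (\<lambda>t::real. 2 * max 0 t * v)" for v by (intro continuous_intros)
  then show ?thesis using der by (auto simp: fd differentiable_def has_field_derivative_def)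
qed

definition C1_fun :: "('p, 'n::finite) chart set \<Rightarrow> ('p \<Rightarrow> real) \<Rightarrow> bool" where
  "C1_fun A \<rho> \<longleftrightarrow> (\<forall>c\<in>A. Ck_on (Suc 0) (\<lambda>x. \<rho> (cinv c x)) (cimage c))"

definition bump :: "('p, 'n::finite) chart \<Rightarrow> complex^'n \<Rightarrow> real \<Rightarrow> 'p \<Rightarrow> real" where
  "bump c a r p = (if p \<in> fst c then (max 0 (r\<^sup>2 - (norm (snd c p - a))\<^sup>2))\<^sup>2 else 0)"

lemma bump_pos_iff:
  assumes "r > 0"
  shows "bump c a r p > 0 \<longleftrightarrow> p \<in> fst c \<and> norm (snd c p - a) < r" "bump c a r p \<ge> 0"
proof -
  have "(norm (snd c p - a))\<^sup>2 < r\<^sup>2 \<longleftrightarrow> norm (snd c p - a) < r"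
    using assms power2_less_imp_less[of "norm (snd c p - a)" r] power_strict_mono[of "norm (snd c p - a)" r 2] by auto
  then show "bump c a r p > 0 \<longleftrightarrow> p \<in> fst c \<and> norm (snd c p - a) < r"
    by (auto simp: bump_def max_def)
  show "bump c a r p \<ge> 0" by (simp add: bump_def)
qed

text \<open>In another chart the bump is a composition with the change of coordinates where the two charts overlap, and
  it vanishes off the compact ball, which is closed because \<open>X\<close> is Hausdorff. These two open sets cover the chart.\<close>

lemma C1_fun_bump:
  assumes M: "complex_manifold X A" and c: "c \<in> A" and r: "r > 0" "cball a r \<subseteq> cimage c"
  shows "C1_fun A (bump c a r)"
  unfolding C1_fun_def
proof
  fix c' assume c': "c' \<in> A"
  note ch = complex_manifoldD(1)[OF M c] complex_manifoldD(1)[OF M c']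
  note ov = overlap_facts[OF ch(2,1)]
  let ?f = "\<lambda>x. bump c a r (cinv c' x)"
  let ?b = "\<lambda>z::complex^'b. (max 0 (r\<^sup>2 - (z - a) \<bullet> (z - a)))\<^sup>2"
  define Q where "Q = {p \<in> fst c. snd c p \<in> cball a r}"
  define W where "W = snd c' ` ((topspace X - Q) \<inter> fst c')"
  have "closedin X Q"
    unfolding Q_def using chart_compact_cinv[OF ch(1) compact_cball r(2)] complex_manifoldD(3)[OF M]
    by (rule compactin_imp_closedin[rotated])
  then have oW: "open W" unfolding W_def by (intro chart_open_image[OF ch(2)]) blast
  have oO: "open (overlap c' c)" by (rule open_overlap[OF ch(2,1)])
  have "Ck_on (Suc 0) ?f W"
  proof (subst Ck_on_cong[OF oW])
    show "?f y = 0" if "y \<in> W" for y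
    proof -
      obtain q where q: "q \<in> fst c'" "q \<notin> Q" "y = snd c' q" using \<open>y \<in> W\<close> unfolding W_def by auto
      then have "\<not> bump c a r q > 0" unfolding bump_pos_iff[OF r(1)] Q_def by (auto simp: dist_norm norm_minus_commute)
      then show ?thesis using q cinv_facts(1)[OF ch(2)] bump_pos_iff(2)[OF r(1), of c a q] by simp
    qed
  qed (rule Ck_on_const)
  moreover have "Ck_on (Suc 0) ?f (overlap c' c)"
  proof (subst Ck_on_cong[OF oO])
    show "?f y = ?b (transition c' c y)" if "y \<in> overlap c' c" for y
      using that ov(1) by (simp add: bump_def transition_def power2_norm_eq_inner)
    have id: "Ck_on (Suc 0) (\<lambda>z. z) UNIV" for z :: "complex^'b"
      by (auto simp: frechet_derivative_ident)
    have b: "Ck_on (Suc 0) ?b UNIV"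
      by (rule Ck_on_compose[OF _ _ _ _ Ck_on_square_pos])
         (auto simp del: Ck_on.simps intro!: Ck_on_add[where g = "\<lambda>z. - _ z", simplified] Ck_on_const
            Ck_on_linear[OF bounded_linear_minus[OF bounded_linear_ident]] Ck_on_bilinear[OF bounded_bilinear_inner] id
            Ck_on_add[where g = "\<lambda>z. - a", simplified])
    show "Ck_on (Suc 0) (\<lambda>y. ?b (transition c' c y)) (overlap c' c)"
      by (rule Ck_on_compose[OF oO open_UNIV _ _ b])
         (use complex_manifoldD(4)[OF M c' c] in \<open>auto simp: holomorphic_map_on_def smooth_map_on_def\<close>)
  qed
  moreover have "cimage c' \<subseteq> W \<union> overlap c' c"
  proof
    fix x assume x: "x \<in> cimage c'"
    show "x \<in> W \<union> overlap c' c"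
    proof (cases "cinv c' x \<in> fst c")
      case False
      then show ?thesis using x cinv_facts(3,4)[OF ch(2), of x] chart_bij(2)[OF ch(2)]
        unfolding W_def Q_def by (auto intro!: image_eqI[of _ _ "cinv c' x"])
    qed (use x ov(1) in auto)
  qed
  ultimately have U: "cimage c' \<subseteq> \<Union>{W, overlap c' c}" "\<And>S. S \<in> {W, overlap c' c} \<Longrightarrow> Ck_on (Suc 0) ?f S"
    by blast+
  have "Ck_on (Suc 0) ?f (\<Union>{W, overlap c' c})"
    by (rule Ck_on_open_Union[OF _ U(2)]) (use oW oO in auto)
  then show "Ck_on (Suc 0) ?f (cimage c')"
    by (rule Ck_on_subset) (rule U(1))
qed

lemma C1_fun_sum:
  assumes "complex_manifold X A" "\<And>i. i \<in> I \<Longrightarrow> C1_fun A (\<rho> i)"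
  shows "C1_fun A (\<lambda>p. \<Sum>i\<in>I. \<rho> i p)"
  using assms(2) chart_bij(3)[OF complex_manifoldD(1)[OF assms(1)]]
  unfolding C1_fun_def by (auto intro!: Ck_on_sum simp del: Ck_on.simps)

lemma C1_fun_divide:
  assumes M: "complex_manifold X A" and "C1_fun A \<rho>" "C1_fun A \<sigma>" "\<And>p. p \<in> topspace X \<Longrightarrow> \<sigma> p \<noteq> 0"
  shows "C1_fun A (\<lambda>p. \<rho> p / \<sigma> p)"
  unfolding C1_fun_def divide_inverse
proof
  fix c assume c: "c \<in> A"
  note ch = complex_manifoldD(1)[OF M c]
  have "\<sigma> (cinv c x) \<noteq> 0" if "x \<in> cimage c" for x
    using assms(4) chart_bij(2)[OF ch] cinv_facts(3)[OF ch that] by blast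
  then have "Ck_on (Suc 0) (\<lambda>x. inverse (\<sigma> (cinv c x))) (cimage c)"
    by (intro Ck_on_compose[OF chart_bij(3)[OF ch] _ _ _ Ck_on_inverse])
       (use assms(3) c in \<open>auto simp: C1_fun_def open_Compl simp del: Ck_on.simps\<close>)
  then show "Ck_on (Suc 0) (\<lambda>x. \<rho> (cinv c x) * inverse (\<sigma> (cinv c x))) (cimage c)"
    using assms(2) c chart_bij(3)[OF ch]
    by (intro Ck_on_bilinear[OF bounded_bilinear_mult]) (auto simp: C1_fun_def simp del: Ck_on.simps)
qed

text \<open>By compactness finitely many balls in coordinate domains cover \<open>X\<close>; their bumps are divided by the sum.\<close>

lemma partition_of_unity:
  fixes X :: "'p topology" and A :: "('p, 'n::finite) chart set"
  assumes M: "complex_manifold X A" and comp: "compact_space X"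
  obtains I :: "nat set" and c a r and \<rho> :: "nat \<Rightarrow> 'p \<Rightarrow> real" where
    "finite I" "\<And>i. i \<in> I \<Longrightarrow> c i \<in> A \<and> r i > 0 \<and> cball (a i) (r i) \<subseteq> cimage (c i)"
    "\<And>i. i \<in> I \<Longrightarrow> C1_fun A (\<rho> i)" "\<And>i p. i \<in> I \<Longrightarrow> p \<in> topspace X \<Longrightarrow> \<rho> i p \<ge> 0"
    "\<And>i p. i \<in> I \<Longrightarrow> p \<in> topspace X \<Longrightarrow> \<rho> i p \<noteq> 0 \<Longrightarrow> p \<in> fst (c i) \<and> snd (c i) p \<in> cball (a i) (r i)"
    "\<And>p. p \<in> topspace X \<Longrightarrow> (\<Sum>i\<in>I. \<rho> i p) = 1"
proof -
  define T where "T = {(c, a, r). c \<in> A \<and> r > 0 \<and> cball a r \<subseteq> cimage c}"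
  define V where "V = (\<lambda>(c::('p,'n) chart, a, r). {p \<in> fst c. snd c p \<in> ball a r})"
  have op: "openin X (V t)" if "t \<in> T" for t
    using that chart_open_vimage[OF complex_manifoldD(1)[OF M] open_ball] by (auto simp: T_def V_def)
  have cover: "topspace X \<subseteq> \<Union>(V ` T)"
  proof
    fix p assume "p \<in> topspace X"
    then obtain c where c: "c \<in> A" "p \<in> fst c" using complex_manifoldD(2)[OF M] by blast
    note ch = complex_manifoldD(1)[OF M c(1)]
    obtain r where "r > 0" "cball (snd c p) r \<subseteq> cimage c"
      using chart_bij(3)[OF ch] cinv_facts(2)[OF ch c(2)] open_contains_cball by blast
    then have "(c, snd c p, r) \<in> T" "p \<in> V (c, snd c p, r)" using c by (auto simp: T_def V_def)
    then show "p \<in> \<Union>(V ` T)" by blast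
  qed
  obtain F where F: "finite F" "F \<subseteq> V ` T" "topspace X \<subseteq> \<Union>F"
    using comp[unfolded compact_space_def compactin_def, THEN conjunct2, rule_format, of "V ` T"] op cover by auto
  obtain T' where T': "finite T'" "T' \<subseteq> T" "F = V ` T'" using finite_subset_image[OF F(1,2)] by blast
  obtain f and N :: nat where f: "bij_betw f {..<N} T'"
    using ex_bij_betw_nat_finite[OF T'(1)] by (metis atLeast0LessThan)
  define c where "c i = fst (f i)" for i
  define a where "a i = fst (snd (f i))" for i
  define r where "r i = snd (snd (f i))" for i
  define bf where "bf i = bump (c i) (a i) (r i)" for i
  define \<sigma> where "\<sigma> p = (\<Sum>i<N. bf i p)" for p
  have I: "c i \<in> A \<and> r i > 0 \<and> cball (a i) (r i) \<subseteq> cimage (c i)" if "i \<in> {..<N}" for i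
  proof -
    have "f i \<in> T" using f T'(2) that by (auto simp: bij_betw_def)
    then show ?thesis by (auto simp: T_def c_def a_def r_def split: prod.splits)
  qed
  have bf: "C1_fun A (bf i)" if "i \<in> {..<N}" for i
    unfolding bf_def using I[OF that] by (intro C1_fun_bump[OF M]) auto
  have bf_nonneg: "bf i p \<ge> 0" if "i \<in> {..<N}" for i p by (simp add: bf_def bump_def)
  have \<sigma>: "\<sigma> p > 0" if "p \<in> topspace X" for p
  proof -
    have "p \<in> \<Union>F" using F(3) that by blast
    then obtain t where t: "t \<in> T'" "p \<in> V t" unfolding T'(3) by blast
    obtain i where i: "i < N" "t = f i" using f t(1) by (auto simp: bij_betw_def)
    have "bf i p > 0"
      unfolding bf_def using t(2) i I[of i] by (subst bump_pos_iff) (auto simp: V_def c_def a_def r_def dist_norm norm_minus_commute split: prod.splits)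
    then show ?thesis unfolding \<sigma>_def using i bf_nonneg by (intro sum_pos2[of _ i]) auto
  qed
  show ?thesis
  proof (rule that[of "{..<N}" c r a "\<lambda>i p. bf i p / \<sigma> p"])
    show "C1_fun A (\<lambda>p. bf i p / \<sigma> p)" if "i \<in> {..<N}" for i
      unfolding \<sigma>_def using \<sigma>[unfolded \<sigma>_def] bf that by (intro C1_fun_divide[OF M] C1_fun_sum[OF M]) (auto simp: less_imp_neq[THEN not_sym])
    show "bf i p / \<sigma> p \<ge> 0" if "i \<in> {..<N}" "p \<in> topspace X" for i p
      using bf_nonneg[OF that(1)] \<sigma>[OF that(2)] by simp
    show "p \<in> fst (c i) \<and> snd (c i) p \<in> cball (a i) (r i)" if "i \<in> {..<N}" "p \<in> topspace X" "bf i p / \<sigma> p \<noteq> 0" for i p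
    proof -
      have "bf i p > 0" using bf_nonneg[OF that(1), of p] that(3) by (cases "bf i p = 0") auto
      then show ?thesis unfolding bf_def using I[OF that(1)] by (subst (asm) bump_pos_iff) (auto simp: dist_norm norm_minus_commute)
    qed
    show "(\<Sum>i<N. bf i p / \<sigma> p) = 1" if "p \<in> topspace X" for p
      using \<sigma>[OF that] by (simp add: sum_divide_distrib[symmetric]) (simp add: \<sigma>_def)
  qed (use I in auto)
qed

section \<open>Integration over a compact manifold\<close>

text \<open>A version of Stokes' theorem. The density \<open>\<rho> E + B \<rho>\<close> stands for the divergence of \<open>\<rho>\<close> times a fixed vector
  field whose own divergence is \<open>E\<close>; it integrates to zero if \<open>\<rho>\<close> is supported in a coordinate domain. For a
  partition of unity the terms \<open>B \<rho>\<^sub>j\<close> add up to zero, so \<open>E\<close> is the sum of the functions \<open>G\<^sub>j = \<rho>\<^sub>j E + B \<rho>\<^sub>j\<close>. The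
  integral of \<open>\<rho>\<^sub>i G\<^sub>j\<close> may be taken in chart \<open>i\<close> or in chart \<open>j\<close>, and summing over \<open>i\<close> in chart \<open>j\<close> gives the integral
  of \<open>G\<^sub>j\<close>, which is zero. So the integral of \<open>E\<close> over \<open>X\<close>, understood as the sum of those of \<open>\<rho>\<^sub>i E\<close>, vanishes.\<close>

lemma nonneg_divergence_eq_0:
  fixes X :: "'p topology" and A :: "('p, 'n::finite) chart set" and \<mu> :: "('p, 'n) chart \<Rightarrow> complex^'n \<Rightarrow> real"
  assumes M: "complex_manifold X A" and comp: "compact_space X"
    and mu: "\<And>c. c \<in> A \<Longrightarrow> continuous_on (cimage c) (\<mu> c)" "\<And>c x. c \<in> A \<Longrightarrow> x \<in> cimage c \<Longrightarrow> \<mu> c x > 0"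
    and mu_trans: "\<And>c c' x. c \<in> A \<Longrightarrow> c' \<in> A \<Longrightarrow> x \<in> overlap c c' \<Longrightarrow>
       \<mu> c x = \<bar>det (rmat (frechet_derivative (transition c c') (at x)))\<bar> * \<mu> c' (transition c c' x)"
    and E: "\<And>p. p \<in> topspace X \<Longrightarrow> E p \<ge> 0" "\<And>c. c \<in> A \<Longrightarrow> continuous_on (cimage c) (\<lambda>x. E (cinv c x))"
    and B_cont: "\<And>\<rho> c. C1_fun A \<rho> \<Longrightarrow> c \<in> A \<Longrightarrow> continuous_on (cimage c) (\<lambda>x. B \<rho> (cinv c x))"
    and B_sum: "\<And>(I::nat set) \<rho> p. finite I \<Longrightarrow> (\<And>i. i \<in> I \<Longrightarrow> C1_fun A (\<rho> i)) \<Longrightarrow> p \<in> topspace X \<Longrightarrow>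
       B (\<lambda>p. \<Sum>i\<in>I. \<rho> i p) p = (\<Sum>i\<in>I. B (\<rho> i) p)"
    and B_const: "\<And>\<rho> p. C1_fun A \<rho> \<Longrightarrow> (\<And>q. q \<in> topspace X \<Longrightarrow> \<rho> q = 1) \<Longrightarrow> p \<in> topspace X \<Longrightarrow> B \<rho> p = 0"
    and B_local: "\<And>\<rho> c x U. C1_fun A \<rho> \<Longrightarrow> c \<in> A \<Longrightarrow> open U \<Longrightarrow> x \<in> U \<Longrightarrow> U \<subseteq> cimage c \<Longrightarrow>
       (\<And>y. y \<in> U \<Longrightarrow> \<rho> (cinv c y) = 0) \<Longrightarrow> B \<rho> (cinv c x) = 0"
    and stokes: "\<And>\<rho> c K. C1_fun A \<rho> \<Longrightarrow> c \<in> A \<Longrightarrow> compact K \<Longrightarrow> K \<subseteq> cimage c \<Longrightarrow>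
       (\<And>p. p \<in> topspace X \<Longrightarrow> \<rho> p \<noteq> 0 \<Longrightarrow> p \<in> fst c \<and> snd c p \<in> K) \<Longrightarrow>
       cint (cimage c) (\<lambda>x. \<mu> c x * (\<rho> (cinv c x) * E (cinv c x) + B \<rho> (cinv c x))) = 0"
    and p: "p \<in> topspace X"
  shows "E p = 0"
proof -
  obtain I :: "nat set" and c a r and \<rho> :: "nat \<Rightarrow> 'p \<Rightarrow> real" where
    I: "finite I" and cr: "\<And>i. i \<in> I \<Longrightarrow> c i \<in> A \<and> r i > 0 \<and> cball (a i) (r i) \<subseteq> cimage (c i)"
    and C1: "\<And>i. i \<in> I \<Longrightarrow> C1_fun A (\<rho> i)" and pos: "\<And>i p. i \<in> I \<Longrightarrow> p \<in> topspace X \<Longrightarrow> \<rho> i p \<ge> 0"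
    and supp: "\<And>i p. i \<in> I \<Longrightarrow> p \<in> topspace X \<Longrightarrow> \<rho> i p \<noteq> 0 \<Longrightarrow> p \<in> fst (c i) \<and> snd (c i) p \<in> cball (a i) (r i)"
    and one: "\<And>p. p \<in> topspace X \<Longrightarrow> (\<Sum>i\<in>I. \<rho> i p) = 1"
    by (rule partition_of_unity[OF M comp], rule that) (assumption | simp only:)+
  have c: "\<And>i. i \<in> I \<Longrightarrow> c i \<in> A" and r: "\<And>i. i \<in> I \<Longrightarrow> cball (a i) (r i) \<subseteq> cimage (c i)"
    using cr by blast+
  define G where "G i p = \<rho> i p * E p + B (\<rho> i) p" for i p
  define Q where "Q i = {p \<in> fst (c i). snd (c i) p \<in> cball (a i) (r i)}" for i
  note ch = complex_manifoldD(1)[OF M]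
  note chc = ch[OF c]
  have inX: "cinv d x \<in> topspace X" if "d \<in> A" "x \<in> cimage d" for d x
    using cinv_facts(3)[OF ch[OF that(1)] that(2)] chart_bij(2)[OF ch[OF that(1)]] by blast
  have Qc: "compactin X (Q i)" if "i \<in> I" for i
    unfolding Q_def by (rule chart_compact_cinv[OF chc[OF that] compact_cball r[OF that]])
  have Qcl: "closedin X (Q i)" if "i \<in> I" for i
    using compactin_imp_closedin[OF complex_manifoldD(3)[OF M] Qc[OF that]] .
  have rho_Q: "\<rho> i p = 0" if "i \<in> I" "p \<in> topspace X" "p \<notin> Q i" for i p
    using supp[OF that(1,2)] that(3) by (auto simp: Q_def)
  have B_Q: "B (\<rho> i) q = 0" if i: "i \<in> I" and q: "q \<in> topspace X" "q \<notin> Q i" for i q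
  proof -
    obtain d where d: "d \<in> A" "q \<in> fst d" using complex_manifoldD(2)[OF M q(1)] by blast
    define U where "U = snd d ` ((topspace X - Q i) \<inter> fst d)"
    have "open U" unfolding U_def using Qcl[OF i] by (intro chart_open_image[OF ch[OF d(1)]]) blast
    have "B (\<rho> i) (cinv d (snd d q)) = 0"
    proof (rule B_local[OF C1[OF i] d(1) \<open>open U\<close>])
      show "snd d q \<in> U" unfolding U_def using q d by auto
      show "U \<subseteq> cimage d" unfolding U_def cimage_def by auto
      show "\<rho> i (cinv d y) = 0" if "y \<in> U" for y
        using that rho_Q[OF i] cinv_facts(1)[OF ch[OF d(1)]] unfolding U_def by auto
    qed
    then show ?thesis using cinv_facts(1)[OF ch[OF d(1)] d(2)] by simp
  qed
  have G_Q: "G i q = 0" if "i \<in> I" "q \<in> topspace X" "q \<notin> Q i" for i q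
    using rho_Q[OF that] B_Q[OF that] by (simp add: G_def)
  have cont_\<rho>: "continuous_on (cimage d) (\<lambda>x. \<rho> i (cinv d x))" if "i \<in> I" "d \<in> A" for i d
    using C1[OF that(1)] that(2) Ck_on_imp_continuous_on unfolding C1_fun_def by blast
  have cont_G: "continuous_on (cimage d) (\<lambda>x. G i (cinv d x))" if "i \<in> I" "d \<in> A" for i d
    unfolding G_def by (intro continuous_intros cont_\<rho> that E(2) B_cont C1)
  have inQ: "cinv (c i) x \<in> Q i \<longleftrightarrow> x \<in> cball (a i) (r i)" if "i \<in> I" "x \<in> cimage (c i)" for i x
    using cinv_facts(3,4)[OF chc[OF that(1)] that(2)] by (simp add: Q_def)
  have cc: "cc_on (cimage (c i)) (\<lambda>x. \<mu> (c i) x * f (cinv (c i) x))"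
    if i: "i \<in> I" and f: "continuous_on (cimage (c i)) (\<lambda>x. f (cinv (c i) x))" "\<And>p. p \<in> topspace X \<Longrightarrow> p \<notin> Q i \<Longrightarrow> f p = 0" for i f
    unfolding cc_on_def
  proof (intro conjI exI[of _ "cball (a i) (r i)"] ballI)
    show "continuous_on (cimage (c i)) (\<lambda>x. \<mu> (c i) x * f (cinv (c i) x))"
      by (intro continuous_intros mu(1) c i f(1))
    show "\<mu> (c i) x * f (cinv (c i) x) = 0" if "x \<in> cimage (c i) - cball (a i) (r i)" for x
      using f(2)[OF inX[OF c[OF i]]] inQ[OF i] that by auto
  qed (use r i chart_bij(3)[OF chc] in auto)
  have chg: "cint (cimage (c i)) (\<lambda>x. \<mu> (c i) x * (\<rho> i (cinv (c i) x) * G j (cinv (c i) x)))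
      = cint (cimage (c j)) (\<lambda>x. \<mu> (c j) x * (\<rho> i (cinv (c j) x) * G j (cinv (c j) x)))" if i: "i \<in> I" and j: "j \<in> I" for i j
  proof -
    let ?t = "transition (c i) (c j)"
    let ?f = "\<lambda>d x. \<mu> d x * (\<rho> i (cinv d x) * G j (cinv d x))"
    note ov = overlap_facts[OF chc[OF i] chc[OF j]] and ov' = overlap_facts[OF chc[OF j] chc[OF i]]
    have "cint (cimage (c i)) (?f (c i)) = cint (overlap (c i) (c j)) (?f (c i))"
    proof (rule cint_subset[symmetric])
      show "overlap (c i) (c j) \<subseteq> cimage (c i)" using ov(5) by blast
      fix x assume x: "x \<in> cimage (c i) - overlap (c i) (c j)"
      then have "cinv (c i) x \<notin> Q j" unfolding ov(1) Q_def by auto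
      then show "?f (c i) x = 0" using G_Q[OF j inX[OF c[OF i]]] x by auto
    qed
    also have "\<dots> = cint (overlap (c j) (c i)) (?f (c j))"
    proof (rule cint_change_of_variables[OF open_overlap[OF chc[OF i] chc[OF j]] _ ov(7,8)])
      show "?t differentiable (at x)" if "x \<in> overlap (c i) (c j)" for x
        using complex_manifoldD(4)[OF M c[OF i] c[OF j]] smooth_map_onD(1) that unfolding holomorphic_map_on_def by blast
      show "cc_on (overlap (c j) (c i)) (?f (c j))"
        unfolding cc_on_def
      proof (intro conjI exI[of _ "snd (c j) ` (Q i \<inter> Q j)"] ballI)
        show "open (overlap (c j) (c i))" by (rule open_overlap[OF chc[OF j] chc[OF i]])
        have "continuous_on (cimage (c j)) (?f (c j))"
          by (intro continuous_intros mu(1) c j cont_\<rho> i cont_G)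
        then show "continuous_on (overlap (c j) (c i)) (?f (c j))"
          by (rule continuous_on_subset) (use ov'(5) in blast)
        have "compactin X (Q i \<inter> Q j)" using closed_Int_compactin[OF Qcl[OF i] Qc[OF j]] .
        then show "compact (snd (c j) ` (Q i \<inter> Q j))"
          by (rule chart_compact_image[OF chc[OF j]]) (auto simp: Q_def)
        show "snd (c j) ` (Q i \<inter> Q j) \<subseteq> overlap (c j) (c i)" by (auto simp: Q_def overlap_def)
        fix x assume x: "x \<in> overlap (c j) (c i) - snd (c j) ` (Q i \<inter> Q j)"
        then have "x \<in> cimage (c j)" using ov'(5) by blast
        then have "cinv (c j) x \<notin> Q i \<inter> Q j" using x cinv_facts(4)[OF chc[OF j]] by (metis DiffD2 image_eqI)
        then show "?f (c j) x = 0"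
          using rho_Q[OF i inX[OF c[OF j]]] G_Q[OF j inX[OF c[OF j]]] \<open>x \<in> cimage (c j)\<close> by auto
      qed
      show "?f (c i) x = \<bar>det (rmat (frechet_derivative ?t (at x)))\<bar> * ?f (c j) (?t x)" if "x \<in> overlap (c i) (c j)" for x
        using mu_trans[OF c[OF i] c[OF j] that] ov(4)[OF that] by simp
    qed
    also have "\<dots> = cint (cimage (c j)) (?f (c j))"
    proof (rule cint_subset)
      show "overlap (c j) (c i) \<subseteq> cimage (c j)" using ov'(5) by blast
      fix x assume x: "x \<in> cimage (c j) - overlap (c j) (c i)"
      then have "cinv (c j) x \<notin> Q i" unfolding ov'(1) Q_def by auto
      then show "?f (c j) x = 0" using rho_Q[OF i inX[OF c[OF j]]] x by auto
    qed
    finally show ?thesis .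
  qed
  have E_sum: "E q = (\<Sum>j\<in>I. G j q)" if q: "q \<in> topspace X" for q
  proof -
    have "C1_fun A (\<lambda>p. \<Sum>i\<in>I. \<rho> i p)" by (rule C1_fun_sum[OF M C1])
    then have "(\<Sum>j\<in>I. B (\<rho> j) q) = 0"
      using B_sum[OF I C1 q] B_const[OF _ _ q, of "\<lambda>p. \<Sum>i\<in>I. \<rho> i p"] one by simp
    then show ?thesis using one[OF q] by (simp add: G_def sum.distrib sum_distrib_right[symmetric])
  qed
  have "(\<Sum>i\<in>I. cint (cimage (c i)) (\<lambda>x. \<mu> (c i) x * (\<rho> i (cinv (c i) x) * E (cinv (c i) x))))
     = (\<Sum>i\<in>I. \<Sum>j\<in>I. cint (cimage (c i)) (\<lambda>x. \<mu> (c i) x * (\<rho> i (cinv (c i) x) * G j (cinv (c i) x))))"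
  proof (rule sum.cong[OF refl])
    fix i assume i: "i \<in> I"
    have "cint (cimage (c i)) (\<lambda>x. \<mu> (c i) x * (\<rho> i (cinv (c i) x) * E (cinv (c i) x)))
       = cint (cimage (c i)) (\<lambda>x. \<Sum>j\<in>I. \<mu> (c i) x * (\<rho> i (cinv (c i) x) * G j (cinv (c i) x)))"
      by (rule cint_cong) (simp add: E_sum[OF inX[OF c[OF i]]] sum_distrib_left)
    also have "\<dots> = (\<Sum>j\<in>I. cint (cimage (c i)) (\<lambda>x. \<mu> (c i) x * (\<rho> i (cinv (c i) x) * G j (cinv (c i) x))))"
      by (rule cint_sum[OF I], rule cc[OF i, of "\<lambda>p. \<rho> i p * G _ p"])
         (auto intro!: continuous_intros cont_\<rho> cont_G c i simp: rho_Q[OF i])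
    finally show "cint (cimage (c i)) (\<lambda>x. \<mu> (c i) x * (\<rho> i (cinv (c i) x) * E (cinv (c i) x)))
       = (\<Sum>j\<in>I. cint (cimage (c i)) (\<lambda>x. \<mu> (c i) x * (\<rho> i (cinv (c i) x) * G j (cinv (c i) x))))" .
  qed
  also have "\<dots> = (\<Sum>j\<in>I. \<Sum>i\<in>I. cint (cimage (c j)) (\<lambda>x. \<mu> (c j) x * (\<rho> i (cinv (c j) x) * G j (cinv (c j) x))))"
    by (subst sum.swap) (simp add: chg)
  also have "\<dots> = (\<Sum>j\<in>I. 0)"
  proof (rule sum.cong[OF refl])
    fix j assume j: "j \<in> I"
    have "(\<Sum>i\<in>I. cint (cimage (c j)) (\<lambda>x. \<mu> (c j) x * (\<rho> i (cinv (c j) x) * G j (cinv (c j) x))))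
       = cint (cimage (c j)) (\<lambda>x. \<Sum>i\<in>I. \<mu> (c j) x * (\<rho> i (cinv (c j) x) * G j (cinv (c j) x)))"
      by (rule cint_sum[OF I, symmetric], rule cc[OF j, of "\<lambda>p. \<rho> _ p * G j p"])
         (auto intro!: continuous_intros cont_\<rho> cont_G c j simp: G_Q[OF j])
    also have "\<dots> = cint (cimage (c j)) (\<lambda>x. \<mu> (c j) x * G j (cinv (c j) x))"
      by (rule cint_cong)
         (simp add: sum_distrib_left[symmetric] sum_distrib_right[symmetric] one[OF inX[OF c[OF j]]])
    also have "\<dots> = 0"
      unfolding G_def by (rule stokes[OF C1[OF j] c[OF j] compact_cball r[OF j] supp[OF j]])
    finally show "(\<Sum>i\<in>I. cint (cimage (c j)) (\<lambda>x. \<mu> (c j) x * (\<rho> i (cinv (c j) x) * G j (cinv (c j) x)))) = 0" .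
  qed
  finally have total: "(\<Sum>i\<in>I. cint (cimage (c i)) (\<lambda>x. \<mu> (c i) x * (\<rho> i (cinv (c i) x) * E (cinv (c i) x)))) = 0" by simp
  have nonneg: "\<mu> (c i) x * (\<rho> i (cinv (c i) x) * E (cinv (c i) x)) \<ge> 0" if "i \<in> I" "x \<in> cimage (c i)" for i x
    using mu(2)[OF c[OF that(1)] that(2)] pos[OF that(1) inX[OF c[OF that(1)] that(2)]] E(1)[OF inX[OF c[OF that(1)] that(2)]] by simp
  have ccE: "cc_on (cimage (c i)) (\<lambda>x. \<mu> (c i) x * (\<rho> i (cinv (c i) x) * E (cinv (c i) x)))" if "i \<in> I" for i
    by (rule cc[OF that, of "\<lambda>p. \<rho> i p * E p"]) (auto intro!: continuous_intros cont_\<rho> E(2) c that simp: rho_Q[OF that])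
  have "cint (cimage (c i)) (\<lambda>x. \<mu> (c i) x * (\<rho> i (cinv (c i) x) * E (cinv (c i) x))) = 0" if "i \<in> I" for i
  proof -
    have "cint (cimage (c i)) (\<lambda>x. \<mu> (c i) x * (\<rho> i (cinv (c i) x) * E (cinv (c i) x))) \<ge> 0" if "i \<in> I" for i
      unfolding cint_def
      by (rule integral_nonneg[OF set_lebesgue_integral_eq_integral(1)[OF cc_on_absolutely_integrable[OF ccE[OF that]]]])
         (use nonneg[OF that] in auto)
    then show ?thesis using total that I by (simp add: sum_nonneg_eq_0_iff)
  qed
  note each = this
  obtain i where i: "i \<in> I" "\<rho> i p \<noteq> 0" using one[OF p] by (metis sum.neutral zero_neq_one)
  have pi: "p \<in> fst (c i)" using supp[OF i(1) p i(2)] by blast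
  have "\<mu> (c i) (snd (c i) p) * (\<rho> i (cinv (c i) (snd (c i) p)) * E (cinv (c i) (snd (c i) p))) = 0"
    using cint_eq_0_imp[OF ccE[OF i(1)] nonneg[OF i(1)] each[OF i(1)]] cinv_facts(2)[OF chc[OF i(1)] pi] by blast
  then show ?thesis
    using mu(2)[OF c[OF i(1)] cinv_facts(2)[OF chc[OF i(1)] pi]] i(2) cinv_facts(1)[OF chc[OF i(1)] pi] by simp
qed

section \<open>The Riemannian volume density\<close>

lemma rmat_entry: "rmat L $ a $ b = cpx (axis a 1) \<bullet> L (cpx (axis b 1))"
proof -
  have "rmat L $ a $ b = axis a 1 \<bullet> rl (L (cpx (axis b 1)))"
    by (simp add: rmat_def matrix_def inner_axis')
  also have "\<dots> = cpx (axis a 1) \<bullet> cpx (rl (L (cpx (axis b 1))))" by (simp only: inner_cpx)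
  finally show ?thesis by simp
qed

lemma linear_rmat_arg: "linear L \<Longrightarrow> linear (\<lambda>y. rl (L (cpx y)))"
  using linear_compose[OF linear_compose[OF cpx(1)] linear_rl, of L] by (simp add: o_def)

lemma rmat_mult:
  assumes "linear L" "linear L'"
  shows "rmat (\<lambda>v. L (L' v)) = rmat L ** rmat L'"
proof -
  have "rmat (\<lambda>v. L (L' v)) = matrix ((\<lambda>y. rl (L (cpx y))) \<circ> (\<lambda>y. rl (L' (cpx y))))"
    by (simp add: rmat_def o_def)
  then show ?thesis
    by (simp add: matrix_compose[OF linear_rmat_arg[OF assms(2)] linear_rmat_arg[OF assms(1)]] rmat_def)
qed

lemma rmat_id: "rmat (\<lambda>v. v) = mat 1"
  by (simp add: rmat_def matrix_id_mat_1[unfolded id_def])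

lemma linear_matrix_complex: "linear (\<lambda>v. A *v v)" for A :: "complex^'n^'n"
  by (rule linearI) (simp_all add: matrix_vector_mult_def vec_eq_iff algebra_simps sum.distrib scaleR_sum_right)

lemma trace_rmat:
  assumes "linear L"
  shows "trace (rmat L) = (\<Sum>b\<in>Basis. b \<bullet> L b)"
proof -
  let ?c = "\<lambda>a. cpx (axis a 1)"
  have "trace (rmat L) = (\<Sum>a\<in>UNIV. ?c a \<bullet> L (?c a))" by (simp add: trace_def rmat_entry)
  also have "\<dots> = (\<Sum>a\<in>UNIV. \<Sum>b\<in>Basis. b \<bullet> L ((?c a \<bullet> b) *\<^sub>R ?c a))"
    by (subst euclidean_inner) (simp add: linear_scale[OF assms] inner_commute mult.commute)
  also have "\<dots> = (\<Sum>b\<in>Basis. b \<bullet> L (\<Sum>a\<in>UNIV. (?c a \<bullet> b) *\<^sub>R ?c a))"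
    by (subst sum.swap) (simp add: linear_sum[OF assms] inner_sum_right)
  also have "\<dots> = (\<Sum>b\<in>Basis. b \<bullet> L b)"
  proof (rule sum.cong[OF refl])
    fix b :: "complex^'a"
    have "(\<Sum>a\<in>UNIV. (?c a \<bullet> b) *\<^sub>R ?c a) = (\<Sum>a\<in>UNIV. (?c a \<bullet> cpx (rl b)) *\<^sub>R ?c a)" by simp
    also have "\<dots> = cpx (\<Sum>a\<in>UNIV. (rl b $ a) *\<^sub>R axis a 1)"
      by (simp only: inner_cpx linear_sum[OF cpx(1)] linear_scale[OF cpx(1)]) (simp add: inner_axis')
    also have "(\<Sum>a\<in>UNIV. (rl b $ a) *\<^sub>R axis a 1) = rl b"
      using basis_expansion[of "rl b"] by (simp add: scalar_mult_eq_scaleR)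
    finally show "b \<bullet> L (\<Sum>a\<in>UNIV. (?c a \<bullet> b) *\<^sub>R ?c a) = b \<bullet> L b" by simp
  qed
  finally show ?thesis .
qed

lemma trace_rmat_complex:
  fixes A :: "complex^'n^'n"
  shows "trace (rmat (\<lambda>v. A *v v)) = 2 * Re (trace A)"
proof -
  have B: "(Basis :: (complex^'n) set) = (\<lambda>(i, u). axis i u) ` (UNIV \<times> {1, \<i>})"
    by (auto simp: Basis_vec_def Basis_complex_def)
  have inj: "inj_on (\<lambda>(i, u). axis i u :: complex^'n) (UNIV \<times> {1, \<i>})"
    by (auto simp: inj_on_def axis_eq_axis)
  have e: "axis i u \<bullet> (A *v axis i u) = Re (A $ i $ i * u * cnj u)" for i u
  proof -
    have "(A *v axis i u) $ i = A $ i $ i * u"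
      by (simp add: matrix_vector_mult_def axis_def if_distrib[of "\<lambda>x. _ * x"] cong: if_cong)
    then show ?thesis
      by (simp add: inner_commute[of "axis i u"] inner_axis inner_complex_def algebra_simps)
  qed
  have "trace (rmat (\<lambda>v. A *v v)) = (\<Sum>i\<in>UNIV. \<Sum>u\<in>{1, \<i>}. axis i u \<bullet> (A *v axis i u))"
    unfolding trace_rmat[OF linear_matrix_complex] B sum.reindex[OF inj] sum.cartesian_product
    by (simp add: o_def split_beta)
  also have "\<dots> = 2 * Re (trace A)"
    by (simp add: e trace_def sum_distrib_left)
  finally show ?thesis .
qed

lemma inner_complex_vec: "w \<bullet> z = Re (\<Sum>j\<in>UNIV. z $ j * cnj (w $ j))" for w z :: "complex^'n"
  by (simp add: inner_vec_def inner_complex_def algebra_simps)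

lemma Re_sesq: "Re (sesq M v w) = w \<bullet> (transpose M *v v)"
proof -
  have "sesq M v w = (\<Sum>j\<in>UNIV. (transpose M *v v) $ j * cnj (w $ j))"
    unfolding sesq_def by (subst sum.swap) (simp add: matrix_vector_mult_def transpose_def sum_distrib_right del: transpose_matrix_vector)
  then show ?thesis unfolding inner_complex_vec by simp
qed

definition gram :: "complex^'n^'n \<Rightarrow> real^('n::finite bit0)^('n bit0)" where
  "gram M = rmat (\<lambda>v. transpose M *v v)"

text \<open>The square root of the absolute value of the determinant of the Gram matrix; the square inside the logarithm
  makes this expression smooth whatever the sign of the determinant. Its logarithmic derivative is the trace of
  \<open>M\<^sup>-\<^sup>1 dM\<close>, as for \<open>det M\<close>, and it transforms by the real Jacobian, which is what the change of variables
  formula produces.\<close>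

definition vdens :: "complex^'n::finite^'n \<Rightarrow> real" where
  "vdens M = exp (1/4 * ln ((det (gram M))\<^sup>2))"

lemma vdens_pos: "vdens M > 0"
  by (simp add: vdens_def)

lemma gram_entry: "gram M $ a $ b = Re (sesq M (cpx (axis b 1)) (cpx (axis a 1)))"
  by (simp only: gram_def rmat_entry Re_sesq)

lemma gram_inverse:
  assumes "invertible M"
  shows "rmat (\<lambda>v. transpose (matrix_inv M) *v v) ** gram M = mat 1" "det (gram M) \<noteq> 0"
proof -
  have "transpose (matrix_inv M) ** transpose M = mat 1"
    unfolding matrix_transpose_mul[symmetric] matrix_inv_works[OF assms] by (rule transpose_mat)
  then show 1: "rmat (\<lambda>v. transpose (matrix_inv M) *v v) ** gram M = mat 1"
    unfolding gram_def
    by (simp add: rmat_mult[OF linear_matrix_complex linear_matrix_complex, symmetric] matrix_vector_mul_assoc rmat_id del: transpose_matrix_vector)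
  show "det (gram M) \<noteq> 0"
    using arg_cong[OF 1, of det] by (auto simp: det_mul)
qed

lemma vdens_transform:
  fixes J :: "complex^'n::finite \<Rightarrow> complex^'n"
  assumes J: "linear J" and M: "\<And>v w. sesq M v w = sesq M' (J v) (J w)"
    and inv: "invertible M" "invertible M'"
  shows "vdens M = \<bar>det (rmat J)\<bar> * vdens M'"
proof -
  have app: "rmat L *v y = rl (L (cpx y))" if "linear L" for L :: "complex^'n \<Rightarrow> complex^'n" and y
    unfolding rmat_def using matrix_works[of "\<lambda>y. rl (L (cpx y))"] linear_rmat_arg[OF that] by (simp add: linear_def scalar_mult_eq_scaleR[abs_def])
  have rl_inner: "rl x \<bullet> rl y = x \<bullet> y" for x y :: "complex^'n"
    using inner_cpx[of "rl x" "rl y"] by simp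
  have entry: "Z $ a $ b = axis a 1 \<bullet> (Z *v axis b 1)" for Z :: "real^('n bit0)^('n bit0)" and a b
    by (simp add: inner_axis' matrix_vector_mult_basis column_def)
  have "gram M $ a $ b = (transpose (rmat J) ** gram M' ** rmat J) $ a $ b" for a b
  proof -
    have "(transpose (rmat J) ** gram M' ** rmat J) $ a $ b
       = axis a 1 \<bullet> (transpose (rmat J) *v (gram M' *v (rmat J *v axis b 1)))"
      unfolding entry[of "transpose (rmat J) ** gram M' ** rmat J"] by (simp only: matrix_vector_mul_assoc matrix_mul_assoc)
    also have "\<dots> = (rmat J *v axis a 1) \<bullet> (gram M' *v (rmat J *v axis b 1))"
      by (simp only: transpose_matrix_vector) (metis dot_lmul_matrix inner_commute)
    also have "\<dots> = J (cpx (axis a 1)) \<bullet> (transpose M' *v J (cpx (axis b 1)))"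
      unfolding gram_def app[OF J] app[OF linear_matrix_complex] rl_inner rl_cpx ..
    also have "\<dots> = gram M $ a $ b"
      by (simp only: gram_entry M Re_sesq)
    finally show ?thesis by simp
  qed
  then have "gram M = transpose (rmat J) ** gram M' ** rmat J" by (simp add: vec_eq_iff)
  then have d: "det (gram M) = (det (rmat J))\<^sup>2 * det (gram M')"
    by (simp add: det_mul det_transpose power2_eq_square)
  have nz: "det (rmat J) \<noteq> 0" "det (gram M') \<noteq> 0" using gram_inverse(2)[OF inv(1)] gram_inverse(2)[OF inv(2)] d by auto
  have "ln ((det (gram M))\<^sup>2) = 4 * ln \<bar>det (rmat J)\<bar> + ln ((det (gram M'))\<^sup>2)"
  proof -
    have "(det (gram M))\<^sup>2 = \<bar>det (rmat J)\<bar> ^ 4 * (det (gram M'))\<^sup>2"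
      unfolding d by (simp add: power_mult_distrib power2_eq_square power4_eq_xxxx)
    moreover have "ln (\<bar>det (rmat J)\<bar> ^ 4 * (det (gram M'))\<^sup>2) = ln (\<bar>det (rmat J)\<bar> ^ 4) + ln ((det (gram M'))\<^sup>2)"
      by (subst ln_mult) (use nz in simp_all)
    moreover have "ln (\<bar>det (rmat J)\<bar> ^ 4) = of_nat 4 * ln \<bar>det (rmat J)\<bar>"
      by (rule ln_realpow)
    ultimately show ?thesis by (simp only: of_nat_numeral)
  qed
  then show ?thesis using nz by (simp add: vdens_def ring_distribs exp_add)
qed

context metric_chart
begin

lemma smooth_vdens: "smooth_map_on (\<lambda>y. vdens (H y)) S"
  unfolding vdens_def power2_eq_square
  by (intro smooth_exp smooth_mult smooth_const smooth_ln smooth_det open_S)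
     (auto simp: gram_entry gram_inverse(2)[OF inv_H] not_square_less_zero less_le intro!: smooth_Re smooth_sesq open_S)

text \<open>Jacobi's formula for the real Gram matrix gives a real trace, which is twice the real part of the complex
  trace of \<open>M\<^sup>-\<^sup>1 dM\<close>.\<close>

lemma gd_vdens:
  assumes x: "x \<in> S"
  shows "gd a b (\<lambda>y. of_real (vdens (H y))) x v = of_real (vdens (H x)) * (\<Sum>k\<in>UNIV. \<Sum>l\<in>UNIV. hup (H x) k l * gd a b (\<lambda>y. H y $ k $ l) x v)"
proof -
  define dH where "dH v = (\<chi> k l. fun_d (\<lambda>y. H y $ k $ l) x v)" for v
  define s where "s v = (\<Sum>k\<in>UNIV. \<Sum>l\<in>UNIV. hup (H x) k l * fun_d (\<lambda>y. H y $ k $ l) x v)" for v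
  let ?D = "\<lambda>v. gram (dH v)"
  let ?B = "rmat (\<lambda>v. transpose (matrix_inv (H x)) *v v)"
  let ?d = "det (gram (H x))"
  have G: "((\<lambda>y. gram (H y) $ i $ j) has_derivative (\<lambda>v. ?D v $ i $ j)) (at x)" for i j
  proof -
    let ?u = "cpx (axis j 1)" and ?w = "cpx (axis i 1)"
    have "fun_d (\<lambda>y. sesq (H y) ?u ?w) x v = sesq (dH v) ?u ?w" for v
      unfolding dH_def fun_d_gd by (rule sesq_gd(1)[OF diff_entry[OF x]])
    then have "((\<lambda>y. sesq (H y) ?u ?w) has_derivative (\<lambda>v. sesq (dH v) ?u ?w)) (at x)"
      using fun_d_has_derivative[OF sesq_gd(2)[OF diff_entry[OF x]], of ?u ?w] by presburger
    then show ?thesis unfolding gram_entry by (rule has_derivative_Re)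
  qed
  have tr: "(\<Sum>i\<in>UNIV. \<Sum>j\<in>UNIV. ?B $ j $ i * ?D v $ i $ j) = 2 * Re (s v)" for v
  proof -
    have "(\<Sum>i\<in>UNIV. \<Sum>j\<in>UNIV. ?B $ j $ i * ?D v $ i $ j) = trace (?B ** ?D v)"
      unfolding trace_def matrix_matrix_mult_def by (subst sum.swap) simp
    also have "?B ** ?D v = rmat (\<lambda>w. (transpose (matrix_inv (H x)) ** transpose (dH v)) *v w)"
      unfolding gram_def rmat_mult[OF linear_matrix_complex linear_matrix_complex, symmetric] matrix_vector_mul_assoc ..
    also have "trace \<dots> = 2 * Re (trace (transpose (matrix_inv (H x)) ** transpose (dH v)))"
      by (rule trace_rmat_complex)
    also have "trace (transpose (matrix_inv (H x)) ** transpose (dH v)) = s v"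
      unfolding trace_def matrix_matrix_mult_def s_def by (simp add: transpose_def hup_def dH_def)
    finally show ?thesis .
  qed
  have real: "of_real (Re (s v)) = s v" for v
  proof -
    have e: "cnj (fun_d (\<lambda>y. H y $ k $ l) x v) = fun_d (\<lambda>y. H y $ l $ k) x v" for k l
    proof -
      have "cnj (fun_d (\<lambda>y. H y $ k $ l) x v) = fun_d (\<lambda>y. cnj (H y $ k $ l)) x v"
        using fun_d_cnj[OF diff_entry[OF x]] by simp
      also have "\<dots> = fun_d (\<lambda>y. H y $ l $ k) x v"
        unfolding fun_d_gd by (rule gd_cong[OF open_S x]) (rule hermitian_posdefD(1)[OF posdef])
      finally show ?thesis .
    qed
    have "cnj (s v) = (\<Sum>k\<in>UNIV. \<Sum>l\<in>UNIV. hup (H x) l k * fun_d (\<lambda>y. H y $ l $ k) x v)"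
      by (simp add: s_def e cnj_hup[OF posdef[OF x]])
    also have "\<dots> = s v" unfolding s_def by (rule sum.swap)
    finally show ?thesis by (simp add: complex_eq_iff)
  qed
  have nz: "?d \<noteq> 0" by (rule gram_inverse(2)[OF inv_H[OF x]])
  have sq: "0 < ?d * ?d" using nz not_real_square_gt_zero by blast
  have det: "((\<lambda>y. det (gram (H y))) has_derivative (\<lambda>v. ?d * (2 * Re (s v)))) (at x)"
    using has_derivative_det[OF G gram_inverse(1)[OF inv_H[OF x]]] unfolding tr .
  have "((\<lambda>t. exp (1/4 * ln (t\<^sup>2))) has_real_derivative vdens (H x) / (2 * ?d)) (at ?d)"
    unfolding vdens_def using nz sq by (auto intro!: derivative_eq_intros simp: field_simps power2_eq_square)
  from has_derivative_compose[OF det this[unfolded has_field_derivative_def]]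
  have "((\<lambda>y. vdens (H y)) has_derivative (\<lambda>v. vdens (H x) * Re (s v))) (at x)"
    using nz by (simp add: vdens_def)
  then have "((\<lambda>y. complex_of_real (vdens (H y))) has_derivative (\<lambda>v. of_real (vdens (H x) * Re (s v)))) (at x)"
    by (rule has_derivative_of_real)
  then have "fun_d (\<lambda>y. complex_of_real (vdens (H y))) x = (\<lambda>v. of_real (vdens (H x)) * s v)"
    by (simp add: fun_d_eqI real)
  then show ?thesis unfolding gd_def s_def
    by (simp add: algebra_simps sum.distrib sum_distrib_left)
qed

text \<open>The vector field dual to \<open>\<theta>\<close> times the volume density, so that its divergence in the coordinates is the
  Riemannian divergence. Below, \<open>energy\<close> is \<open>|\<theta>|\<^sup>2\<close>, and \<open>pairing \<rho>\<close> is the real part of the derivative of \<open>\<rho>\<close> along the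
  field.\<close>

definition flux :: "'n \<Rightarrow> complex^'n \<Rightarrow> complex" where
  "flux l y = of_real (vdens (H y)) * (\<Sum>k\<in>UNIV. hup (H y) k l * theta H y (axis k 1))"

definition energy :: "complex^'n \<Rightarrow> real" where
  "energy x = Re (\<Sum>k\<in>UNIV. \<Sum>l\<in>UNIV. hup (H x) k l * theta H x (axis k 1) * cnj (theta H x (axis l 1)))"

definition pairing :: "(complex^'n \<Rightarrow> real) \<Rightarrow> complex^'n \<Rightarrow> real" where
  "pairing \<rho> x = Re (\<Sum>k\<in>UNIV. \<Sum>l\<in>UNIV. hup (H x) k l * theta H x (axis k 1) * dzbar l (\<lambda>y. of_real (\<rho> y)) x)"

lemma smooth_flux: "smooth_map_on (flux l) S"
  unfolding flux_def[abs_def]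
  by (intro smooth_mult smooth_of_real smooth_sum smooth_vdens smooth_hup smooth_theta smooth_H inv_H open_S)

text \<open>The divergence of the vector field dual to \<open>\<theta>\<close>: differentiating the inverse metric and the density
  produces the trace of the torsion once more.\<close>

lemma divergence_flux:
  assumes x: "x \<in> S"
  shows "(\<Sum>l\<in>UNIV. dzbar l (flux l) x) = of_real (vdens (H x)) *
    ((\<Sum>k\<in>UNIV. \<Sum>l\<in>UNIV. hup (H x) k l * dzbar l (\<lambda>y. theta H y (axis k 1)) x) +
     (\<Sum>k\<in>UNIV. \<Sum>l\<in>UNIV. hup (H x) k l * theta H x (axis k 1) * cnj (theta H x (axis l 1))))"
proof -
  let ?m = "complex_of_real (vdens (H x))"
  define h where "h k l = hup (H x) k l" for k l
  define th where "th k = theta H x (axis k 1)" for k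
  define Hb where "Hb l p q = dzbar l (\<lambda>y. H y $ p $ q) x" for l p q
  define P where "P l = (\<Sum>p\<in>UNIV. \<Sum>q\<in>UNIV. h p q * Hb l p q)" for l
  have dm: "(\<lambda>y. complex_of_real (vdens (H y))) differentiable (at x)"
    by (rule smooth_map_onD(1)[OF smooth_of_real[OF open_S smooth_vdens] x])
  have dh: "(\<lambda>y. hup (H y) k l) differentiable (at x)" for k l
    by (rule smooth_map_onD(1)[OF smooth_hup[OF open_S smooth_H inv_H] x])
  have dt: "(\<lambda>y. theta H y v) differentiable (at x)" for v
    by (rule smooth_map_onD(1)[OF smooth_theta x])
  have Dm: "dzbar l (\<lambda>y. complex_of_real (vdens (H y))) x = ?m * P l" for l
    unfolding P_def Hb_def h_def dzbar_def fun_delbar_gd by (rule gd_vdens[OF x])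
  have Dh: "dzbar l (\<lambda>y. hup (H y) k l') x = - (\<Sum>q\<in>UNIV. \<Sum>p\<in>UNIV. h k q * Hb l p q * h p l')" for l l' k
    unfolding Hb_def h_def dzbar_def fun_delbar_gd by (rule gd_hup[OF open_S x smooth_H inv_H])
  have prod: "dzbar l (\<lambda>y. hup (H y) k l * theta H y (axis k 1)) x
      = dzbar l (\<lambda>y. hup (H y) k l) x * th k + h k l * dzbar l (\<lambda>y. theta H y (axis k 1)) x" for k l
    unfolding dzbar_def fun_delbar_gd h_def th_def by (rule gd_mult[OF dh dt])
  have dsum: "(\<lambda>y. \<Sum>k\<in>UNIV. hup (H y) k l * theta H y (axis k 1)) differentiable (at x)" for l
    by (intro differentiable_sum ballI finite differentiable_mult dh dt)
  have sum: "dzbar l (\<lambda>y. \<Sum>k\<in>UNIV. hup (H y) k l * theta H y (axis k 1)) x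
      = (\<Sum>k\<in>UNIV. dzbar l (\<lambda>y. hup (H y) k l) x * th k + h k l * dzbar l (\<lambda>y. theta H y (axis k 1)) x)" for l
    unfolding prod[symmetric] unfolding dzbar_def fun_delbar_gd
    by (rule gd_sum) (intro differentiable_mult dh dt)
  have "dzbar l (flux l) x = ?m * P l * (\<Sum>k\<in>UNIV. h k l * th k)
     + ?m * (\<Sum>k\<in>UNIV. dzbar l (\<lambda>y. hup (H y) k l) x * th k + h k l * dzbar l (\<lambda>y. theta H y (axis k 1)) x)" for l
  proof -
    have "dzbar l (flux l) x = dzbar l (\<lambda>y. complex_of_real (vdens (H y))) x * (\<Sum>k\<in>UNIV. hup (H x) k l * theta H x (axis k 1))
      + ?m * dzbar l (\<lambda>y. \<Sum>k\<in>UNIV. hup (H y) k l * theta H y (axis k 1)) x"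
      unfolding flux_def[abs_def] unfolding dzbar_def fun_delbar_gd by (rule gd_mult[OF dm dsum])
    then show ?thesis unfolding Dm sum by (simp add: h_def th_def)
  qed
  then have "(\<Sum>l\<in>UNIV. dzbar l (flux l) x) = ?m * ((\<Sum>l\<in>UNIV. \<Sum>k\<in>UNIV. h k l * dzbar l (\<lambda>y. theta H y (axis k 1)) x)
     + ((\<Sum>l\<in>UNIV. \<Sum>k\<in>UNIV. P l * h k l * th k) + (\<Sum>l\<in>UNIV. \<Sum>k\<in>UNIV. dzbar l (\<lambda>y. hup (H y) k l) x * th k)))"
    by (simp add: sum.distrib sum_distrib_left algebra_simps)
  also have "(\<Sum>l\<in>UNIV. \<Sum>k\<in>UNIV. P l * h k l * th k) = (\<Sum>k\<in>UNIV. th k * (\<Sum>q\<in>UNIV. h k q * P q))"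
    by (subst sum.swap) (simp add: sum_distrib_left mult_ac)
  also have "(\<Sum>l\<in>UNIV. \<Sum>k\<in>UNIV. dzbar l (\<lambda>y. hup (H y) k l) x * th k)
     = - (\<Sum>k\<in>UNIV. th k * (\<Sum>q\<in>UNIV. h k q * (\<Sum>p\<in>UNIV. \<Sum>l\<in>UNIV. h p l * Hb l p q)))"
  proof -
    have A: "(\<Sum>l\<in>UNIV. \<Sum>k\<in>UNIV. dzbar l (\<lambda>y. hup (H y) k l) x * th k)
       = - (\<Sum>k\<in>UNIV. th k * (\<Sum>l\<in>UNIV. \<Sum>q\<in>UNIV. \<Sum>p\<in>UNIV. h k q * (h p l * Hb l p q)))"
      unfolding Dh by (subst sum.swap) (simp add: sum_distrib_left sum_negf mult_ac)
    have B: "(\<Sum>l\<in>UNIV. \<Sum>q\<in>UNIV. \<Sum>p\<in>UNIV. h k q * (h p l * Hb l p q))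
       = (\<Sum>q\<in>UNIV. h k q * (\<Sum>p\<in>UNIV. \<Sum>l\<in>UNIV. h p l * Hb l p q))" for k
    proof -
      have "(\<Sum>l\<in>UNIV. \<Sum>q\<in>UNIV. \<Sum>p\<in>UNIV. h k q * (h p l * Hb l p q))
         = (\<Sum>q\<in>UNIV. \<Sum>l\<in>UNIV. \<Sum>p\<in>UNIV. h k q * (h p l * Hb l p q))" by (rule sum.swap)
      also have "\<dots> = (\<Sum>q\<in>UNIV. \<Sum>p\<in>UNIV. \<Sum>l\<in>UNIV. h k q * (h p l * Hb l p q))"
        by (rule sum.cong[OF refl]) (rule sum.swap)
      finally show ?thesis by (simp add: sum_distrib_left)
    qed
    show ?thesis unfolding A B ..
  qed
  also have "(\<Sum>k\<in>UNIV. th k * (\<Sum>q\<in>UNIV. h k q * P q)) + - (\<Sum>k\<in>UNIV. th k * (\<Sum>q\<in>UNIV. h k q * (\<Sum>p\<in>UNIV. \<Sum>l\<in>UNIV. h p l * Hb l p q)))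
     = (\<Sum>k\<in>UNIV. \<Sum>q\<in>UNIV. h k q * th k * cnj (th q))"
  proof -
    have c: "cnj (th q) = P q - (\<Sum>p\<in>UNIV. \<Sum>l\<in>UNIV. h p l * Hb l p q)" for q
      unfolding th_def P_def h_def Hb_def cnj_theta_axis[OF x] by (simp add: algebra_simps sum_subtractf)
    show ?thesis unfolding c by (simp add: algebra_simps sum_subtractf sum_distrib_left)
  qed
  also have "(\<Sum>l\<in>UNIV. \<Sum>k\<in>UNIV. h k l * dzbar l (\<lambda>y. theta H y (axis k 1)) x) = (\<Sum>k\<in>UNIV. \<Sum>l\<in>UNIV. h k l * dzbar l (\<lambda>y. theta H y (axis k 1)) x)"
    by (rule sum.swap)
  finally show ?thesis unfolding h_def th_def .
qed

lemma Re_dzbar: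
  assumes "F differentiable (at x)"
  shows "Re (dzbar l F x) = frechet_derivative (\<lambda>y. Re (F y) / 2) (at x) (axis l 1)
     + frechet_derivative (\<lambda>y. - Im (F y) / 2) (at x) (\<i> *s axis l 1)"
proof -
  have 1: "frechet_derivative (\<lambda>y. Re (F y) / 2) (at x) v = Re (fun_d F x v) / 2" for v
    unfolding fun_d_def
    by (rule frechet_derivative_linear_compose[OF _ assms]) (intro bounded_linear_divide bounded_linear_Re bounded_linear_compose[OF bounded_linear_divide])
  have 2: "frechet_derivative (\<lambda>y. - Im (F y) / 2) (at x) v = - Im (fun_d F x v) / 2" for v
    unfolding fun_d_def
    by (rule frechet_derivative_linear_compose[OF _ assms])
       (intro bounded_linear_compose[OF bounded_linear_divide] bounded_linear_minus bounded_linear_Im)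
  show ?thesis unfolding 1 2 by (simp add: dzbar_def fun_delbar_def field_simps)
qed

text \<open>Stokes' theorem in a coordinate domain, for the field dual to \<open>\<theta>\<close> times a compactly supported
  function. The second-order part of the divergence drops out if it is purely imaginary.\<close>

lemma chart_stokes:
  assumes im: "\<And>x. x \<in> S \<Longrightarrow> Re (\<Sum>k\<in>UNIV. \<Sum>l\<in>UNIV. hup (H x) k l * dzbar l (\<lambda>y. theta H y (axis k 1)) x) = 0"
    and \<rho>: "Ck_on (Suc 0) \<rho> S" and K: "compact K" "K \<subseteq> S" "\<And>x. x \<in> S - K \<Longrightarrow> \<rho> x = 0"
  shows "cint S (\<lambda>x. vdens (H x) * (\<rho> x * energy x + pairing \<rho> x)) = 0"
proof -
  define F where "F l y = complex_of_real (\<rho> y) * flux l y" for l y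
  have d\<rho>: "(\<lambda>y. complex_of_real (\<rho> y)) differentiable (at x)" if "x \<in> S" for x
    using Ck_on_linear[where L = complex_of_real, OF bounded_linear_of_real open_S \<rho>] that by simp
  have dfl: "flux l differentiable (at x)" if "x \<in> S" for l x
    by (rule smooth_map_onD(1)[OF smooth_flux that])
  have CF: "Ck_on (Suc 0) (F l) S" for l
    unfolding F_def[abs_def]
    by (intro Ck_on_bilinear[OF bounded_bilinear_mult] open_S Ck_on_linear[OF bounded_linear_of_real] \<rho>)
       (use smooth_flux in \<open>simp add: smooth_map_on_def del: Ck_on.simps\<close>)
  have dF: "F l differentiable (at x)" if "x \<in> S" for l x using CF[of l] that by simp
  define f where "f l b y = (if b then Re (F l y) / 2 else - Im (F l y) / 2)" for l b y
  define v where "v l b = (if b then axis l 1 else \<i> *s axis l 1 :: complex^'n)" for l b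
  have Cf: "Ck_on (Suc 0) (f l b) S" for l b
  proof (cases b)
    case True
    have "Ck_on (Suc 0) (\<lambda>y. Re (F l y) / 2) S"
      by (rule Ck_on_linear[OF _ open_S CF]) (intro bounded_linear_compose[OF bounded_linear_divide] bounded_linear_Re)
    then show ?thesis using True unfolding f_def[abs_def] by simp
  next
    case False
    have "Ck_on (Suc 0) (\<lambda>y. - Im (F l y) / 2) S"
      by (rule Ck_on_linear[OF _ open_S CF])
         (intro bounded_linear_compose[OF bounded_linear_divide] bounded_linear_minus bounded_linear_Im)
    then show ?thesis using False unfolding f_def[abs_def] by simp
  qed
  have fK: "f l b y = 0" if "y \<in> S - K" for l b y using K(3)[OF that] by (simp add: f_def F_def)
  have oSK: "open (S - K)" using open_S K(1) compact_imp_closed by blast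
  have dfK: "frechet_derivative (f l b) (at y) w = 0" if "y \<in> S - K" for l b y w
  proof -
    have "frechet_derivative (f l b) (at y) = frechet_derivative (\<lambda>y. 0) (at y)"
      by (rule frechet_derivative_cong_open(1)[OF oSK that fK])
    then show ?thesis by (simp flip: frechet_derivative_at[OF has_derivative_const])
  qed
  have cont: "continuous_on S (\<lambda>y. frechet_derivative (f l b) (at y) w)" for l b w using Cf[of l b] by simp
  have integrand: "vdens (H x) * (\<rho> x * energy x + pairing \<rho> x)
      = (\<Sum>p\<in>UNIV \<times> {True, False}. frechet_derivative (f (fst p) (snd p)) (at x) (v (fst p) (snd p)))" if x: "x \<in> S" for x
  proof -
    have "(\<Sum>p\<in>UNIV \<times> {True, False}. frechet_derivative (f (fst p) (snd p)) (at x) (v (fst p) (snd p)))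
       = (\<Sum>l\<in>UNIV. \<Sum>b\<in>{True, False}. frechet_derivative (f l b) (at x) (v l b))"
      unfolding sum.cartesian_product by (rule sum.cong) auto
    also have "\<dots> = (\<Sum>l\<in>UNIV. Re (dzbar l (F l) x))"
      unfolding Re_dzbar[OF dF[OF x]] by (simp add: f_def[abs_def] v_def)
    also have "\<dots> = Re (\<Sum>l\<in>UNIV. dzbar l (\<lambda>y. complex_of_real (\<rho> y)) x * flux l x + complex_of_real (\<rho> x) * dzbar l (flux l) x)"
      unfolding F_def[abs_def] dzbar_def fun_delbar_gd by (simp add: gd_mult[OF d\<rho>[OF x] dfl[OF x]])
    also have "(\<Sum>l\<in>UNIV. dzbar l (\<lambda>y. complex_of_real (\<rho> y)) x * flux l x + complex_of_real (\<rho> x) * dzbar l (flux l) x)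
       = (\<Sum>l\<in>UNIV. dzbar l (\<lambda>y. complex_of_real (\<rho> y)) x * flux l x) + complex_of_real (\<rho> x) * (\<Sum>l\<in>UNIV. dzbar l (flux l) x)"
      by (simp add: sum.distrib sum_distrib_left)
    also have "(\<Sum>l\<in>UNIV. dzbar l (\<lambda>y. complex_of_real (\<rho> y)) x * flux l x)
       = of_real (vdens (H x)) * (\<Sum>k\<in>UNIV. \<Sum>l\<in>UNIV. hup (H x) k l * theta H x (axis k 1) * dzbar l (\<lambda>y. of_real (\<rho> y)) x)"
      unfolding flux_def sum_distrib_left by (subst sum.swap) (simp add: mult_ac)
    finally show ?thesis
      unfolding divergence_flux[OF x] energy_def pairing_def using im[OF x] by (simp add: algebra_simps)
  qed
  have "cint S (\<lambda>x. vdens (H x) * (\<rho> x * energy x + pairing \<rho> x))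
     = cint S (\<lambda>x. \<Sum>p\<in>UNIV \<times> {True, False}. frechet_derivative (f (fst p) (snd p)) (at x) (v (fst p) (snd p)))"
    by (rule cint_cong) (rule integrand)
  also have "\<dots> = (\<Sum>p\<in>UNIV \<times> {True, False}. cint S (\<lambda>x. frechet_derivative (f (fst p) (snd p)) (at x) (v (fst p) (snd p))))"
    by (rule cint_sum) (use open_S K cont dfK in \<open>auto simp: cc_on_def\<close>)
  also have "\<dots> = 0"
    by (intro sum.neutral ballI cint_derivative[OF open_S K(1,2)]) (use Cf fK cont in auto)
  finally show ?thesis .
qed

end

section \<open>Consequences of the Ricci-flat equation in a chart\<close>

lemma ext_deriv_small:
  "ext_deriv D \<eta> x [v] = D (\<lambda>y. \<eta> y []) x v"
  "ext_deriv D \<eta> x [v, w] = D (\<lambda>y. \<eta> y [w]) x v - D (\<lambda>y. \<eta> y [v]) x w"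
  "ext_deriv D \<eta> x [u, v, w] = D (\<lambda>y. \<eta> y [v, w]) x u - D (\<lambda>y. \<eta> y [u, w]) x v + D (\<lambda>y. \<eta> y [u, v]) x w"
  by (simp_all add: ext_deriv_Cons contract_def)

lemma wirtinger_cong:
  assumes "open S" "x \<in> S" "\<And>y. y \<in> S \<Longrightarrow> f y = g y"
  shows "fun_del f x v = fun_del g x v" "fun_delbar f x v = fun_delbar g x v"
proof -
  show "fun_del f x v = fun_del g x v" unfolding fun_del_gd by (rule gd_cong[OF assms])
  show "fun_delbar f x v = fun_delbar g x v" unfolding fun_delbar_gd by (rule gd_cong[OF assms])
qed

lemma gd_lincomb:
  assumes "open S" "x \<in> S" "\<And>y. y \<in> S \<Longrightarrow> F y = (\<Sum>i\<in>I. a i * f i y)" "\<And>i. f i differentiable (at x)"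
  shows "gd p q F x u = (\<Sum>i\<in>I. a i * gd p q (f i) x u)"
proof -
  have "gd p q F x u = gd p q (\<lambda>y. \<Sum>i\<in>I. a i * f i y) x u" by (rule gd_cong[OF assms(1-3)])
  also have "\<dots> = (\<Sum>i\<in>I. a i * gd p q (f i) x u)"
    by (subst gd_sum) (auto intro!: differentiable_mult differentiable_const assms(4) simp: gd_cmult[OF assms(4)])
  finally show ?thesis .
qed

definition theta_form :: "(complex^'n::finite \<Rightarrow> complex^'n^'n) \<Rightarrow> 'n dform" where
  "theta_form H x vs = (case vs of [v] \<Rightarrow> theta H x v | _ \<Rightarrow> 0)"

lemma of_degree_theta_form: "of_degree 1 (theta_form H x)"
  by (auto simp: of_degree_def theta_form_def split: list.splits)

lemma of_degree_d_theta_form: "of_degree 2 (form_d (theta_form H) x)"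
  using ext_deriv_degree[where \<eta> = "theta_form H" and D = fun_d and k = 1 and x = x, OF of_degree_theta_form D_zero(1)]
  by (simp add: numeral_2_eq_2)

text \<open>Replacing \<open>w\<close> by \<open>\<i> w\<close> turns the difference into a multiple of the sum.\<close>

lemma form11_eq_0_imp_sesq_eq_0:
  assumes "\<And>v w. sesq M v w - sesq M w v = 0"
  shows "sesq M v w = 0"
  using assms[of v w] assms[of v "\<i> *s w"] by (simp add: sesq_linear algebra_simps)

context metric_chart
begin

definition logdet :: "complex^'n \<Rightarrow> complex" where
  "logdet y = of_real (ln (Re (det (H y))))"

lemma smooth_logdet: "smooth_map_on logdet S"
  unfolding logdet_def[abs_def]
  by (intro smooth_of_real smooth_ln smooth_Re smooth_det open_S smooth_entry)
     (auto intro: det_hermitian_pos(1) posdef)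

lemma diff_theta: "x \<in> S \<Longrightarrow> (\<lambda>y. theta H y v) differentiable (at x)"
  using smooth_map_onD(1)[OF smooth_theta] .

text \<open>A vanishing (1,1)-form has vanishing coefficients, which \<open>lc_curv_trace\<close> computes: the complex Hessian of
  \<open>log det h\<close> is the Hermitian part of the matrix of \<open>\<partial>\<close>-bar \<open>\<theta>\<close>.\<close>

lemma ricci_flat_equation:
  assumes x: "x \<in> S" and flat: "lc_ricci H x = (\<lambda>vs. 0)"
  shows "fun_delbar (\<lambda>y. fun_del logdet y w) x v =
     1/2 * fun_delbar (\<lambda>y. theta H y w) x v + 1/2 * fun_del (\<lambda>y. cnj (theta H y v)) x w"
proof -
  define M where "M = (\<chi> i j. \<Sum>k\<in>UNIV. lc_curv H i j k k x)"
  have "sesq M v w - sesq M w v = 0" for v w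
    using fun_cong[OF flat, of "[v, w]"] by (simp add: lc_ricci_def form11_def M_def)
  then have "sesq M w v = 0" by (rule form11_eq_0_imp_sesq_eq_0)
  moreover have "sesq M w v = - fun_delbar (\<lambda>y. fun_del logdet y w) x v
     + (1/2 * fun_delbar (\<lambda>y. theta H y w) x v + 1/2 * fun_del (\<lambda>y. cnj (theta H y v)) x w)"
  proof -
    have dl: "dz i logdet differentiable (at x)" for i
      unfolding dz_def[abs_def] fun_del_gd by (rule smooth_map_onD(1)[OF smooth_gd[OF open_S smooth_logdet] x])
    have dc: "(\<lambda>y. cnj (theta H y v)) differentiable (at x)" for v
      by (rule smooth_map_onD(1)[OF smooth_cnj[OF open_S smooth_theta] x])
    have e1: "fun_del logdet y w = (\<Sum>i\<in>UNIV. w $ i * dz i logdet y)" if "y \<in> S" for y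
      by (rule fun_del_expand(1)[OF smooth_map_onD(1)[OF smooth_logdet that]])
    have "fun_delbar (\<lambda>y. fun_del logdet y w) x v = (\<Sum>i\<in>UNIV. w $ i * fun_delbar (dz i logdet) x v)"
      unfolding fun_delbar_gd by (rule gd_lincomb[OF open_S x e1 dl])
    then have A: "fun_delbar (\<lambda>y. fun_del logdet y w) x v = (\<Sum>i\<in>UNIV. \<Sum>j\<in>UNIV. dzbar j (dz i logdet) x * w $ i * cnj (v $ j))"
      by (simp add: fun_del_expand(2)[OF dl] sum_distrib_left mult_ac)
    have "fun_delbar (\<lambda>y. theta H y w) x v = (\<Sum>i\<in>UNIV. w $ i * fun_delbar (\<lambda>y. theta H y (axis i 1)) x v)"
      unfolding fun_delbar_gd by (rule gd_lincomb[OF open_S x theta_expand diff_theta[OF x]])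
    then have B: "fun_delbar (\<lambda>y. theta H y w) x v = (\<Sum>i\<in>UNIV. \<Sum>j\<in>UNIV. dzbar j (\<lambda>y. theta H y (axis i 1)) x * w $ i * cnj (v $ j))"
      by (simp add: fun_del_expand(2)[OF diff_theta[OF x]] sum_distrib_left mult_ac)
    have e3: "cnj (theta H y v) = (\<Sum>j\<in>UNIV. cnj (v $ j) * cnj (theta H y (axis j 1)))" if "y \<in> S" for y
      by (subst theta_expand[OF that]) simp
    have "fun_del (\<lambda>y. cnj (theta H y v)) x w = (\<Sum>j\<in>UNIV. cnj (v $ j) * fun_del (\<lambda>y. cnj (theta H y (axis j 1))) x w)"
      unfolding fun_del_gd by (rule gd_lincomb[OF open_S x e3 dc])
    then have C: "fun_del (\<lambda>y. cnj (theta H y v)) x w = (\<Sum>i\<in>UNIV. \<Sum>j\<in>UNIV. dz i (\<lambda>y. cnj (theta H y (axis j 1))) x * w $ i * cnj (v $ j))"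
      by (subst sum.swap) (simp add: fun_del_expand(1)[OF dc] sum_distrib_left mult_ac)
    have M: "M $ i $ j = - dzbar j (dz i logdet) x + 1/2 * dzbar j (\<lambda>y. theta H y (axis i 1)) x
        + 1/2 * dz i (\<lambda>y. cnj (theta H y (axis j 1))) x" for i j
      unfolding M_def using lc_curv_trace[OF x, of i j] by (simp add: logdet_def[abs_def])
    show ?thesis
      unfolding A B C sesq_def M
      by (simp add: algebra_simps sum.distrib sum_subtractf sum_distrib_left sum_negf)
  qed
  ultimately show ?thesis by (simp add: algebra_simps)
qed

text \<open>On a Ricci-flat chart \<open>\<partial>\<partial>\<close>-bar of \<open>\<theta>\<close> vanishes, since up to \<open>\<partial>\<close> of a conjugate the form \<open>\<partial>\<close>-bar
  of \<open>\<theta>\<close> is the complex Hessian of a function.\<close>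

lemma mixed_second_derivative_theta:
  assumes x: "x \<in> S" and flat: "\<And>y. y \<in> S \<Longrightarrow> lc_ricci H y = (\<lambda>vs. 0)"
  shows "fun_del (\<lambda>y. fun_delbar (\<lambda>z. theta H z w) y v) x u = fun_del (\<lambda>y. fun_delbar (\<lambda>z. theta H z u) y v) x w"
proof -
  let ?g = "\<lambda>w y. fun_delbar (\<lambda>z. fun_del logdet z w) y v"
  let ?c = "\<lambda>y. cnj (theta H y v)"
  have sc: "smooth_map_on ?c S" by (intro smooth_cnj smooth_theta open_S)
  have s1: "smooth_map_on (\<lambda>y. fun_del logdet y w) S" for w
    unfolding fun_del_gd by (intro smooth_gd smooth_logdet open_S)
  have dg: "?g w differentiable (at x)" for w
    unfolding fun_delbar_gd by (rule smooth_map_onD(1)[OF smooth_gd[OF open_S s1] x])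
  have dc: "(\<lambda>y. fun_del ?c y w) differentiable (at x)" for w
    unfolding fun_del_gd by (rule smooth_map_onD(1)[OF smooth_gd[OF open_S sc] x])
  have *: "fun_del (\<lambda>y. fun_delbar (\<lambda>z. theta H z w) y v) x u = 2 * fun_del (?g w) x u - fun_del (\<lambda>y. fun_del ?c y w) x u" for w u
  proof -
    have "fun_del (\<lambda>y. fun_delbar (\<lambda>z. theta H z w) y v) x u = fun_del (\<lambda>y. 2 * ?g w y - fun_del ?c y w) x u"
      by (rule wirtinger_cong[OF open_S x]) (simp add: ricci_flat_equation[OF _ flat])
    also have "\<dots> = 2 * fun_del (?g w) x u - fun_del (\<lambda>y. fun_del ?c y w) x u"
      using gd_diff[OF differentiable_mult[OF differentiable_const dg] dc, of "1/2" "- \<i>/2" 2 w w u] gd_cmult[OF dg, of "1/2" "- \<i>/2" 2 w u]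
      by (simp add: fun_del_gd)
    finally show ?thesis .
  qed
  have g: "fun_del (?g w) x u = fun_delbar (\<lambda>y. fun_del (\<lambda>z. fun_del logdet z w) y u) x v" for w u
    unfolding fun_del_gd fun_delbar_gd by (rule gd_commute[OF open_S x s1[unfolded fun_del_gd]])
  have "fun_delbar (\<lambda>y. fun_del (\<lambda>z. fun_del logdet z w) y u) x v = fun_delbar (\<lambda>y. fun_del (\<lambda>z. fun_del logdet z u) y w) x v"
    unfolding fun_del_gd fun_delbar_gd
    by (rule gd_cong[OF open_S x]) (rule gd_commute[OF open_S _ smooth_logdet])
  moreover have "fun_del (\<lambda>y. fun_del ?c y w) x u = fun_del (\<lambda>y. fun_del ?c y u) x w"
    unfolding fun_del_gd by (rule gd_commute[OF open_S x sc])
  ultimately show ?thesis unfolding * g by simp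
qed

lemma form_d_theta_form:
  "form_d (theta_form H) x [v, w] = fun_d (\<lambda>y. theta H y w) x v - fun_d (\<lambda>y. theta H y v) x w"
  by (simp add: ext_deriv_small theta_form_def)

text \<open>As \<open>\<partial>\<close> and \<open>\<partial>\<close>-bar have square zero and anticommute, only \<open>\<partial>\<partial>\<close>-bar of \<open>\<theta>\<close> is left of \<open>\<partial>d\<theta>\<close> and, up to
  sign, of \<open>\<partial>\<close>-bar of \<open>d\<theta>\<close>.\<close>

lemma d_theta_closed:
  assumes x: "x \<in> S" and flat: "\<And>y. y \<in> S \<Longrightarrow> lc_ricci H y = (\<lambda>vs. 0)"
  shows "form_del (form_d (theta_form H)) x vs = 0" "form_delbar (form_d (theta_form H)) x vs = 0"
proof -
  have deg: "of_degree 2 (form_d (theta_form H) y)" for y by (rule of_degree_d_theta_form)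
  have s1: "smooth_map_on (\<lambda>y. fun_del (\<lambda>z. theta H z w) y v) S" "smooth_map_on (\<lambda>y. fun_delbar (\<lambda>z. theta H z w) y v) S" for v w
    unfolding fun_del_gd fun_delbar_gd by (intro smooth_gd smooth_theta open_S)+
  note d1 = smooth_map_onD(1)[OF s1(1) x] smooth_map_onD(1)[OF s1(2) x]
  have e: "form_d (theta_form H) y [v, w] = (fun_del (\<lambda>z. theta H z w) y v + fun_delbar (\<lambda>z. theta H z w) y v)
     - (fun_del (\<lambda>z. theta H z v) y w + fun_delbar (\<lambda>z. theta H z v) y w)" for y v w
    unfolding form_d_theta_form by (simp add: fun_d_split)
  have E: "gd p q (\<lambda>y. form_d (theta_form H) y [v, w]) x u =
      (gd p q (\<lambda>y. fun_del (\<lambda>z. theta H z w) y v) x u + gd p q (\<lambda>y. fun_delbar (\<lambda>z. theta H z w) y v) x u)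
     - (gd p q (\<lambda>y. fun_del (\<lambda>z. theta H z v) y w) x u + gd p q (\<lambda>y. fun_delbar (\<lambda>z. theta H z v) y w) x u)" for p q u v w
    unfolding e by (simp add: gd_add gd_diff d1 differentiable_add)
  note E = E[where p = "1/2" and q = "- \<i>/2", folded fun_del_gd] E[where p = "1/2" and q = "\<i>/2", folded fun_delbar_gd]
  have a: "fun_del (\<lambda>y. fun_del (\<lambda>z. theta H z w) y v) x u = fun_del (\<lambda>y. fun_del (\<lambda>z. theta H z w) y u) x v" for u v w
    unfolding fun_del_gd by (rule gd_commute[OF open_S x smooth_theta])
  have a': "fun_delbar (\<lambda>y. fun_delbar (\<lambda>z. theta H z w) y v) x u = fun_delbar (\<lambda>y. fun_delbar (\<lambda>z. theta H z w) y u) x v" for u v w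
    unfolding fun_delbar_gd by (rule gd_commute[OF open_S x smooth_theta])
  have c: "fun_delbar (\<lambda>y. fun_del (\<lambda>z. theta H z w) y v) x u = fun_del (\<lambda>y. fun_delbar (\<lambda>z. theta H z w) y u) x v" for u v w
    unfolding fun_delbar_gd fun_del_gd by (rule gd_commute[OF open_S x smooth_theta])
  note b = mixed_second_derivative_theta[OF x flat]
  have "form_del (form_d (theta_form H)) x vs = 0 \<and> form_delbar (form_d (theta_form H)) x vs = 0"
  proof (cases "length vs = 3")
    case True
    then obtain u v w where vs: "vs = [u, v, w]" by (auto simp: length_Suc_conv numeral_3_eq_3)
    have "form_del (form_d (theta_form H)) x vs = 0"
      unfolding vs ext_deriv_small(3) E
      using a[of w v u] a[of v w u] a[of u w v] b[of w v u] b[of v w u] b[of w u v] by simp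
    moreover have "form_delbar (form_d (theta_form H)) x vs = 0"
      unfolding vs ext_deriv_small(3) E c
      using a'[of w v u] a'[of v w u] a'[of u w v] b[of w v u] b[of v w u] b[of w u v] by simp
    ultimately show ?thesis ..
  next
    case False
    then show ?thesis
      using ext_deriv_degree[where D = fun_del and \<eta> = "form_d (theta_form H)" and k = 2 and x = x, OF deg D_zero(2)]
        ext_deriv_degree[where D = fun_delbar and \<eta> = "form_d (theta_form H)" and k = 2 and x = x, OF deg D_zero(3)]
      by (simp add: of_degree_def numeral_3_eq_3 numeral_2_eq_2)
  qed
  then show "form_del (form_d (theta_form H)) x vs = 0" "form_delbar (form_d (theta_form H)) x vs = 0" by auto
qed

lemma form_on_theta: "form_on S (theta_form H)"
  unfolding form_on_def
proof (intro conjI ballI allI)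
  fix x assume x: "x \<in> S"
  have l: "theta H x (u + v) = theta H x u + theta H x v" "theta H x (r *\<^sub>R v) = r *\<^sub>R theta H x v" for u v r
    unfolding theta_expand[OF x, of "u + v"] theta_expand[OF x, of u] theta_expand[OF x, of v] theta_expand[OF x, of "r *\<^sub>R v"]
    by (simp_all add: algebra_simps sum.distrib scaleR_sum_right)
  show "alternating_multilinear (theta_form H x)"
    unfolding alternating_multilinear_def
  proof (intro conjI allI impI)
    fix us ws :: "(complex^'n) list"
    show "linear (\<lambda>v. theta_form H x (us @ v # ws))"
    proof (cases "us = [] \<and> ws = []")
      case True
      then show ?thesis by (auto simp: theta_form_def l intro!: linearI)
    next
      case False
      then have "length (us @ v # ws) \<noteq> 1" for v by simp
      then have "theta_form H x (us @ v # ws) = 0" for v using of_degree_theta_form[of H x] unfolding of_degree_def by blast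
      then show ?thesis by (simp add: linear_iff)
    qed
    show "theta_form H x vs = 0" if "\<not> distinct vs" for vs
      using that by (auto simp: theta_form_def split: list.splits)
  qed
next
  fix vs
  show "smooth_map_on (\<lambda>x. theta_form H x vs) S"
  proof (cases "\<exists>v. vs = [v]")
    case True
    then show ?thesis by (auto simp: theta_form_def intro: smooth_theta)
  next
    case False
    then have "theta_form H x vs = 0" for x by (auto simp: theta_form_def split: list.splits)
    then show ?thesis by (simp add: smooth_const)
  qed
qed

lemma altform_theta_d:
  assumes x: "x \<in> S"
  shows "alternating_multilinear (form_d (theta_form H) x)"
proof -
  have deg: "of_degree 2 (form_d (theta_form H) x)" by (rule of_degree_d_theta_form)
  have l: "fun_d (\<lambda>y. theta H y (v + v')) x u = fun_d (\<lambda>y. theta H y v) x u + fun_d (\<lambda>y. theta H y v') x u"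
    "fun_d (\<lambda>y. theta H y (r *\<^sub>R v)) x u = r *\<^sub>R fun_d (\<lambda>y. theta H y v) x u" for v v' u r
  proof -
    have t: "fun_d (\<lambda>y. theta H y v) x u = (\<Sum>i\<in>UNIV. v $ i * fun_d (\<lambda>y. theta H y (axis i 1)) x u)" for v u
      unfolding fun_d_gd by (rule gd_lincomb[OF open_S x theta_expand diff_theta[OF x]])
    show "fun_d (\<lambda>y. theta H y (v + v')) x u = fun_d (\<lambda>y. theta H y v) x u + fun_d (\<lambda>y. theta H y v') x u"
      "fun_d (\<lambda>y. theta H y (r *\<^sub>R v)) x u = r *\<^sub>R fun_d (\<lambda>y. theta H y v) x u"
      unfolding t[of "v + v'"] t[of v] t[of v'] t[of "r *\<^sub>R v"] by (simp_all add: algebra_simps sum.distrib scaleR_sum_right)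
  qed
  note l' = linear_add[OF fun_d_linear[OF diff_theta[OF x]]] linear_scale[OF fun_d_linear[OF diff_theta[OF x]]]
  have "altform (form_d (theta_form H) x)"
    unfolding altform_def
  proof (intro conjI allI)
    fix us ws :: "(complex^'n) list" and v
    show "form_d (theta_form H) x (us @ v # v # ws) = 0"
    proof (cases "us = [] \<and> ws = []")
      case False
      then have "length (us @ v # v # ws) \<noteq> 2" by auto
      then show ?thesis using deg unfolding of_degree_def by blast
    qed (simp add: form_d_theta_form)
    have "us = [] \<and> length ws = 1 \<or> length us = 1 \<and> ws = [] \<or> (\<forall>v::complex^'n. length (us @ v # ws) \<noteq> 2)"
      by (cases us; cases ws) auto
    then consider w where "us = []" "ws = [w]" | w where "us = [w]" "ws = []" | "\<And>v::complex^'n. length (us @ v # ws) \<noteq> 2"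
      by (auto simp: length_Suc_conv)
    then show "linear (\<lambda>v. form_d (theta_form H) x (us @ v # ws))"
    proof cases
      case 3
      then have "form_d (theta_form H) x (us @ v # ws) = 0" for v using deg unfolding of_degree_def by blast
      then show ?thesis by (simp add: linear_iff)
    qed (auto simp: form_d_theta_form l l' algebra_simps intro!: linearI)
  qed
  then show ?thesis
    unfolding alternating_multilinear_def by (auto simp: altform_linear altform_not_distinct)
qed

lemma form_on_theta_d: "form_on S (form_d (theta_form H))"
  unfolding form_on_def
proof (intro conjI ballI allI)
  fix vs
  have deg: "of_degree 2 (form_d (theta_form H) x)" for x by (rule of_degree_d_theta_form)
  show "smooth_map_on (\<lambda>x. form_d (theta_form H) x vs) S"
  proof (cases "length vs = 2")
    case True
    then obtain v w where vs: "vs = [v, w]" by (auto simp: length_Suc_conv numeral_2_eq_2)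
    show ?thesis
      unfolding vs form_d_theta_form unfolding fun_d_gd by (intro smooth_diff smooth_gd smooth_theta open_S)
  next
    case False
    then show ?thesis using deg by (simp add: of_degree_def smooth_const)
  qed
qed (rule altform_theta_d)

text \<open>The part of type (1,1) of the equation \<open>d\<theta> = \<partial>\<partial>\<close>-bar \<open>u\<close>, isolated by multiplying the arguments by \<open>\<i>\<close>: the
  (2,0)-part \<open>p\<close> is complex bilinear, the (1,1)-part \<open>s\<close> is sesquilinear.\<close>

lemma theta_potential:
  assumes x: "x \<in> S" and u: "smooth_map_on u S"
    and eq: "\<And>v w. form_d (theta_form H) x [v, w] = fun_del (\<lambda>y. fun_delbar u y w) x v - fun_del (\<lambda>y. fun_delbar u y v) x w"
  shows "fun_delbar (\<lambda>y. theta H y w) x v = - fun_del (\<lambda>y. fun_delbar u y v) x w"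
proof -
  define p where "p v w = fun_del (\<lambda>y. theta H y w) x v" for v w
  define s where "s v w = fun_delbar (\<lambda>y. theta H y w) x v + fun_del (\<lambda>y. fun_delbar u y v) x w" for v w
  have Z: "p v w - p w v + s v w - s w v = 0" for v w
  proof -
    have "p v w - p w v + s v w - s w v = form_d (theta_form H) x [v, w] - (fun_del (\<lambda>y. fun_delbar u y w) x v - fun_del (\<lambda>y. fun_delbar u y v) x w)"
      unfolding form_d_theta_form fun_d_split p_def s_def by (simp add: algebra_simps)
    then show ?thesis using eq by simp
  qed
  have db: "(\<lambda>y. fun_delbar u y v) differentiable (at x)" for v
    unfolding fun_delbar_gd by (rule smooth_map_onD(1)[OF smooth_gd[OF open_S u] x])
  have th: "fun_del (\<lambda>y. theta H y (\<i> *s w)) x v = \<i> * fun_del (\<lambda>y. theta H y w) x v"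
    "fun_delbar (\<lambda>y. theta H y (\<i> *s w)) x v = \<i> * fun_delbar (\<lambda>y. theta H y w) x v" for v w
  proof -
    have "theta H y (\<i> *s w) = \<i> * theta H y w" if "y \<in> S" for y
      unfolding theta_expand[OF that, of "\<i> *s w"] theta_expand[OF that, of w] by (simp add: sum_distrib_left mult_ac)
    then have "gd a b (\<lambda>y. theta H y (\<i> *s w)) x v = \<i> * gd a b (\<lambda>y. theta H y w) x v" for a b
      unfolding gd_cmult[OF diff_theta[OF x], symmetric] by (rule gd_cong[OF open_S x])
    then show "fun_del (\<lambda>y. theta H y (\<i> *s w)) x v = \<i> * fun_del (\<lambda>y. theta H y w) x v"
      "fun_delbar (\<lambda>y. theta H y (\<i> *s w)) x v = \<i> * fun_delbar (\<lambda>y. theta H y w) x v"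
      by (simp_all add: fun_del_gd fun_delbar_gd)
  qed
  have du: "fun_del (\<lambda>y. fun_delbar u y (\<i> *s v)) x w = - \<i> * fun_del (\<lambda>y. fun_delbar u y v) x w" for v w
  proof -
    have "fun_del (\<lambda>y. fun_delbar u y (\<i> *s v)) x w = fun_del (\<lambda>y. - \<i> * fun_delbar u y v) x w"
      unfolding fun_del_gd by (rule gd_cong[OF open_S x]) (simp add: fun_del_scale(2)[OF smooth_map_onD(1)[OF u]])
    then show ?thesis unfolding fun_del_gd gd_cmult[OF db] .
  qed
  have P: "p (\<i> *s v) w = \<i> * p v w" "p v (\<i> *s w) = \<i> * p v w" for v w
    by (simp_all add: p_def th fun_del_scale[OF diff_theta[OF x]])
  have S: "s (\<i> *s v) w = - \<i> * s v w" "s v (\<i> *s w) = \<i> * s v w" for v w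
    by (simp_all add: s_def th du fun_del_scale[OF diff_theta[OF x]] fun_del_scale[OF db] algebra_simps)
  have 1: "p v w - p w v + s v w - s w v = 0" by (rule Z)
  have 2: "- p v w + p w v + s v w - s w v = 0"
    using Z[of "\<i> *s v" "\<i> *s w"] unfolding P S by (simp add: algebra_simps)
  have 3: "\<i> * (p v w - p w v) + \<i> * (s v w + s w v) = 0"
    using Z[of v "\<i> *s w"] unfolding P S by (simp add: algebra_simps)
  have "s v w = s w v" "p v w = p w v" using 1 2 by (simp_all add: algebra_simps) (simp_all add: complex_eq_iff)
  then have "s v w = 0" using 3 by simp
  then show ?thesis unfolding s_def by (simp add: eq_neg_iff_add_eq_0)
qed

text \<open>The Hermitian part of the matrix of \<open>\<partial>\<close>-bar \<open>\<theta>\<close> is the complex Hessian of \<open>log det h\<close> by Ricci-flatness, and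
  that of \<open>- Re u\<close> by the choice of \<open>u\<close>.\<close>

lemma pluriharmonic_potential:
  assumes x: "x \<in> S" and flat: "lc_ricci H x = (\<lambda>vs. 0)" and u: "smooth_map_on u S"
    and pot: "\<And>v w. fun_delbar (\<lambda>y. theta H y w) x v = - fun_del (\<lambda>y. fun_delbar u y v) x w"
  shows "fun_delbar (\<lambda>y. fun_del (\<lambda>z. logdet z + of_real (Re (u z))) y w) x v = 0"
proof -
  have cu: "smooth_map_on (\<lambda>y. cnj (u y)) S" by (intro smooth_cnj u open_S)
  have su: "smooth_map_on (\<lambda>y. complex_of_real (Re (u y))) S" by (intro smooth_of_real smooth_Re u open_S)
  have du: "u differentiable (at y)" if "y \<in> S" for y by (rule smooth_map_onD(1)[OF u that])
  have d2: "(\<lambda>y. fun_del f y w) differentiable (at x)" "(\<lambda>y. fun_delbar f y w) differentiable (at x)" if "smooth_map_on f S" for f w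
    unfolding fun_del_gd fun_delbar_gd by (rule smooth_map_onD(1)[OF smooth_gd[OF open_S that] x])+
  have comm: "fun_delbar (\<lambda>y. fun_del f y w) x v = fun_del (\<lambda>y. fun_delbar f y v) x w" if "smooth_map_on f S" for f v w
    unfolding fun_del_gd fun_delbar_gd by (rule gd_commute[OF open_S x that])
  have c: "fun_del (\<lambda>y. cnj (theta H y v)) x w = - fun_delbar (\<lambda>y. fun_del (\<lambda>z. cnj (u z)) y w) x v"
  proof -
    have "fun_del (\<lambda>y. cnj (theta H y v)) x w = cnj (fun_delbar (\<lambda>y. theta H y v) x w)"
      by (rule fun_del_cnj(1)[OF diff_theta[OF x]])
    also have "\<dots> = - cnj (fun_del (\<lambda>y. fun_delbar u y w) x v)" unfolding pot by simp
    also have "\<dots> = - fun_delbar (\<lambda>y. cnj (fun_delbar u y w)) x v" by (simp add: fun_del_cnj(2)[OF d2(2)[OF u]])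
    also have "fun_delbar (\<lambda>y. cnj (fun_delbar u y w)) x v = fun_delbar (\<lambda>y. fun_del (\<lambda>z. cnj (u z)) y w) x v"
      by (rule wirtinger_cong[OF open_S x]) (simp add: fun_del_cnj(1)[OF du])
    finally show ?thesis .
  qed
  have re: "fun_delbar (\<lambda>y. fun_del (\<lambda>z. complex_of_real (Re (u z))) y w) x v
      = 1/2 * fun_delbar (\<lambda>y. fun_del u y w) x v + 1/2 * fun_delbar (\<lambda>y. fun_del (\<lambda>z. cnj (u z)) y w) x v"
  proof -
    have r: "fun_del (\<lambda>z. complex_of_real (Re (u z))) y w = 1/2 * (fun_del u y w + fun_del (\<lambda>z. cnj (u z)) y w)" if "y \<in> S" for y
    proof -
      have "(\<lambda>z. complex_of_real (Re (u z))) = (\<lambda>z. 1/2 * (u z + cnj (u z)))" by (simp add: fun_eq_iff complex_add_cnj)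
      then show ?thesis
        using gd_cmult[OF differentiable_add[OF du[OF that] smooth_map_onD(1)[OF cu that]], of "1/2" "- \<i>/2" "1/2" w]
          gd_add[OF du[OF that] smooth_map_onD(1)[OF cu that], of "1/2" "- \<i>/2" w]
        by (simp add: fun_del_gd)
    qed
    have "fun_delbar (\<lambda>y. fun_del (\<lambda>z. complex_of_real (Re (u z))) y w) x v = fun_delbar (\<lambda>y. 1/2 * (fun_del u y w + fun_del (\<lambda>z. cnj (u z)) y w)) x v"
      by (rule wirtinger_cong[OF open_S x r])
    also have "\<dots> = 1/2 * fun_delbar (\<lambda>y. fun_del u y w + fun_del (\<lambda>z. cnj (u z)) y w) x v"
      unfolding fun_delbar_gd by (rule gd_cmult[OF differentiable_add[OF d2(1)[OF u] d2(1)[OF cu]]])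
    also have "fun_delbar (\<lambda>y. fun_del u y w + fun_del (\<lambda>z. cnj (u z)) y w) x v
        = fun_delbar (\<lambda>y. fun_del u y w) x v + fun_delbar (\<lambda>y. fun_del (\<lambda>z. cnj (u z)) y w) x v"
      unfolding fun_delbar_gd by (rule gd_add[OF d2(1)[OF u] d2(1)[OF cu]])
    finally show ?thesis by (simp add: distrib_left)
  qed
  have "fun_delbar (\<lambda>y. fun_del (\<lambda>z. logdet z + of_real (Re (u z))) y w) x v
     = fun_delbar (\<lambda>y. fun_del logdet y w + fun_del (\<lambda>z. of_real (Re (u z))) y w) x v"
    unfolding fun_delbar_gd
    by (rule gd_cong[OF open_S x]) (simp add: fun_del_gd gd_add smooth_map_onD(1)[OF smooth_logdet] smooth_map_onD(1)[OF su])
  also have "\<dots> = fun_delbar (\<lambda>y. fun_del logdet y w) x v + fun_delbar (\<lambda>y. fun_del (\<lambda>z. of_real (Re (u z))) y w) x v"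
    using gd_add[OF d2(1)[OF smooth_logdet] d2(1)[OF su]] by (simp add: fun_delbar_gd)
  also have "\<dots> = 0"
    unfolding ricci_flat_equation[OF x flat] re c pot comm[OF u] by simp
  finally show ?thesis .
qed

section \<open>Conformal change of the metric\<close>

lemma conformal_metric_chart:
  assumes g: "smooth_map_on g S"
  shows "metric_chart S (\<lambda>y. exp (g y) *\<^sub>R H y)"
proof
  show "open S" by (rule open_S)
  show "smooth_map_on (\<lambda>y. exp (g y) *\<^sub>R H y) S" by (intro smooth_scaleR smooth_exp open_S g smooth_H)
  fix x assume x: "x \<in> S"
  show "hermitian_posdef (exp (g x) *\<^sub>R H x)"
    unfolding hermitian_posdef_def
  proof (intro conjI allI impI)
    show "(exp (g x) *\<^sub>R H x) $ j $ i = cnj ((exp (g x) *\<^sub>R H x) $ i $ j)" for i j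
      by (simp add: hermitian_posdefD(1)[OF posdef[OF x]])
    fix v :: "complex^'n" assume "v \<noteq> 0"
    moreover have "sesq (exp (g x) *\<^sub>R H x) v v = of_real (exp (g x)) * sesq (H x) v v"
      by (simp add: sesq_def sum_distrib_left scaleR_complex mult_ac)
    ultimately show "Re (sesq (exp (g x) *\<^sub>R H x) v v) > 0"
      using hermitian_posdefD(2)[OF posdef[OF x]] by simp
  qed
qed

lemma hup_scaleR:
  assumes "invertible M" "r \<noteq> 0"
  shows "hup (r *\<^sub>R M) k l = hup M k l / of_real r"
proof -
  have "(r *\<^sub>R M) ** (inverse r *\<^sub>R matrix_inv M) = M ** matrix_inv M"
    using assms(2) by (simp add: matrix_matrix_mult_def vec_eq_iff scaleR_complex field_simps)
  then have "matrix_inv (r *\<^sub>R M) = inverse r *\<^sub>R matrix_inv M"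
    by (intro matrix_inv_eqI) (simp add: matrix_inv_works[OF assms(1)])
  then show ?thesis by (simp add: hup_def scaleR_complex divide_inverse mult.commute)
qed

text \<open>In the trace of the new torsion, \<open>\<partial>g\<close> occurs once for each dimension with sign plus, and once with sign
  minus from the antisymmetrisation.\<close>

lemma theta_conformal:
  assumes g: "smooth_map_on g S" and x: "x \<in> S"
  shows "theta (\<lambda>y. exp (g y) *\<^sub>R H y) x v = theta H x v + (of_nat CARD('n) - 1) * fun_del (\<lambda>y. of_real (g y)) x v"
proof -
  let ?e = "complex_of_real (exp (g x))"
  let ?dg = "fun_del (\<lambda>y. complex_of_real (g y)) x"
  have dg: "g differentiable (at x)" by (rule smooth_map_onD(1)[OF g x])
  have sdg: "(\<lambda>y. complex_of_real (g y)) differentiable (at x)" by (rule smooth_map_onD(1)[OF smooth_of_real[OF open_S g] x])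
  have de: "(\<lambda>y. complex_of_real (exp (g y))) differentiable (at x)"
    by (rule smooth_map_onD(1)[OF smooth_of_real[OF open_S smooth_exp[OF open_S g]] x])
  note ds = sesq_gd(2)[OF diff_entry[OF x]]
  have T: "fun_del (\<lambda>y. sesq (exp (g y) *\<^sub>R H y) a b) x u = ?e * (?dg u * sesq (H x) a b + fun_del (\<lambda>y. sesq (H y) a b) x u)" for a b u
  proof -
    have "(\<lambda>y. sesq (exp (g y) *\<^sub>R H y) a b) = (\<lambda>y. complex_of_real (exp (g y)) * sesq (H y) a b)"
      by (simp add: fun_eq_iff sesq_def sum_distrib_left scaleR_complex mult_ac)
    then show ?thesis
      unfolding fun_del_gd using gd_mult[OF de ds] gd_exp[OF dg] by (simp add: algebra_simps)
  qed
  have h: "hup (exp (g x) *\<^sub>R H x) k l = hup (H x) k l / ?e" for k l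
    by (rule hup_scaleR[OF inv_H[OF x]]) simp
  have "theta (\<lambda>y. exp (g y) *\<^sub>R H y) x v = (\<Sum>k\<in>UNIV. \<Sum>l\<in>UNIV. hup (H x) k l *
     (torsion H x v (axis k 1) (axis l 1) + (?dg v * H x $ k $ l - ?dg (axis k 1) * sesq (H x) v (axis l 1))))"
    unfolding theta_def h torsion_def T
    by (intro sum.cong refl) (simp add: field_simps sesq_axis)
  also have "\<dots> = theta H x v + ((\<Sum>k\<in>UNIV. \<Sum>l\<in>UNIV. hup (H x) k l * (?dg v * H x $ k $ l))
      - (\<Sum>k\<in>UNIV. \<Sum>l\<in>UNIV. hup (H x) k l * (?dg (axis k 1) * sesq (H x) v (axis l 1))))"
    by (simp add: theta_def algebra_simps sum.distrib sum_subtractf)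
  also have "(\<Sum>k\<in>UNIV. \<Sum>l\<in>UNIV. hup (H x) k l * (?dg v * H x $ k $ l)) = of_nat CARD('n) * ?dg v"
  proof -
    have "(\<Sum>k\<in>UNIV. \<Sum>l\<in>UNIV. hup (H x) k l * (?dg v * H x $ k $ l)) = (\<Sum>k\<in>UNIV. (\<Sum>l\<in>UNIV. hup (H x) k l * H x $ k $ l) * ?dg v)"
      unfolding sum_distrib_right by (simp add: mult_ac)
    also have "\<dots> = (\<Sum>k\<in>(UNIV::'n set). ?dg v)" by (simp only: hup_contract(1)[OF inv_H[OF x]] refl if_True mult_1)
    finally show ?thesis by simp
  qed
  also have "(\<Sum>k\<in>UNIV. \<Sum>l\<in>UNIV. hup (H x) k l * (?dg (axis k 1) * sesq (H x) v (axis l 1))) = ?dg v"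
  proof -
    have sa: "sesq (H x) v (axis l 1) = (\<Sum>i\<in>UNIV. v $ i * H x $ i $ l)" for l
      by (simp add: sesq_def axis_def if_distrib[of cnj] if_distrib[of "\<lambda>x. _ * x"] cong: if_cong) (simp add: mult.commute)
    have "(\<Sum>k\<in>UNIV. \<Sum>l\<in>UNIV. hup (H x) k l * (?dg (axis k 1) * sesq (H x) v (axis l 1)))
       = (\<Sum>k\<in>UNIV. ?dg (axis k 1) * (\<Sum>i\<in>UNIV. v $ i * (\<Sum>l\<in>UNIV. hup (H x) k l * H x $ i $ l)))"
    proof (rule sum.cong[OF refl])
      fix k
      have "(\<Sum>l\<in>UNIV. hup (H x) k l * (?dg (axis k 1) * sesq (H x) v (axis l 1)))
         = ?dg (axis k 1) * (\<Sum>l\<in>UNIV. \<Sum>i\<in>UNIV. v $ i * (hup (H x) k l * H x $ i $ l))"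
        unfolding sa sum_distrib_left by (simp add: mult_ac)
      also have "(\<Sum>l\<in>UNIV. \<Sum>i\<in>UNIV. v $ i * (hup (H x) k l * H x $ i $ l)) = (\<Sum>i\<in>UNIV. v $ i * (\<Sum>l\<in>UNIV. hup (H x) k l * H x $ i $ l))"
        unfolding sum_distrib_left by (rule sum.swap)
      finally show "(\<Sum>l\<in>UNIV. hup (H x) k l * (?dg (axis k 1) * sesq (H x) v (axis l 1)))
         = ?dg (axis k 1) * (\<Sum>i\<in>UNIV. v $ i * (\<Sum>l\<in>UNIV. hup (H x) k l * H x $ i $ l))" .
    qed
    also have "\<dots> = (\<Sum>k\<in>UNIV. v $ k * dz k (\<lambda>y. complex_of_real (g y)) x)"
      by (simp add: hup_contract(1)[OF inv_H[OF x]] if_distrib[of "\<lambda>x. _ * x"] dz_def mult.commute cong: if_cong)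
    also have "\<dots> = ?dg v" by (rule fun_del_expand(1)[OF sdg, symmetric])
    finally show ?thesis .
  qed
  finally show ?thesis by (simp add: algebra_simps)
qed

text \<open>The potential \<open>u\<close> makes \<open>\<partial>\<close>-bar of \<open>\<theta>\<close> minus a complex Hessian. The conformal change by \<open>Re u / (n - 1)\<close> adds the
  Hessian of \<open>Re u\<close>, and the trace of the remaining Hessian of \<open>\<i> Im u\<close> is imaginary.\<close>

lemma conformal_trace_imaginary:
  assumes u: "smooth_map_on u S"
    and pot: "\<And>x v w. x \<in> S \<Longrightarrow> fun_delbar (\<lambda>y. theta H y w) x v = - fun_del (\<lambda>y. fun_delbar u y v) x w"
    and n: "CARD('n) \<noteq> 1" and x: "x \<in> S"
  defines "H' \<equiv> \<lambda>y. exp (Re (u y) / (real CARD('n) - 1)) *\<^sub>R H y"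
  shows "Re (\<Sum>k\<in>UNIV. \<Sum>l\<in>UNIV. hup (H' x) k l * dzbar l (\<lambda>y. theta H' y (axis k 1)) x) = 0"
proof -
  define g where "g y = Re (u y) / (real CARD('n) - 1)" for y
  have sg: "smooth_map_on g S"
    unfolding g_def[abs_def] using n by (intro smooth_divide smooth_Re smooth_const u open_S) simp
  interpret C: metric_chart S H' unfolding H'_def using conformal_metric_chart[OF sg] by (simp add: g_def)
  have su: "smooth_map_on (\<lambda>y. complex_of_real (Re (u y))) S" "smooth_map_on (\<lambda>y. complex_of_real (Im (u y))) S"
    by (intro smooth_of_real smooth_Re smooth_Im u open_S)+
  have s1: "smooth_map_on (\<lambda>y. fun_del f y w) S" if "smooth_map_on f S" for f w
    unfolding fun_del_gd by (rule smooth_gd[OF open_S that])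
  have comm: "fun_del (\<lambda>y. fun_delbar f y v) x w = fun_delbar (\<lambda>y. fun_del f y w) x v" if "smooth_map_on f S" for f v w
    unfolding fun_del_gd fun_delbar_gd by (rule gd_commute[OF open_S x that])
  define L where "L v w = fun_delbar (\<lambda>y. fun_del (\<lambda>z. complex_of_real (Im (u z))) y w) x v" for v w
  have th: "theta H' y w = theta H y w + fun_del (\<lambda>z. complex_of_real (Re (u z))) y w" if y: "y \<in> S" for y w
  proof -
    have "(\<lambda>z. complex_of_real (g z)) = (\<lambda>z. 1 / (of_nat CARD('n) - 1) * complex_of_real (Re (u z)))"
      by (simp add: g_def fun_eq_iff)
    then have "fun_del (\<lambda>z. complex_of_real (g z)) y w = 1 / (of_nat CARD('n) - 1) * fun_del (\<lambda>z. complex_of_real (Re (u z))) y w"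
      using gd_cmult[OF smooth_map_onD(1)[OF su(1) y], of "1/2" "- \<i>/2" "1 / (of_nat CARD('n) - 1)" w] by (simp add: fun_del_gd)
    moreover have "complex_of_nat CARD('n) - 1 \<noteq> 0" using n by (simp add: of_nat_eq_1_iff)
    ultimately show ?thesis
      using theta_conformal[OF sg y, of w] by (simp add: H'_def g_def)
  qed
  have ind: "fun_delbar (\<lambda>y. theta H' y w) x v = - \<i> * L v w" for v w
  proof -
    have "fun_delbar (\<lambda>y. theta H' y w) x v = fun_delbar (\<lambda>y. theta H y w + fun_del (\<lambda>z. complex_of_real (Re (u z))) y w) x v"
      unfolding fun_delbar_gd by (rule gd_cong[OF open_S x th])
    also have "\<dots> = fun_delbar (\<lambda>y. theta H y w) x v + fun_delbar (\<lambda>y. fun_del (\<lambda>z. complex_of_real (Re (u z))) y w) x v"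
      using gd_add[OF diff_theta[OF x] smooth_map_onD(1)[OF s1[OF su(1)] x]] by (simp add: fun_delbar_gd)
    also have "fun_delbar (\<lambda>y. theta H y w) x v = - (fun_delbar (\<lambda>y. fun_del (\<lambda>z. complex_of_real (Re (u z))) y w) x v + \<i> * L v w)"
    proof -
      have e: "fun_del u y w = fun_del (\<lambda>z. complex_of_real (Re (u z))) y w + \<i> * fun_del (\<lambda>z. complex_of_real (Im (u z))) y w" if y: "y \<in> S" for y
      proof -
        have "u = (\<lambda>z. complex_of_real (Re (u z)) + \<i> * complex_of_real (Im (u z)))" by (simp add: fun_eq_iff complex_eq)
        then have "fun_del u y w = fun_del (\<lambda>z. complex_of_real (Re (u z)) + \<i> * complex_of_real (Im (u z))) y w" by metis
        also have "\<dots> = fun_del (\<lambda>z. complex_of_real (Re (u z))) y w + \<i> * fun_del (\<lambda>z. complex_of_real (Im (u z))) y w"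
          unfolding fun_del_gd
          by (subst gd_add) (auto intro!: differentiable_mult differentiable_const smooth_map_onD(1)[OF su(1) y] smooth_map_onD(1)[OF su(2) y]
              simp: gd_cmult[OF smooth_map_onD(1)[OF su(2) y]])
        finally show ?thesis .
      qed
      have "fun_delbar (\<lambda>y. fun_del u y w) x v = fun_delbar (\<lambda>y. fun_del (\<lambda>z. complex_of_real (Re (u z))) y w + \<i> * fun_del (\<lambda>z. complex_of_real (Im (u z))) y w) x v"
        unfolding fun_delbar_gd by (rule gd_cong[OF open_S x e])
      also have "\<dots> = fun_delbar (\<lambda>y. fun_del (\<lambda>z. complex_of_real (Re (u z))) y w) x v + \<i> * L v w"
        unfolding fun_delbar_gd L_def
        by (subst gd_add) (auto intro!: differentiable_mult differentiable_const smooth_map_onD(1)[OF s1[OF su(1)] x] smooth_map_onD(1)[OF s1[OF su(2)] x]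
              simp: gd_cmult[OF smooth_map_onD(1)[OF s1[OF su(2)] x]])
      finally show ?thesis unfolding pot[OF x] comm[OF u] by simp
    qed
    finally show ?thesis by simp
  qed
  have Lc: "cnj (L v w) = L w v" for v w
  proof -
    let ?i = "\<lambda>z. complex_of_real (Im (u z))"
    have "cnj (L v w) = fun_del (\<lambda>y. cnj (fun_del ?i y w)) x v"
      unfolding L_def by (rule fun_del_cnj(1)[OF smooth_map_onD(1)[OF s1[OF su(2)] x], symmetric])
    also have "\<dots> = fun_del (\<lambda>y. fun_delbar ?i y w) x v"
    proof -
      have "cnj (fun_del ?i y w) = fun_delbar ?i y w" if "y \<in> S" for y
        using fun_del_cnj(2)[OF smooth_map_onD(1)[OF su(2) that], of w] by simp
      then show ?thesis by (rule wirtinger_cong[OF open_S x])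
    qed
    finally show ?thesis unfolding comm[OF su(2)] L_def .
  qed
  let ?s = "\<Sum>k\<in>UNIV. \<Sum>l\<in>UNIV. hup (H' x) k l * L (axis l 1) (axis k 1)"
  have "cnj ?s = (\<Sum>k\<in>UNIV. \<Sum>l\<in>UNIV. hup (H' x) l k * L (axis k 1) (axis l 1))"
    by (simp add: Lc cnj_hup[OF C.posdef[OF x]])
  also have "\<dots> = ?s" by (rule sum.swap)
  finally have "cnj ?s = ?s" .
  moreover have "Im z = 0" if "cnj z = z" for z using that by (simp add: complex_eq_iff)
  ultimately have "Im ?s = 0" by blast
  moreover have "(\<Sum>k\<in>UNIV. \<Sum>l\<in>UNIV. hup (H' x) k l * dzbar l (\<lambda>y. theta H' y (axis k 1)) x) = - \<i> * ?s"
    unfolding dzbar_def ind by (simp add: sum_distrib_left mult_ac)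
  ultimately show ?thesis by simp
qed

end

section \<open>Changes of coordinates\<close>

lemma complex_linear_matrix:
  fixes J :: "complex^'n \<Rightarrow> complex^'n"
  assumes "linear J" "\<And>c v. J (c *s v) = c *s J v"
  shows "J v = matrix J *v v"
proof -
  have "J v = J (\<Sum>i\<in>UNIV. v $ i *s axis i 1)" by (simp add: basis_expansion)
  also have "\<dots> = (\<Sum>i\<in>UNIV. v $ i *s J (axis i 1))" by (simp only: linear_sum[OF assms(1)] assms(2))
  also have "\<dots> = matrix J *v v"
    by (simp add: vec_eq_iff matrix_def matrix_vector_mult_def mult.commute)
  finally show ?thesis .
qed

lemma differentiable_of_real:
  "f differentiable (at x) \<Longrightarrow> (\<lambda>y. complex_of_real (f y)) differentiable (at x)"
  unfolding differentiable_def using bounded_linear.has_derivative[OF bounded_linear_of_real] by blast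

lemma sesquilinear_eq_sesq:
  fixes f :: "complex^'n::finite \<Rightarrow> complex^'n \<Rightarrow> complex"
  assumes l: "\<And>c v v' w. f (c *s v + v') w = c * f v w + f v' w"
    and r: "\<And>c v w w'. f v (c *s w + w') = cnj c * f v w + f v w'"
  shows "sesq (\<chi> k l. f (axis k 1) (axis l 1)) v w = f v w"
proof -
  have z: "f 0 w = 0" "f v 0 = 0" for v w using l[of "-1" 0 0 w] r[of v "-1" 0 0] by simp_all
  have L: "f (\<Sum>i\<in>I. v $ i *s axis i 1) w = (\<Sum>i\<in>I. v $ i * f (axis i 1) w)" if "finite I" for I v w
    using that by (induction I rule: finite_induct) (simp_all add: z l)
  have R: "f v (\<Sum>i\<in>I. w $ i *s axis i 1) = (\<Sum>i\<in>I. cnj (w $ i) * f v (axis i 1))" if "finite I" for I v w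
    using that by (induction I rule: finite_induct) (simp_all add: z r)
  have "f v w = (\<Sum>i\<in>UNIV. v $ i * f (axis i 1) w)"
    using L[where I = UNIV and v = v and w = w, OF finite] by (simp only: basis_expansion)
  also have "\<dots> = (\<Sum>i\<in>UNIV. v $ i * (\<Sum>j\<in>UNIV. cnj (w $ j) * f (axis i 1) (axis j 1)))"
  proof (rule sum.cong[OF refl])
    show "v $ i * f (axis i 1) w = v $ i * (\<Sum>j\<in>UNIV. cnj (w $ j) * f (axis i 1) (axis j 1))" for i
      using R[where I = UNIV and v = "axis i 1" and w = w, OF finite] by (simp only: basis_expansion)
  qed
  also have "\<dots> = sesq (\<chi> k l. f (axis k 1) (axis l 1)) v w"
    by (simp add: sesq_def sum_distrib_left mult_ac)
  finally show ?thesis ..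
qed

text \<open>Two coordinate expressions of one Hermitian metric. The last assumption forces the differential of \<open>t\<close> to be
  invertible, as \<open>H x\<close> is nondegenerate.\<close>

locale metric_transition = src: metric_chart S H + tgt: metric_chart S' H'
  for S :: "(complex^'n::finite) set" and H and S' :: "(complex^'n) set" and H' +
  fixes W :: "(complex^'n) set" and t :: "complex^'n \<Rightarrow> complex^'n"
  assumes open_W: "open W" and W_S: "W \<subseteq> S" and t_S': "x \<in> W \<Longrightarrow> t x \<in> S'"
    and hol: "holomorphic_map_on t W"
    and metric: "x \<in> W \<Longrightarrow> sesq (H x) v w = sesq (H' (t x)) (frechet_derivative t (at x) v) (frechet_derivative t (at x) w)"
begin

abbreviation J :: "complex^'n \<Rightarrow> complex^'n \<Rightarrow> complex^'n" where
  "J x \<equiv> frechet_derivative t (at x)"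

lemma smooth_t: "smooth_map_on t W"
  using hol by (simp add: holomorphic_map_on_def)

lemma J_scale: "x \<in> W \<Longrightarrow> J x (c *s v) = c *s J x v"
  using hol by (simp add: holomorphic_map_on_def)

lemma dt: "x \<in> W \<Longrightarrow> t differentiable (at x)"
  by (rule smooth_map_onD(1)[OF smooth_t])

lemma J_linear: "x \<in> W \<Longrightarrow> linear (J x)"
  using dt frechet_derivative_works has_derivative_linear by blast

lemma J_comb: "x \<in> W \<Longrightarrow> J x (c *s v + w) = c *s J x v + J x w"
  by (simp only: linear_add[OF J_linear] J_scale)

lemma J_matrix: "x \<in> W \<Longrightarrow> J x v = matrix (J x) *v v"
  by (rule complex_linear_matrix[OF J_linear J_scale])

lemma inW: "x \<in> W \<Longrightarrow> x \<in> S" using W_S by blast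

lemma gd_pullback:
  assumes "x \<in> W" "f differentiable (at (t x))"
  shows "gd a b (\<lambda>y. f (t y)) x v = gd a b f (t x) (J x v)" "(\<lambda>y. f (t y)) differentiable (at x)"
proof -
  show "gd a b (\<lambda>y. f (t y)) x v = gd a b f (t x) (J x v)"
    by (rule gd_compose_holomorphic[OF dt assms(2) J_scale]) (fact assms(1))+
  show "(\<lambda>y. f (t y)) differentiable (at x)"
    using differentiable_chain_at[OF dt[OF assms(1)] assms(2)] by (simp add: o_def)
qed

text \<open>The second derivative of \<open>t\<close> is symmetric and, \<open>t\<close> being holomorphic, complex bilinear. This is why it drops out
  of the transformation laws of the torsion and of \<open>d\<theta>\<close>.\<close>

definition hess :: "complex^'n \<Rightarrow> complex^'n \<Rightarrow> complex^'n \<Rightarrow> complex^'n" where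
  "hess x u v = frechet_derivative (\<lambda>y. J y v) (at x) u"

lemma smooth_J: "smooth_map_on (\<lambda>y. J y v $ i) W"
  by (intro smooth_nth smooth_map_onD(4) smooth_t open_W)

lemma hess_symmetric: "x \<in> W \<Longrightarrow> hess x u v = hess x v u"
  unfolding hess_def by (rule second_derivative_symmetric[OF open_W _ smooth_t])

lemma fun_d_J: "x \<in> W \<Longrightarrow> fun_d (\<lambda>y. J y v $ i) x u = hess x u v $ i"
  unfolding fun_d_def hess_def
  by (rule frechet_derivative_linear_compose[OF bounded_linear_vec_nth smooth_map_onD(1)[OF smooth_map_onD(4)[OF smooth_t]]])

lemma hess_scale:
  assumes x: "x \<in> W"
  shows "hess x (\<i> *s u) v = \<i> *s hess x u v"
proof -
  have "hess x (\<i> *s u) v $ i = \<i> * hess x u v $ i" for i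
  proof -
    have d: "(\<lambda>y. J y u $ i) differentiable (at x)" by (rule smooth_map_onD(1)[OF smooth_J x])
    have "hess x (\<i> *s u) v $ i = fun_d (\<lambda>y. J y (\<i> *s u) $ i) x v"
      by (simp only: hess_symmetric[OF x] fun_d_J[OF x])
    also have "\<dots> = fun_d (\<lambda>y. \<i> * J y u $ i) x v"
      unfolding fun_d_gd by (rule gd_cong[OF open_W x]) (simp add: J_scale)
    also have "\<dots> = \<i> * fun_d (\<lambda>y. J y u $ i) x v" unfolding fun_d_gd by (rule gd_cmult[OF d])
    finally show ?thesis by (simp only: fun_d_J[OF x] hess_symmetric[OF x, of u])
  qed
  then show ?thesis by (simp add: vec_eq_iff)
qed

lemma fun_del_J:
  assumes x: "x \<in> W"
  shows "fun_del (\<lambda>y. J y v $ i) x u = hess x u v $ i" "fun_delbar (\<lambda>y. J y v $ i) x u = 0"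
  by (simp_all add: fun_del_def fun_delbar_def fun_d_J[OF x] hess_scale[OF x] mult.assoc[symmetric])

text \<open>The second derivatives of \<open>t\<close> enter the first derivatives of the metric symmetrically, so they cancel
  in the torsion.\<close>

lemma torsion_transform:
  assumes x: "x \<in> W"
  shows "torsion H x u v w = torsion H' (t x) (J x u) (J x v) (J x w)"
proof -
  let ?z = "t x"
  note zS = t_S'[OF x]
  have key: "fun_del (\<lambda>y. sesq (H y) v w) x u = fun_del (\<lambda>z. sesq (H' z) (J x v) (J x w)) ?z (J x u) + sesq (H' ?z) (hess x u v) (J x w)" for u v
  proof -
    have dH: "(\<lambda>y. H' (t y) $ i $ j) differentiable (at x)" for i j by (rule gd_pullback(2)[OF x tgt.diff_entry[OF zS]])
    have dJ: "(\<lambda>y. J y v $ i) differentiable (at x)" for v i by (rule smooth_map_onD(1)[OF smooth_J x])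
    have dc: "(\<lambda>y. cnj (J y w $ j)) differentiable (at x)" for j by (rule smooth_map_onD(1)[OF smooth_cnj[OF open_W smooth_J] x])
    have trm: "fun_del (\<lambda>y. H' (t y) $ i $ j * J y v $ i * cnj (J y w $ j)) x u =
       fun_del (\<lambda>z. H' z $ i $ j) ?z (J x u) * J x v $ i * cnj (J x w $ j) + H' ?z $ i $ j * hess x u v $ i * cnj (J x w $ j)" for i j
    proof -
      have "fun_del (\<lambda>y. H' (t y) $ i $ j * J y v $ i * cnj (J y w $ j)) x u
         = (fun_del (\<lambda>y. H' (t y) $ i $ j) x u * J x v $ i + H' ?z $ i $ j * fun_del (\<lambda>y. J y v $ i) x u) * cnj (J x w $ j)
           + H' ?z $ i $ j * J x v $ i * fun_del (\<lambda>y. cnj (J y w $ j)) x u"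
        unfolding fun_del_gd gd_mult[OF differentiable_mult[OF dH dJ] dc] gd_mult[OF dH dJ] ..
      also have "fun_del (\<lambda>y. H' (t y) $ i $ j) x u = fun_del (\<lambda>z. H' z $ i $ j) ?z (J x u)"
        unfolding fun_del_gd by (rule gd_pullback(1)[OF x tgt.diff_entry[OF zS]])
      finally show ?thesis by (simp add: fun_del_cnj(1)[OF dJ] fun_del_J[OF x] algebra_simps)
    qed
    have dt3: "(\<lambda>y. H' (t y) $ i $ j * J y v $ i * cnj (J y w $ j)) differentiable (at x)" for i j
      by (intro differentiable_mult dH dJ dc)
    have "fun_del (\<lambda>y. sesq (H y) v w) x u = fun_del (\<lambda>y. \<Sum>i\<in>UNIV. \<Sum>j\<in>UNIV. H' (t y) $ i $ j * J y v $ i * cnj (J y w $ j)) x u"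
      by (rule wirtinger_cong[OF open_W x], simp only: metric, simp only: sesq_def)
    also have "\<dots> = (\<Sum>i\<in>UNIV. \<Sum>j\<in>UNIV. fun_del (\<lambda>y. H' (t y) $ i $ j * J y v $ i * cnj (J y w $ j)) x u)"
    proof -
      have "(\<lambda>y. \<Sum>j\<in>UNIV. H' (t y) $ i $ j * J y v $ i * cnj (J y w $ j)) differentiable (at x)" for i
        by (intro differentiable_sum ballI finite dt3)
      then show ?thesis unfolding fun_del_gd by (simp only: gd_sum dt3)
    qed
    also have "\<dots> = sesq (\<chi> k l. fun_del (\<lambda>z. H' z $ k $ l) ?z (J x u)) (J x v) (J x w) + sesq (H' ?z) (hess x u v) (J x w)"
      unfolding trm by (simp add: sesq_def sum.distrib)
    also have "sesq (\<chi> k l. fun_del (\<lambda>z. H' z $ k $ l) ?z (J x u)) (J x v) (J x w) = fun_del (\<lambda>z. sesq (H' z) (J x v) (J x w)) ?z (J x u)"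
      unfolding fun_del_gd by (rule sesq_gd(1)[OF tgt.diff_entry[OF zS], symmetric])
    finally show ?thesis .
  qed
  show ?thesis unfolding torsion_def key hess_symmetric[OF x, of v u] by simp
qed

lemma trace_transform:
  assumes x: "x \<in> W"
    and l: "\<And>c v v' w. f (c *s v + v') w = c * f v w + f v' w" and r: "\<And>c v w w'. f v (c *s w + w') = cnj c * f v w + f v w'"
    and l': "\<And>c v v' w. f' (c *s v + v') w = c * f' v w + f' v' w" and r': "\<And>c v w w'. f' v (c *s w + w') = cnj c * f' v w + f' v w'"
    and eq: "\<And>v w. f v w = f' (J x v) (J x w)"
  shows "(\<Sum>k\<in>UNIV. \<Sum>l\<in>UNIV. hup (H x) k l * f (axis k 1) (axis l 1)) = (\<Sum>k\<in>UNIV. \<Sum>l\<in>UNIV. hup (H' (t x)) k l * f' (axis k 1) (axis l 1))"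
proof -
  let ?N = "\<chi> k l. f (axis k 1) (axis l 1)" and ?N' = "\<chi> k l. f' (axis k 1) (axis l 1)"
  have N: "sesq ?N v w = sesq ?N' (matrix (J x) *v v) (matrix (J x) *v w)" for v w
  proof -
    have "sesq ?N v w = f v w" by (rule sesquilinear_eq_sesq; fact l r)
    also have "\<dots> = f' (J x v) (J x w)" by (rule eq)
    also have "\<dots> = sesq ?N' (J x v) (J x w)" by (rule sesquilinear_eq_sesq[symmetric]; fact l' r')
    finally show ?thesis unfolding J_matrix[OF x, of v] J_matrix[OF x, of w] .
  qed
  have M: "sesq (H x) v w = sesq (H' (t x)) (matrix (J x) *v v) (matrix (J x) *v w)" for v w
    unfolding J_matrix[OF x, symmetric] by (rule metric[OF x])
  have "(\<Sum>k\<in>UNIV. \<Sum>l\<in>UNIV. hup (H x) k l * ?N $ k $ l) = (\<Sum>k\<in>UNIV. \<Sum>l\<in>UNIV. hup (H' (t x)) k l * ?N' $ k $ l)"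
    by (rule hup_trace_invariant[OF M N src.inv_H[OF inW[OF x]] tgt.inv_H[OF t_S'[OF x]]])
  then show ?thesis by (simp only: vec_lambda_beta)
qed

lemma theta_transform:
  assumes x: "x \<in> W"
  shows "theta H x v = theta H' (t x) (J x v)"
  unfolding theta_def
  by (rule trace_transform[OF x, of "torsion H x v" "torsion H' (t x) (J x v)"])
     (simp_all only: src.torsion_linear[OF inW[OF x]] tgt.torsion_linear[OF t_S'[OF x]] torsion_transform[OF x] J_comb[OF x])

lemma energy_transform:
  assumes x: "x \<in> W"
  shows "src.energy x = tgt.energy (t x)"
  unfolding src.energy_def tgt.energy_def mult.assoc
  by (rule arg_cong[of _ _ Re], rule trace_transform[OF x, of "\<lambda>v w. theta H x v * cnj (theta H x w)" "\<lambda>v w. theta H' (t x) v * cnj (theta H' (t x) w)"],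
      simp_all only: src.theta_linear[OF inW[OF x]] tgt.theta_linear[OF t_S'[OF x]] theta_transform[OF x] J_comb[OF x] complex_cnj_add complex_cnj_mult, simp_all only: algebra_simps)

lemma pairing_transform:
  assumes x: "x \<in> W" and \<rho>: "\<rho> differentiable (at x)" "\<rho>' differentiable (at (t x))" and eq: "\<And>y. y \<in> W \<Longrightarrow> \<rho> y = \<rho>' (t y)"
  shows "src.pairing \<rho> x = tgt.pairing \<rho>' (t x)"
proof -
  have c: "(\<lambda>y. complex_of_real (\<rho> y)) differentiable (at x)" "(\<lambda>y. complex_of_real (\<rho>' y)) differentiable (at (t x))"
    using \<rho> by (simp_all add: differentiable_of_real)
  have e: "fun_delbar (\<lambda>y. complex_of_real (\<rho> y)) x v = fun_delbar (\<lambda>y. complex_of_real (\<rho>' y)) (t x) (J x v)" for v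
  proof -
    have "fun_delbar (\<lambda>y. complex_of_real (\<rho> y)) x v = fun_delbar (\<lambda>y. complex_of_real (\<rho>' (t y))) x v"
      by (rule wirtinger_cong[OF open_W x]) (simp add: eq)
    also have "\<dots> = fun_delbar (\<lambda>y. complex_of_real (\<rho>' y)) (t x) (J x v)"
      unfolding fun_delbar_gd by (rule gd_pullback(1)[OF x c(2)])
    finally show ?thesis .
  qed
  have l: "fun_delbar f z (a *s v + w) = cnj a * fun_delbar f z v + fun_delbar f z w" if "f differentiable (at z)" for f and z v w :: "complex^'n" and a
    using linear_add[OF gd_linear[OF that, of "1/2" "\<i>/2"]] fun_del_scale(2)[OF that] by (simp add: fun_delbar_gd)
  show ?thesis
    unfolding src.pairing_def tgt.pairing_def dzbar_def mult.assoc
    by (rule arg_cong[of _ _ Re], rule trace_transform[OF x, of "\<lambda>v w. theta H x v * fun_delbar (\<lambda>y. of_real (\<rho> y)) x w"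
          "\<lambda>v w. theta H' (t x) v * fun_delbar (\<lambda>y. of_real (\<rho>' y)) (t x) w"],
        simp_all only: src.theta_linear[OF inW[OF x]] tgt.theta_linear[OF t_S'[OF x]] theta_transform[OF x] J_comb[OF x] e l[OF c(1)] l[OF c(2)], simp_all only: algebra_simps)
qed

lemma d_theta_transform:
  assumes x: "x \<in> W"
  shows "form_d (theta_form H) x [v, w] = form_d (theta_form H') (t x) [J x v, J x w]"
proof -
  note zS = t_S'[OF x]
  have key: "fun_d (\<lambda>y. theta H y w) x v = fun_d (\<lambda>z. theta H' z (J x w)) (t x) (J x v) + theta H' (t x) (hess x v w)" for v w
  proof -
    have dth: "(\<lambda>y. theta H' (t y) (axis k 1)) differentiable (at x)" for k
      by (rule gd_pullback(2)[OF x tgt.diff_theta[OF zS]])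
    have dJ: "(\<lambda>y. J y w $ k) differentiable (at x)" for k by (rule smooth_map_onD(1)[OF smooth_J x])
    have "fun_d (\<lambda>y. theta H y w) x v = fun_d (\<lambda>y. \<Sum>k\<in>UNIV. J y w $ k * theta H' (t y) (axis k 1)) x v"
      unfolding fun_d_gd by (rule gd_cong[OF open_W x]) (simp add: theta_transform tgt.theta_expand[OF t_S', symmetric])
    also have "\<dots> = (\<Sum>k\<in>UNIV. fun_d (\<lambda>y. J y w $ k * theta H' (t y) (axis k 1)) x v)"
      by (intro fun_d_rules(5) differentiable_mult dth dJ)
    also have "\<dots> = (\<Sum>k\<in>UNIV. hess x v w $ k * theta H' (t x) (axis k 1) + J x w $ k * fun_d (\<lambda>z. theta H' z (axis k 1)) (t x) (J x v))"
    proof (rule sum.cong[OF refl])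
      fix k
      have "fun_d (\<lambda>y. theta H' (t y) (axis k 1)) x v = fun_d (\<lambda>z. theta H' z (axis k 1)) (t x) (J x v)"
        unfolding fun_d_gd by (rule gd_pullback(1)[OF x tgt.diff_theta[OF zS]])
      then show "fun_d (\<lambda>y. J y w $ k * theta H' (t y) (axis k 1)) x v
         = hess x v w $ k * theta H' (t x) (axis k 1) + J x w $ k * fun_d (\<lambda>z. theta H' z (axis k 1)) (t x) (J x v)"
        by (simp add: fun_d_rules(4)[OF dJ dth] fun_d_J[OF x])
    qed
    also have "\<dots> = theta H' (t x) (hess x v w) + (\<Sum>k\<in>UNIV. J x w $ k * fun_d (\<lambda>z. theta H' z (axis k 1)) (t x) (J x v))"
      unfolding tgt.theta_expand[OF zS, of "hess x v w"] by (rule sum.distrib)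
    also have "(\<Sum>k\<in>UNIV. J x w $ k * fun_d (\<lambda>z. theta H' z (axis k 1)) (t x) (J x v)) = fun_d (\<lambda>z. theta H' z (J x w)) (t x) (J x v)"
      unfolding fun_d_gd by (rule gd_lincomb[OF tgt.open_S zS tgt.theta_expand tgt.diff_theta[OF zS], symmetric])
    finally show ?thesis by simp
  qed
  show ?thesis unfolding src.form_d_theta_form tgt.form_d_theta_form key hess_symmetric[OF x, of w v] by simp
qed

lemma vdens_transition:
  assumes x: "x \<in> W"
  shows "vdens (H x) = \<bar>det (rmat (J x))\<bar> * vdens (H' (t x))"
  by (rule vdens_transform[OF J_linear[OF x] metric[OF x] src.inv_H[OF inW[OF x]] tgt.inv_H[OF t_S'[OF x]]])

text \<open>The determinant of the metric transforms like the inverse of a metric on the canonical bundle.\<close>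

lemma det_transition:
  assumes x: "x \<in> W"
  shows "Re (det (H x)) = (cmod (det (matrix (J x))))\<^sup>2 * Re (det (H' (t x)))"
proof -
  have "sesq (H x) v w = sesq (H' (t x)) (matrix (J x) *v v) (matrix (J x) *v w)" for v w
    by (subst metric[OF x]) (simp only: J_matrix[OF x, symmetric])
  then have "H x = transpose (matrix (J x)) ** H' (t x) ** (\<chi> i j. cnj (matrix (J x) $ i $ j))"
    by (rule sesq_pullback_matrix)
  then have "det (H x) = det (matrix (J x)) * det (H' (t x)) * det (\<chi> i j. cnj (matrix (J x) $ i $ j))"
    by (simp add: det_mul det_transpose)
  also have "det (\<chi> i j. cnj (matrix (J x) $ i $ j)) = cnj (det (matrix (J x)))"
    by (simp add: det_def)
  finally have "det (H x) = of_real ((cmod (det (matrix (J x))))\<^sup>2) * det (H' (t x))"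
    by (simp only: complex_norm_square mult_ac)
  then show ?thesis by simp
qed

end

section \<open>Globalisation\<close>

lemma metric_chart_of_metric:
  assumes "complex_manifold X A" "hermitian_metric A h" "c \<in> A"
  shows "metric_chart (cimage c) (h c)"
  using assms chart_bij(3)[OF complex_manifoldD(1)[OF assms(1,3)]]
  by (auto simp: hermitian_metric_def intro!: metric_chart.intro)

lemma metric_transition_of_metric:
  assumes M: "complex_manifold X A" and h: "hermitian_metric A h" and c: "c \<in> A" "c' \<in> A"
  shows "metric_transition (cimage c) (h c) (cimage c') (h c') (overlap c c') (transition c c')"
proof -
  note ch = complex_manifoldD(1)[OF M c(1)] complex_manifoldD(1)[OF M c(2)]
  note ov = overlap_facts[OF ch]
  have "metric_transition_axioms (cimage c) (h c) (cimage c') (h c') (overlap c c') (transition c c')"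
  proof
    show "open (overlap c c')" by (rule open_overlap[OF ch])
    show "overlap c c' \<subseteq> cimage c" using ov(5) by blast
    show "transition c c' x \<in> cimage c'" if "x \<in> overlap c c'" for x by (rule ov(6)[OF that])
    show "holomorphic_map_on (transition c c') (overlap c c')" by (rule complex_manifoldD(4)[OF M c])
    show "sesq (h c x) v w = sesq (h c' (transition c c' x)) (frechet_derivative (transition c c') (at x) v) (frechet_derivative (transition c c') (at x) w)"
      if "x \<in> overlap c c'" for x v w using h c that unfolding hermitian_metric_def by blast
  qed
  then show ?thesis
    using metric_chart_of_metric[OF M h c(1)] metric_chart_of_metric[OF M h c(2)]
    by (simp only: metric_transition_def)
qed

lemma global_form_theta_d:
  assumes M: "complex_manifold X A" and h: "hermitian_metric A h"
  shows "global_form A (\<lambda>c. theta_form (h c))" "global_form A (\<lambda>c. form_d (theta_form (h c)))"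
proof -
  have len1: "\<exists>v. vs = [v] \<or> length vs \<noteq> 1" and len2: "\<exists>v w. vs = [v, w] \<or> length vs \<noteq> 2" for vs :: "(complex^'b) list"
    by (cases vs; cases "tl vs"; auto simp: length_Suc_conv numeral_2_eq_2)+
  show "global_form A (\<lambda>c. theta_form (h c))"
    unfolding global_form_def
  proof (intro conjI ballI allI)
    fix c assume "c \<in> A"
    then interpret metric_chart "cimage c" "h c" by (rule metric_chart_of_metric[OF M h])
    show "form_on (cimage c) (theta_form (h c))" by (rule form_on_theta)
  next
    fix c c' x vs assume c: "c \<in> A" "c' \<in> A" and x: "x \<in> overlap c c'"
    interpret metric_transition "cimage c" "h c" "cimage c'" "h c'" "overlap c c'" "transition c c'"
      by (rule metric_transition_of_metric[OF M h c])
    show "theta_form (h c) x vs = theta_form (h c') (transition c c' x) (map (J x) vs)"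
      using theta_transform[OF x] by (auto simp: theta_form_def split: list.split)
  qed
  show "global_form A (\<lambda>c. form_d (theta_form (h c)))"
    unfolding global_form_def
  proof (intro conjI ballI allI)
    fix c assume "c \<in> A"
    then interpret metric_chart "cimage c" "h c" by (rule metric_chart_of_metric[OF M h])
    show "form_on (cimage c) (form_d (theta_form (h c)))" by (rule form_on_theta_d)
  next
    fix c c' x and vs :: "(complex^'b) list" assume c: "c \<in> A" "c' \<in> A" and x: "x \<in> overlap c c'"
    interpret metric_transition "cimage c" "h c" "cimage c'" "h c'" "overlap c c'" "transition c c'"
      by (rule metric_transition_of_metric[OF M h c])
    show "form_d (theta_form (h c)) x vs = form_d (theta_form (h c')) (transition c c' x) (map (J x) vs)"
    proof (cases "length vs = 2")
      case True
      then obtain v w where "vs = [v, w]" using len2 by blast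
      then show ?thesis using d_theta_transform[OF x] by simp
    next
      case False
      then show ?thesis using of_degree_d_theta_form[of "h c" x] of_degree_d_theta_form[of "h c'" "transition c c' x"]
        by (simp add: of_degree_def)
    qed
  qed
qed

text \<open>The form \<open>d\<theta>\<close> is global and exact, and by Ricci-flatness it is closed under \<open>\<partial>\<close> and \<open>\<partial>\<close>-bar. The function \<open>u\<close> is
  the component of degree 0 of the form that the \<open>\<partial>\<partial>\<close>-bar lemma provides.\<close>

lemma ddbar_potential:
  fixes A :: "('p, 'n::finite) chart set"
  assumes M: "complex_manifold X A" and h: "hermitian_metric A h"
    and flat: "levi_civita_ricci_flat A h" and ddbar: "ddbar_lemma A"
  obtains u where "\<And>c. c \<in> A \<Longrightarrow> smooth_map_on (u c) (cimage c)"
    "\<And>c c' x. c \<in> A \<Longrightarrow> c' \<in> A \<Longrightarrow> x \<in> overlap c c' \<Longrightarrow> u c x = u c' (transition c c' x)"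
    "\<And>c x v w. c \<in> A \<Longrightarrow> x \<in> cimage c \<Longrightarrow> fun_delbar (\<lambda>y. theta (h c) y w) x v = - fun_del (\<lambda>y. fun_delbar (u c) y v) x w"
proof -
  let ?\<eta> = "\<lambda>c. form_d (theta_form (h c))"
  have fl: "lc_ricci (h c) y = (\<lambda>vs. 0)" if "c \<in> A" "y \<in> cimage c" for c y
    using flat that by (simp add: levi_civita_ricci_flat_def forms_eq_def)
  have closed: "form_del (?\<eta> c) x = (\<lambda>vs. 0)" "form_delbar (?\<eta> c) x = (\<lambda>vs. 0)" if c: "c \<in> A" and x: "x \<in> cimage c" for c x
  proof -
    interpret metric_chart "cimage c" "h c" by (rule metric_chart_of_metric[OF M h c])
    show "form_del (?\<eta> c) x = (\<lambda>vs. 0)" "form_delbar (?\<eta> c) x = (\<lambda>vs. 0)"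
      using d_theta_closed[OF x fl[OF c]] by auto
  qed
  have "\<exists>\<gamma>. global_form A \<gamma> \<and> forms_eq A ?\<eta> (\<lambda>c. form_del (form_delbar (\<gamma> c)))"
  proof (rule ddbar[unfolded ddbar_lemma_def, rule_format], intro conjI exI[of _ "\<lambda>c. theta_form (h c)"])
    show "global_form A ?\<eta>" "global_form A (\<lambda>c. theta_form (h c))" by (rule global_form_theta_d[OF M h])+
    show "forms_eq A (\<lambda>c. form_del (?\<eta> c)) zero_forms" "forms_eq A (\<lambda>c. form_delbar (?\<eta> c)) zero_forms"
      by (simp_all add: forms_eq_def closed)
  qed (simp add: forms_eq_def)
  then obtain \<gamma> where \<gamma>: "global_form A \<gamma>" "forms_eq A ?\<eta> (\<lambda>c. form_del (form_delbar (\<gamma> c)))" by blast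
  show ?thesis
  proof (rule that[of "\<lambda>c x. \<gamma> c x []"])
    show s: "smooth_map_on (\<lambda>x. \<gamma> c x []) (cimage c)" if "c \<in> A" for c
      using \<gamma>(1) that by (simp add: global_form_def form_on_def)
    show "\<gamma> c x [] = \<gamma> c' (transition c c' x) []" if "c \<in> A" "c' \<in> A" "x \<in> overlap c c'" for c c' x
    proof -
      have "\<forall>vs. \<gamma> c x vs = \<gamma> c' (transition c c' x) (map (frechet_derivative (transition c c') (at x)) vs)"
        using \<gamma>(1) that unfolding global_form_def by blast
      from this[rule_format, of "[]"] show ?thesis by simp
    qed
    show "fun_delbar (\<lambda>y. theta (h c) y w) x v = - fun_del (\<lambda>y. fun_delbar (\<lambda>x. \<gamma> c x []) y v) x w"
      if c: "c \<in> A" and x: "x \<in> cimage c" for c x v w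
    proof -
      interpret metric_chart "cimage c" "h c" by (rule metric_chart_of_metric[OF M h c])
      show ?thesis
      proof (rule theta_potential[OF x s[OF c]])
        fix v w
        have "?\<eta> c x [v, w] = form_del (form_delbar (\<gamma> c)) x [v, w]"
          using \<gamma>(2) c x by (simp add: forms_eq_def)
        then show "?\<eta> c x [v, w] = fun_del (\<lambda>y. fun_delbar (\<lambda>x. \<gamma> c x []) y w) x v - fun_del (\<lambda>y. fun_delbar (\<lambda>x. \<gamma> c x []) y v) x w"
          unfolding ext_deriv_small(2)[of fun_del] ext_deriv_small(1) .
      qed
    qed
  qed
qed

text \<open>The real part of the divergence of the field dual to \<open>\<theta>\<close> is \<open>|\<theta>|\<^sup>2\<close> plus the real part of the trace, which is
  assumed to vanish. So \<open>|\<theta>|\<^sup>2\<close> integrates to zero.\<close>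

lemma theta_eq_0_of_imaginary_trace:
  fixes A :: "('p, 'n::finite) chart set"
  assumes M: "complex_manifold X A" and comp: "compact_space X" and h: "hermitian_metric A h"
    and im: "\<And>c x. c \<in> A \<Longrightarrow> x \<in> cimage c \<Longrightarrow>
       Re (\<Sum>k\<in>UNIV. \<Sum>l\<in>UNIV. hup (h c x) k l * dzbar l (\<lambda>y. theta (h c) y (axis k 1)) x) = 0"
    and c: "c \<in> A" and x: "x \<in> cimage c"
  shows "theta (h c) x v = 0"
proof -
  note mc = metric_chart_of_metric[OF M h] and mt = metric_transition_of_metric[OF M h]
  note ch = complex_manifoldD(1)[OF M]
  define cc where "cc p = (SOME c. c \<in> A \<and> p \<in> fst c)" for p
  have cc: "cc p \<in> A" "p \<in> fst (cc p)" if "p \<in> topspace X" for p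
    using someI_ex[of "\<lambda>c. c \<in> A \<and> p \<in> fst c"] complex_manifoldD(2)[OF M that] unfolding cc_def by blast+
  \<comment> \<open>Functions on \<open>X\<close> are evaluated in a chart chosen at each point; the choice is immaterial by
    the transformation laws.\<close>
  define E where "E p = metric_chart.energy (h (cc p)) (snd (cc p) p)" for p
  define B where "B \<rho> p = metric_chart.pairing (h (cc p)) (\<lambda>y. \<rho> (cinv (cc p) y)) (snd (cc p) p)" for \<rho> p
  have inX: "cinv c x \<in> topspace X" if "c \<in> A" "x \<in> cimage c" for c x
    using cinv_facts(3)[OF ch[OF that(1)] that(2)] chart_bij(2)[OF ch[OF that(1)]] by blast
  have tr: "x \<in> overlap c (cc (cinv c x))" "transition c (cc (cinv c x)) x = snd (cc (cinv c x)) (cinv c x)" "cc (cinv c x) \<in> A"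
    if "c \<in> A" "x \<in> cimage c" for c x
  proof -
    note q = cc[OF inX[OF that]]
    show "cc (cinv c x) \<in> A" by (rule q(1))
    show "x \<in> overlap c (cc (cinv c x))" using overlap_facts(1)[OF ch[OF that(1)] ch[OF q(1)]] q(2) that(2) by blast
    show "transition c (cc (cinv c x)) x = snd (cc (cinv c x)) (cinv c x)" by (simp add: transition_def)
  qed
  have diff: "(\<lambda>y. \<rho> (cinv c y)) differentiable (at x)" if "C1_fun A \<rho>" "c \<in> A" "x \<in> cimage c" for \<rho> c x
    using that by (simp add: C1_fun_def)
  have cdiff: "(\<lambda>y. complex_of_real (\<rho> (cinv c y))) differentiable (at x)" if "C1_fun A \<rho>" "c \<in> A" "x \<in> cimage c" for \<rho> c x
    by (rule differentiable_of_real[OF diff[OF that]])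
  have E_eq: "E (cinv c x) = metric_chart.energy (h c) x" if "c \<in> A" "x \<in> cimage c" for c x
  proof -
    interpret metric_transition "cimage c" "h c" "cimage (cc (cinv c x))" "h (cc (cinv c x))" "overlap c (cc (cinv c x))" "transition c (cc (cinv c x))"
      by (rule mt[OF that(1) tr(3)[OF that]])
    show ?thesis using energy_transform[OF tr(1)[OF that]] unfolding E_def tr(2)[OF that] by simp
  qed
  have B_eq: "B \<rho> (cinv c x) = metric_chart.pairing (h c) (\<lambda>y. \<rho> (cinv c y)) x" if "C1_fun A \<rho>" "c \<in> A" "x \<in> cimage c" for \<rho> c x
  proof -
    let ?d = "cc (cinv c x)"
    note ov = overlap_facts[OF ch[OF that(2)] ch[OF tr(3)[OF that(2,3)]]]
    interpret metric_transition "cimage c" "h c" "cimage ?d" "h ?d" "overlap c ?d" "transition c ?d"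
      by (rule mt[OF that(2) tr(3)[OF that(2,3)]])
    have "src.pairing (\<lambda>y. \<rho> (cinv c y)) x = tgt.pairing (\<lambda>y. \<rho> (cinv ?d y)) (transition c ?d x)"
      by (rule pairing_transform[OF tr(1)[OF that(2,3)] diff[OF that] diff[OF that(1) tr(3)[OF that(2,3)] ov(6)[OF tr(1)[OF that(2,3)]]]])
         (simp add: ov(4))
    then show ?thesis unfolding B_def tr(2)[OF that(2,3)] by simp
  qed
  have B_point: "B \<rho> p = metric_chart.pairing (h (cc p)) (\<lambda>y. \<rho> (cinv (cc p) y)) (snd (cc p) p)" for \<rho> p by (rule B_def)
  have sndp: "snd (cc p) p \<in> cimage (cc p)" if "p \<in> topspace X" for p
    using cinv_facts(2)[OF ch[OF cc(1)[OF that]] cc(2)[OF that]] .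
  have pairing_0: "metric_chart.pairing (h c) \<rho> x = 0" if c: "c \<in> A" and U: "open U" "x \<in> U" "\<And>y. y \<in> U \<Longrightarrow> \<rho> y = k" and x: "x \<in> cimage c" for c U \<rho> x and k :: real
  proof -
    interpret metric_chart "cimage c" "h c" by (rule mc[OF c])
    have "dzbar l (\<lambda>y. complex_of_real (\<rho> y)) x = dzbar l (\<lambda>y. complex_of_real k) x" for l
      unfolding dzbar_def by (rule wirtinger_cong[OF U(1,2)]) (simp add: U(3))
    then show ?thesis by (simp add: pairing_def dzbar_def fun_delbar_gd)
  qed
  have E0: "E p = 0" if p: "p \<in> topspace X" for p
  proof (rule nonneg_divergence_eq_0[OF M comp, of "\<lambda>c x. vdens (h c x)" E B])
    fix c assume c: "c \<in> A"
    interpret metric_chart "cimage c" "h c" by (rule mc[OF c])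
    show "continuous_on (cimage c) (\<lambda>x. vdens (h c x))" by (rule smooth_map_onD(3)[OF smooth_vdens])
    show "vdens (h c x) > 0" for x by (rule vdens_pos)
    have "continuous_on (cimage c) energy"
      unfolding energy_def[abs_def]
      by (intro smooth_map_onD(3) smooth_Re smooth_sum smooth_mult smooth_cnj smooth_hup smooth_theta smooth_H inv_H open_S)
    then show "continuous_on (cimage c) (\<lambda>x. E (cinv c x))"
      by (rule continuous_on_eq) (simp add: E_eq[OF c])
    fix \<rho> assume \<rho>: "C1_fun A \<rho>"
    have "continuous_on (cimage c) (\<lambda>x. dzbar l (\<lambda>y. complex_of_real (\<rho> (cinv c y))) x)" for l
    proof -
      have "Ck_on (Suc 0) (\<lambda>x. complex_of_real (\<rho> (cinv c x))) (cimage c)"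
        using Ck_on_linear[where L = complex_of_real, OF bounded_linear_of_real open_S] \<rho> c unfolding C1_fun_def by blast
      then show ?thesis unfolding dzbar_def fun_delbar_def fun_d_def by (intro continuous_intros) auto
    qed
    then have "continuous_on (cimage c) (pairing (\<lambda>y. \<rho> (cinv c y)))"
      unfolding pairing_def[abs_def]
      by (intro continuous_on_Re continuous_on_sum continuous_on_mult)
         (auto intro!: smooth_map_onD(3) smooth_hup smooth_theta smooth_H inv_H open_S)
    then show "continuous_on (cimage c) (\<lambda>x. B \<rho> (cinv c x))"
      by (rule continuous_on_eq) (simp add: B_eq[OF \<rho> c])
    show "B \<rho> (cinv c x) = 0" if "open U" "x \<in> U" "U \<subseteq> cimage c" "\<And>y. y \<in> U \<Longrightarrow> \<rho> (cinv c y) = 0" for x U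
    proof -
      have xc: "x \<in> cimage c" using that by blast
      show ?thesis unfolding B_eq[OF \<rho> c xc] by (rule pairing_0[OF c that(1,2) that(4) xc])
    qed
    fix K assume K: "compact K" "K \<subseteq> cimage c" and supp: "\<And>p. p \<in> topspace X \<Longrightarrow> \<rho> p \<noteq> 0 \<Longrightarrow> p \<in> fst c \<and> snd c p \<in> K"
    have "cint (cimage c) (\<lambda>x. vdens (h c x) * (\<rho> (cinv c x) * energy x + pairing (\<lambda>y. \<rho> (cinv c y)) x)) = 0"
    proof (rule chart_stokes[OF im[OF c] _ K])
      show "Ck_on (Suc 0) (\<lambda>y. \<rho> (cinv c y)) (cimage c)" using \<rho> c unfolding C1_fun_def by blast
      show "\<rho> (cinv c x) = 0" if "x \<in> cimage c - K" for x
        using supp[OF inX[OF c]] cinv_facts(4)[OF ch[OF c]] that by (metis DiffD1 DiffD2)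
    qed
    then show "cint (cimage c) (\<lambda>x. vdens (h c x) * (\<rho> (cinv c x) * E (cinv c x) + B \<rho> (cinv c x))) = 0"
      by (simp add: E_eq[OF c] B_eq[OF \<rho> c] cong: cint_cong)
  next
    fix c c' x assume c: "c \<in> A" "c' \<in> A" and x: "x \<in> overlap c c'"
    interpret metric_transition "cimage c" "h c" "cimage c'" "h c'" "overlap c c'" "transition c c'" by (rule mt[OF c])
    show "vdens (h c x) = \<bar>det (rmat (J x))\<bar> * vdens (h c' (transition c c' x))" by (rule vdens_transition[OF x])
  next
    fix p assume p: "p \<in> topspace X"
    interpret metric_chart "cimage (cc p)" "h (cc p)" by (rule mc[OF cc(1)[OF p]])
    show "E p \<ge> 0" unfolding E_def energy_def by (rule hup_pos(2)[OF posdef[OF sndp[OF p]]])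
    fix I :: "nat set" and \<rho> assume I: "finite I" and \<rho>: "\<And>i. i \<in> I \<Longrightarrow> C1_fun A (\<rho> i)"
    let ?\<rho> = "\<lambda>i y. complex_of_real (\<rho> i (cinv (cc p) y))"
    have "dzbar l (\<lambda>y. complex_of_real (\<Sum>i\<in>I. \<rho> i (cinv (cc p) y))) (snd (cc p) p) = (\<Sum>i\<in>I. dzbar l (?\<rho> i) (snd (cc p) p))" for l
      unfolding dzbar_def fun_delbar_gd of_real_sum by (rule gd_sum) (rule cdiff[OF \<rho> cc(1)[OF p] sndp[OF p]])
    then show "B (\<lambda>p. \<Sum>i\<in>I. \<rho> i p) p = (\<Sum>i\<in>I. B (\<rho> i) p)"
      unfolding B_point pairing_def Re_sum[symmetric]
      by (simp add: sum_distrib_left del: Re_sum) (subst sum.swap, rule arg_cong[of _ _ Re], rule sum.cong[OF refl], rule sum.swap)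
  next
    fix \<rho> p assume "C1_fun A \<rho>" and one: "\<And>q. q \<in> topspace X \<Longrightarrow> \<rho> q = 1" and p: "p \<in> topspace X"
    show "B \<rho> p = 0" unfolding B_point
      by (rule pairing_0[OF cc(1)[OF p] chart_bij(3)[OF ch[OF cc(1)[OF p]]] sndp[OF p] _ sndp[OF p]]) (rule one[OF inX[OF cc(1)[OF p]]])
  qed (rule p)
  interpret metric_chart "cimage c" "h c" by (rule mc[OF c])
  have "energy x = 0" using E0[OF inX[OF c x]] E_eq[OF c x] by simp
  then have "theta (h c) x (axis k 1) = 0" for k
    unfolding energy_def by (rule hup_pos(3)[OF posdef[OF x]])
  then show ?thesis using theta_expand[OF x, of v] by simp
qed

lemma conformal_hermitian_metric:
  assumes M: "complex_manifold X A" and h: "hermitian_metric A h" and f: "smooth_real_function A f"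
  shows "hermitian_metric A (\<lambda>c x. exp (f (cinv c x)) *\<^sub>R h c x)"
  unfolding hermitian_metric_def
proof (intro conjI ballI allI)
  fix c assume c: "c \<in> A"
  interpret metric_chart "cimage c" "h c" by (rule metric_chart_of_metric[OF M h c])
  have "smooth_map_on (\<lambda>x. f (cinv c x)) (cimage c)" using f c by (simp add: smooth_real_function_def o_def)
  then interpret C: metric_chart "cimage c" "\<lambda>x. exp (f (cinv c x)) *\<^sub>R h c x" by (rule conformal_metric_chart)
  show "smooth_map_on (\<lambda>x. exp (f (cinv c x)) *\<^sub>R h c x) (cimage c)" by (rule C.smooth_H)
  show "hermitian_posdef (exp (f (cinv c x)) *\<^sub>R h c x)" if "x \<in> cimage c" for x by (rule C.posdef[OF that])
next
  fix c c' x v w assume c: "c \<in> A" "c' \<in> A" and x: "x \<in> overlap c c'"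
  interpret metric_transition "cimage c" "h c" "cimage c'" "h c'" "overlap c c'" "transition c c'"
    by (rule metric_transition_of_metric[OF M h c])
  have sc: "sesq (r *\<^sub>R M) v w = of_real r * sesq M v w" for r M and v w :: "complex^'b"
    by (simp add: sesq_def sum_distrib_left scaleR_complex mult_ac)
  show "sesq (exp (f (cinv c x)) *\<^sub>R h c x) v w =
      sesq (exp (f (cinv c' (transition c c' x))) *\<^sub>R h c' (transition c c' x)) (J x v) (J x w)"
    unfolding sc metric[OF x, of v w] overlap_facts(4)[OF complex_manifoldD(1)[OF M c(1)] complex_manifoldD(1)[OF M c(2)] x] ..
qed

text \<open>The conformal factor \<open>Re u / (n - 1)\<close> is a global function because \<open>u\<close> is.\<close>

lemma conformally_balanced_of_potential:
  fixes A :: "('p, 'n::finite) chart set"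
  assumes M: "complex_manifold X A" and comp: "compact_space X" and h: "hermitian_metric A h"
    and u: "\<And>c. c \<in> A \<Longrightarrow> smooth_map_on (u c) (cimage c)"
      "\<And>c c' x. c \<in> A \<Longrightarrow> c' \<in> A \<Longrightarrow> x \<in> overlap c c' \<Longrightarrow> u c x = u c' (transition c c' x)"
      "\<And>c x v w. c \<in> A \<Longrightarrow> x \<in> cimage c \<Longrightarrow> fun_delbar (\<lambda>y. theta (h c) y w) x v = - fun_del (\<lambda>y. fun_delbar (u c) y v) x w"
  shows "conformally_balanced A h"
proof (cases "CARD('n) = 1")
  case True
  \<comment> \<open>In dimension one every metric is balanced, because \<open>\<omega>\<^sup>0\<close> is constant.\<close>
  have "smooth_real_function A (\<lambda>_. 0)" by (simp add: smooth_real_function_def o_def smooth_const)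
  moreover have "balanced A h'" for h'
    using True by (simp add: balanced_def forms_eq_def fun_eq_iff ext_deriv_def zero_form_def[abs_def] fun_d_gd)
  ultimately show ?thesis unfolding conformally_balanced_def by blast
next
  case False
  note ch = complex_manifoldD(1)[OF M]
  define cc where "cc p = (SOME c. c \<in> A \<and> p \<in> fst c)" for p
  define f where "f p = Re (u (cc p) (snd (cc p) p)) / (real CARD('n) - 1)" for p
  have f_eq: "f (cinv c x) = Re (u c x) / (real CARD('n) - 1)" if c: "c \<in> A" and x: "x \<in> cimage c" for c x
  proof -
    let ?d = "cc (cinv c x)"
    have inX: "cinv c x \<in> topspace X" using cinv_facts(3)[OF ch[OF c] x] chart_bij(2)[OF ch[OF c]] by blast
    have d: "?d \<in> A" "cinv c x \<in> fst ?d"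
      using someI_ex[of "\<lambda>c'. c' \<in> A \<and> cinv c x \<in> fst c'"] complex_manifoldD(2)[OF M inX] unfolding cc_def by blast+
    then have "x \<in> overlap c ?d" using overlap_facts(1)[OF ch[OF c] ch[OF d(1)]] x by blast
    from u(2)[OF c d(1) this] show ?thesis by (simp add: f_def transition_def)
  qed
  have sf: "smooth_real_function A f"
    unfolding smooth_real_function_def
  proof
    fix c assume c: "c \<in> A"
    note op = chart_bij(3)[OF ch[OF c]]
    have "smooth_map_on (\<lambda>x. Re (u c x) / (real CARD('n) - 1)) (cimage c)"
      using False by (intro smooth_divide smooth_Re smooth_const u(1) c op) simp
    then show "smooth_map_on (f \<circ> cinv c) (cimage c)"
      by (subst smooth_map_on_cong[OF op]) (simp_all add: f_eq[OF c])
  qed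
  let ?h = "\<lambda>c x. exp (f (cinv c x)) *\<^sub>R h c x"
  have hf: "hermitian_metric A ?h" by (rule conformal_hermitian_metric[OF M h sf])
  have th_cong: "theta H x v = theta H' x v" if "open U" "x \<in> U" "\<And>y. y \<in> U \<Longrightarrow> H y = H' y" for H H' and U :: "(complex^'n) set" and x v
  proof -
    have d: "fun_del (\<lambda>y. sesq (H y) a b) x c = fun_del (\<lambda>y. sesq (H' y) a b) x c" for a b c
      by (rule wirtinger_cong[OF that(1,2)]) (simp only: that(3))
    show ?thesis unfolding theta_def torsion_def d that(3)[OF that(2)] ..
  qed
  have im: "Re (\<Sum>k\<in>UNIV. \<Sum>l\<in>UNIV. hup (?h c x) k l * dzbar l (\<lambda>y. theta (?h c) y (axis k 1)) x) = 0"
    if c: "c \<in> A" and x: "x \<in> cimage c" for c x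
  proof -
    interpret metric_chart "cimage c" "h c" by (rule metric_chart_of_metric[OF M h c])
    let ?h' = "\<lambda>y. exp (Re (u c y) / (real CARD('n) - 1)) *\<^sub>R h c y"
    have eq: "?h c y = ?h' y" if "y \<in> cimage c" for y by (simp add: f_eq[OF c that])
    have "dzbar l (\<lambda>y. theta (?h c) y (axis k 1)) x = dzbar l (\<lambda>y. theta ?h' y (axis k 1)) x" for k l
      unfolding dzbar_def by (rule wirtinger_cong[OF open_S x]) (rule th_cong[OF open_S _ eq])
    then show ?thesis
      using conformal_trace_imaginary[OF u(1)[OF c] u(3)[OF c] False x] by (simp add: eq[OF x])
  qed
  have "balanced A ?h"
    unfolding balanced_def forms_eq_def
  proof (intro ballI ext)
    fix c x vs assume c: "c \<in> A" and x: "x \<in> cimage c"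
    interpret metric_chart "cimage c" "?h c" by (rule metric_chart_of_metric[OF M hf c])
    show "form_d (wedge_power (form11 (?h c)) (CARD('n) - 1)) x vs = 0"
      by (rule theta_zero_imp_balanced[OF x theta_eq_0_of_imaginary_trace[OF M comp hf im c x]])
  qed
  then show ?thesis using sf unfolding conformally_balanced_def by blast
qed

text \<open>The metric on the canonical bundle is \<open>exp (- Re u) / det h\<close>: its logarithm is pluriharmonic up to sign, \<open>1 / det h\<close>
  transforms as a metric on that bundle, and \<open>u\<close> is a function.\<close>

lemma unitary_flat_of_potential:
  fixes A :: "('p, 'n::finite) chart set"
  assumes M: "complex_manifold X A" and h: "hermitian_metric A h" and flat: "levi_civita_ricci_flat A h"
    and u: "\<And>c. c \<in> A \<Longrightarrow> smooth_map_on (u c) (cimage c)"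
      "\<And>c c' x. c \<in> A \<Longrightarrow> c' \<in> A \<Longrightarrow> x \<in> overlap c c' \<Longrightarrow> u c x = u c' (transition c c' x)"
      "\<And>c x v w. c \<in> A \<Longrightarrow> x \<in> cimage c \<Longrightarrow> fun_delbar (\<lambda>y. theta (h c) y w) x v = - fun_del (\<lambda>y. fun_delbar (u c) y v) x w"
  shows "unitary_flat A canonical_bundle"
  unfolding unitary_flat_def
proof (intro exI conjI)
  let ?g = "\<lambda>c x. exp (- Re (u c x)) / Re (det (h c x))"
  show "line_bundle_metric A canonical_bundle ?g"
    unfolding line_bundle_metric_def
  proof (intro conjI ballI)
    fix c assume c: "c \<in> A"
    interpret metric_chart "cimage c" "h c" by (rule metric_chart_of_metric[OF M h c])
    have pos: "Re (det (h c x)) > 0" if "x \<in> cimage c" for x by (rule det_hermitian_pos(1)[OF posdef[OF that]])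
    show "smooth_map_on (?g c) (cimage c)"
      by (intro smooth_divide smooth_exp smooth_minus smooth_Re smooth_det open_S u(1) c smooth_entry) (use pos in force)
    show "?g c x > 0" if "x \<in> cimage c" for x using pos[OF that] by simp
  next
    fix c c' x assume c: "c \<in> A" "c' \<in> A" and x: "x \<in> overlap c c'"
    interpret metric_transition "cimage c" "h c" "cimage c'" "h c'" "overlap c c'" "transition c c'"
      by (rule metric_transition_of_metric[OF M h c])
    have "Re (det (h c x)) > 0" by (rule det_hermitian_pos(1)[OF src.posdef[OF inW[OF x]]])
    then have "cmod (det (matrix (J x))) \<noteq> 0" unfolding det_transition[OF x] by auto
    then show "?g c' (transition c c' x) = (cmod (canonical_bundle c c' x))\<^sup>2 * ?g c x"
      unfolding canonical_bundle_def det_transition[OF x] u(2)[OF c x] by simp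
  qed
  show "forms_eq A (chern_curvature ?g) zero_forms"
    unfolding forms_eq_def
  proof (intro ballI ext)
    fix c x vs assume c: "c \<in> A" and x: "x \<in> cimage c"
    interpret metric_chart "cimage c" "h c" by (rule metric_chart_of_metric[OF M h c])
    let ?\<phi> = "\<lambda>y. complex_of_real (ln (?g c y))"
    let ?\<psi> = "\<lambda>y. logdet y + of_real (Re (u c y))"
    have fl: "lc_ricci (h c) y = (\<lambda>vs. 0)" if "y \<in> cimage c" for y
      using flat c that by (simp add: levi_civita_ricci_flat_def forms_eq_def)
    have \<phi>: "?\<phi> y = - ?\<psi> y" if "y \<in> cimage c" for y
      using det_hermitian_pos(1)[OF posdef[OF that]] by (simp add: ln_div logdet_def)
    have s\<psi>: "smooth_map_on ?\<psi> (cimage c)" by (intro smooth_add smooth_logdet smooth_of_real smooth_Re u(1) c open_S)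
    have 0: "fun_delbar (\<lambda>y. fun_del ?\<phi> y w) x v = 0" for v w
    proof -
      have "fun_del ?\<phi> y w = - fun_del ?\<psi> y w" if y: "y \<in> cimage c" for y
      proof -
        have "fun_del ?\<phi> y w = fun_del (\<lambda>y. - ?\<psi> y) y w" by (rule wirtinger_cong[OF open_S y \<phi>])
        then show ?thesis unfolding fun_del_gd gd_minus[OF smooth_map_onD(1)[OF s\<psi> y]] .
      qed
      then have "fun_delbar (\<lambda>y. fun_del ?\<phi> y w) x v = fun_delbar (\<lambda>y. - fun_del ?\<psi> y w) x v"
        by (rule wirtinger_cong[OF open_S x])
      also have "\<dots> = - fun_delbar (\<lambda>y. fun_del ?\<psi> y w) x v"
        unfolding fun_delbar_gd fun_del_gd by (rule gd_minus[OF smooth_map_onD(1)[OF smooth_gd[OF open_S s\<psi>] x]])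
      also have "\<dots> = 0" using pluriharmonic_potential[OF x fl[OF x] u(1)[OF c] u(3)[OF c x]] by simp
      finally show ?thesis .
    qed
    have deg: "of_degree 1 (form_del (zero_form ?\<phi>) y)" for y
      using ext_deriv_degree[where D = fun_del and \<eta> = "zero_form ?\<phi>" and k = 0 and x = y, OF _ D_zero(2)]
      by (simp add: of_degree_def zero_form_def)
    show "chern_curvature ?g c x vs = 0"
    proof (cases "length vs = 2")
      case True
      then obtain v w where vs: "vs = [v, w]" by (auto simp: length_Suc_conv numeral_2_eq_2)
      show ?thesis
        unfolding chern_curvature_def vs ext_deriv_small(2)[of fun_delbar] ext_deriv_small(1)
        by (simp add: zero_form_def 0)
    next
      case False
      then show ?thesis
        using ext_deriv_degree[where D = fun_delbar and \<eta> = "form_del (zero_form ?\<phi>)" and k = 1 and x = x, OF deg D_zero(3)]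
        by (simp add: chern_curvature_def of_degree_def numeral_2_eq_2)
    qed
  qed
qed

theorem theorem5p4:
  fixes X :: "'p topology" and A :: "('p, 'n::finite) chart set"
    and h :: "('p, 'n) chart \<Rightarrow> complex^'n \<Rightarrow> complex^'n^'n"
  assumes "complex_manifold X A" and "compact_space X"
    and "hermitian_metric A h"
    and "levi_civita_ricci_flat A h"
    and "ddbar_lemma A"
  shows "conformally_balanced A h \<and> unitary_flat A canonical_bundle"
proof -
  obtain u where u: "\<And>c. c \<in> A \<Longrightarrow> smooth_map_on (u c) (cimage c)"
    "\<And>c c' x. c \<in> A \<Longrightarrow> c' \<in> A \<Longrightarrow> x \<in> overlap c c' \<Longrightarrow> u c x = u c' (transition c c' x)"
    "\<And>c x v w. c \<in> A \<Longrightarrow> x \<in> cimage c \<Longrightarrow> fun_delbar (\<lambda>y. theta (h c) y w) x v = - fun_del (\<lambda>y. fun_delbar (u c) y v) x w"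
    using ddbar_potential[OF assms(1,3,4,5)] by blast
  show ?thesis
    using conformally_balanced_of_potential[OF assms(1,2,3) u] unitary_flat_of_potential[OF assms(1,3,4) u] by blast
qed

end
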